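(* Let $X$ be an SMD random variable such that $K_{2n}(X)K_{2n+2}(X)<0$ for every integer $n\ge1$. If $Y$ is a centred real random variable admitting moments of all orders such that $K_4(Y)K_4(X)>0$ and $\mathit{mmse}(X,s)=\mathit{mmse}(Y,s)$ for all $s>0$, then $X$ and $Y$ have the same distribution.
   Context: For a real random variable $X$ with moments of all orders, its cumulants are $K_n(X)=(-i)^n(\ln\varphi_X)^{(n)}(0)$, $\varphi_X$ the characteristic function. $X$ is called SMD if $X$ and $-X$ have the same law, $X$ has moments of all orders, and any random variable $Y$ with $\mathbb{E}[Y^p]=\mathbb{E}[X^p]$ for all $p\ge1$ has the same law as $X$. For $s>0$, $\mathit{mmse}(X,s)=\mathbb{E}[(X-\mathbb{E}[X\mid Y_s])^2]$ where $Y_s=\sqrt{s}X+N$ and $N$ is a standard Gaussian independent of $X$. *)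

theory Defs
  imports "HOL-Probability.Probability"
begin

text \<open>All notions are defined on the law (a real measure) of a random variable.\<close>

definition nth_vderiv :: "nat \<Rightarrow> (real \<Rightarrow> complex) \<Rightarrow> real \<Rightarrow> complex" where
  "nth_vderiv n f = ((\<lambda>g t. vector_derivative g (at t)) ^^ n) f"

text \<open>Cumulant K_n = (-i)^n (ln phi)^(n)(0), phi the characteristic function
  (real-valued for real laws with moments of all orders; we take the real part).\<close>
definition cumulant :: "real measure \<Rightarrow> nat \<Rightarrow> real" where
  "cumulant \<mu> n = Re ((- \<i>) ^ n * nth_vderiv n (\<lambda>t. Ln (char \<mu> t)) 0)"

definition real_law :: "real measure \<Rightarrow> bool" where
  "real_law \<mu> \<longleftrightarrow> prob_space \<mu> \<and> sets \<mu> = sets borel"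

definition all_moments :: "real measure \<Rightarrow> bool" where
  "all_moments \<mu> \<longleftrightarrow> (\<forall>n::nat. integrable \<mu> (\<lambda>x. x ^ n))"

definition SMD :: "real measure \<Rightarrow> bool" where
  "SMD \<mu> \<longleftrightarrow> real_law \<mu> \<and> distr \<mu> borel uminus = \<mu> \<and> all_moments \<mu> \<and>
     (\<forall>\<nu>. real_law \<nu> \<and> (\<forall>p::nat\<ge>1. integrable \<nu> (\<lambda>x. x ^ p) \<and>
            (\<integral>x. x ^ p \<partial>\<nu>) = (\<integral>x. x ^ p \<partial>\<mu>)) \<longrightarrow> \<nu> = \<mu>)"

text \<open>mmse(X,s) = E[(X - E[X | Y_s])^2] with Y_s = sqrt s X + N, N standard Gaussian
  independent of X; realised on the product space law(X) \<otimes> N(0,1).\<close>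
definition mmse :: "real measure \<Rightarrow> real \<Rightarrow> real" where
  "mmse \<mu> s =
     (let P = \<mu> \<Otimes>\<^sub>M std_normal_distribution;
          Ys = (\<lambda>z. sqrt s * fst z + snd z);
          F = vimage_algebra (space P) Ys borel
      in \<integral>z. (fst z - real_cond_exp P F fst z)\<^sup>2 \<partial>P)"

end

theory Submission
  imports Defs "HOL-Computational_Algebra.Formal_Power_Series"
begin

text \<open>
  Put \<open>\<epsilon> = \<surd>s\<close>. The density of \<open>\<epsilon> X + N\<close> relative to that of \<open>N\<close> has the formal expansion
  \<open>W = \<Sum> E X\<^sup>n \<epsilon>\<^sup>n He\<^sub>n / n!\<close>, and \<open>V = W' / W\<close> represents \<open>\<epsilon> E (X | \<epsilon> X + N)\<close>. The truncations of \<open>V\<close> are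
  polynomial estimators whose error is computed exactly from the moments, and they are optimal up to
  \<open>O(\<epsilon>\<^sup>2\<^sup>m\<^sup>+\<^sup>2)\<close>; hence \<open>\<epsilon>\<^sup>2 mmse(X, \<epsilon>\<^sup>2)\<close> has the asymptotic expansion of
  \<open>\<epsilon>\<^sup>2 E X\<^sup>2 - E (V\<^sup>2 W)\<close>, and the coefficients of the latter agree for \<open>X\<close> and \<open>Y\<close>.

  Suppose the moments of order below \<open>k\<close> agree and let \<open>d\<close> be the difference of the \<open>k\<close>-th ones. The coefficient of
  \<open>\<epsilon>\<^sup>2\<^sup>k\<close> gives \<open>d (2 K\<^sub>k + d) = 0\<close>, so \<open>d = 0\<close> or the \<open>k\<close>-th cumulant changes sign. For odd \<open>k\<close> we have
  \<open>K\<^sub>k = 0\<close>, and for \<open>k = 4\<close> a change of sign is excluded by assumption. For even \<open>k \<ge> 6\<close> the next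
  coefficient, that of \<open>\<epsilon>\<^sup>2\<^sup>k\<^sup>+\<^sup>2\<close>, would be a nonnegative number plus a positive combination of the products
  \<open>K\<^sub>i K\<^sub>j K\<^sub>k\<close> with \<open>i + j = k + 2\<close> and \<open>i, j \<ge> 4\<close> even, all of which are positive because the even cumulants of \<open>X\<close>
  alternate in sign.
\<close>

subsection \<open>Gaussian expectation of polynomials and Hermite polynomials\<close>

text \<open>The formal series need not converge, and X need not have exponential moments. Every
  estimate therefore works with polynomials at a fixed order, for which the Gaussian integrals are
  exact, and divides by the true density of the observation only through a lower bound uniform in y
  (Jensen's inequality, which uses centring). On the algebraic side, the top-degree coefficients of
  y V form t (log M)', with M the moment generating series; this is how cumulants enter. At order 2k
  only top-degree coefficients contribute. At order 2k + 2 one coefficient of V below the top is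
  needed, and the Burgers equation for V turns it into a top-degree coefficient of V * V. The
  unknown differences of the moments of order k + 1 and k + 2 also occur there: the former only
  multiplies K_(k+1) = 0 and forms a square, the latter disappears by orthogonality. Inserting d = -
  2 K_k cancels exactly the products that contain K_2, so that the alternating signs decide.\<close>

definition gauss_ex :: "real poly \<Rightarrow> real" where
  "gauss_ex p = (\<integral>x. poly p x \<partial>std_normal_distribution)"

lemma integrable_std_normal_poly: "integrable std_normal_distribution (poly p)"
proof -
  have "integrable std_normal_distribution (\<lambda>x. \<Sum>i\<le>degree p. coeff p i * x ^ i)"
    by (intro Bochner_Integration.integrable_sum integrable_mult_right
          integrable_std_normal_distribution_moment)
  then show ?thesis
    by (simp add: poly_altdef[abs_def])
qed

lemma gauss_ex_0 [simp]: "gauss_ex 0 = 0"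
  by (simp add: gauss_ex_def)

lemma gauss_ex_add: "gauss_ex (p + q) = gauss_ex p + gauss_ex q"
  by (simp add: gauss_ex_def integrable_std_normal_poly)

lemma gauss_ex_diff: "gauss_ex (p - q) = gauss_ex p - gauss_ex q"
  by (simp add: gauss_ex_def integrable_std_normal_poly)

lemma gauss_ex_smult: "gauss_ex (smult c p) = c * gauss_ex p"
  by (simp add: gauss_ex_def)

lemma gauss_ex_sum: "gauss_ex (\<Sum>i\<in>A. f i) = (\<Sum>i\<in>A. gauss_ex (f i))"
  by (induction A rule: infinite_finite_induct) (simp_all add: gauss_ex_add)

lemma gauss_ex_square_nonneg: "gauss_ex (p * p) \<ge> 0"
  by (simp add: gauss_ex_def)

lemma gauss_ex_1: "gauss_ex 1 = 1"
  using std_normal_distribution_even_moments[of 0] by (simp add: gauss_ex_def)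

text \<open>Stein's identity on monomials, read off from the closed form of the even moments; for
  odd \<open>n\<close> both sides vanish.\<close>

lemma std_normal_moment_Suc_Suc:
  "(\<integral>x. x ^ Suc (Suc n) \<partial>std_normal_distribution)
     = real (Suc n) * (\<integral>x. x ^ n \<partial>std_normal_distribution)"
proof (cases "even n")
  case True
  then obtain k where n: "n = 2 * k" by (auto elim: evenE)
  have "(\<integral>x. x ^ (2 * Suc k) \<partial>std_normal_distribution) = fact (2 * Suc k) / (2 ^ Suc k * fact (Suc k))"
    by (rule std_normal_distribution_even_moments(1))
  also have "\<dots> = real (Suc n) * (fact (2 * k) / (2 ^ k * fact k))"
  proof -
    have "real (Suc k) \<noteq> 0" by simp
    then show ?thesis
      unfolding n by (simp add: divide_simps del: of_nat_Suc) (simp add: algebra_simps)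
  qed
  also have "fact (2 * k) / (2 ^ k * fact k) = (\<integral>x. x ^ (2 * k) \<partial>std_normal_distribution)"
    by (rule std_normal_distribution_even_moments(1)[symmetric])
  finally show ?thesis by (simp add: n)
next
  case False
  then show ?thesis
    using integral_std_normal_distribution_moment_odd[of n]
      integral_std_normal_distribution_moment_odd[of "Suc (Suc n)"] by simp
qed

lemma gauss_ex_stein_monom: "gauss_ex (pderiv (monom c n)) = gauss_ex ([:0, 1:] * monom c n)"
proof (cases n)
  case 0
  then show ?thesis
    using integral_std_normal_distribution_moment_odd[of 1]
    by (simp add: gauss_ex_def pderiv_monom poly_monom mult.commute)
next
  case (Suc k)
  have "gauss_ex (pderiv (monom c n)) = real n * c * (\<integral>x. x ^ k \<partial>std_normal_distribution)"
    unfolding gauss_ex_def pderiv_monom poly_monom Suc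
    by (subst integral_mult_right_zero[symmetric]) simp
  also have "\<dots> = c * (\<integral>x. x ^ Suc (Suc k) \<partial>std_normal_distribution)"
    unfolding std_normal_moment_Suc_Suc Suc by simp
  also have "\<dots> = gauss_ex ([:0, 1:] * monom c n)"
  proof -
    have "poly ([:0, 1:] * monom c (Suc k)) = (\<lambda>x. c * x ^ Suc (Suc k))"
      by (auto simp: poly_monom fun_eq_iff)
    then show ?thesis
      unfolding gauss_ex_def Suc by (simp only: integral_mult_right_zero)
  qed
  finally show ?thesis .
qed

lemma pderiv_sum: "pderiv (\<Sum>i\<in>A. f i) = (\<Sum>i\<in>A. pderiv (f i))"
  by (induction A rule: infinite_finite_induct) (simp_all add: pderiv_add)

text \<open>Gaussian integration by parts, extended linearly from monomials. It makes multiplication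
  by y minus differentiation the adjoint of \<open>pderiv\<close>; all later pairings rest on
  this.\<close>

lemma gauss_ex_stein: "gauss_ex (pderiv p) = gauss_ex ([:0, 1:] * p)"
proof -
  have "gauss_ex (pderiv (\<Sum>i\<le>degree p. monom (coeff p i) i))
      = gauss_ex ([:0, 1:] * (\<Sum>i\<le>degree p. monom (coeff p i) i))"
    unfolding pderiv_sum sum_distrib_left gauss_ex_sum gauss_ex_stein_monom ..
  then show ?thesis
    by (simp only: poly_as_sum_of_monoms)
qed

text \<open>The normalisation is \<open>He\<^sub>n / n!\<close>, i.e. the coefficients of \<open>exp (t y - t\<^sup>2 / 2)\<close> in \<open>t\<close>.\<close>
primrec hermite :: "nat \<Rightarrow> real poly" where
  "hermite 0 = 1"
| "hermite (Suc n) = smult (1 / real (Suc n)) ([:0, 1:] * hermite n - pderiv (hermite n))"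

lemma hermite_Suc_mult:
  "smult (real (Suc n)) (hermite (Suc n)) = [:0, 1:] * hermite n - pderiv (hermite n)"
  by (simp del: of_nat_Suc)

text \<open>In the generating function exp (t y - t^2 / 2), differentiation in y is multiplication
  by t, so the factorial normalisation leaves no constant.\<close>

lemma pderiv_hermite_Suc: "pderiv (hermite (Suc n)) = hermite n"
proof (induction n)
  case 0
  show ?case by (simp add: pderiv_pCons)
next
  case (Suc n)
  have "smult (real (Suc (Suc n))) (pderiv (hermite (Suc (Suc n)))) =
      pderiv ([:0, 1:] * hermite (Suc n) - pderiv (hermite (Suc n)))"
    unfolding hermite_Suc_mult[symmetric] pderiv_smult ..
  also have "\<dots> = hermite (Suc n) + ([:0, 1:] * hermite n - pderiv (hermite n))"
    unfolding pderiv_diff pderiv_mult Suc by (simp add: pderiv_pCons)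
  also have "\<dots> = smult (real (Suc (Suc n))) (hermite (Suc n))"
    unfolding hermite_Suc_mult[symmetric] of_nat_Suc[of "Suc n"] smult_add_left[of 1]
    by (simp only: smult_1_left)
  finally show ?case
    by (metis of_nat_eq_0_iff nat.simps(3) smult_cancel)
qed

text \<open>Hermite polynomials are eigenvectors of the Ornstein-Uhlenbeck operator. The eigenvalue
  equals the order at which \<open>hermite n\<close> occurs in \<open>noisy_density\<close>, which
  yields the differential equation \<open>euler_noisy_density\<close>.\<close>

lemma hermite_eigen:
  "[:0, 1:] * pderiv (hermite n) - pderiv (pderiv (hermite n)) = smult (real n) (hermite n)"
proof (cases n)
  case (Suc m)
  show ?thesis
    unfolding Suc pderiv_hermite_Suc hermite_Suc_mult ..
qed simp

lemma coeff_hermite_gt: "n < i \<Longrightarrow> coeff (hermite n) i = 0"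
proof (induction n arbitrary: i)
  case (Suc n)
  then obtain j where "i = Suc j" "n < j" by (cases i) auto
  with Suc.IH show ?case by (simp add: coeff_pderiv)
qed (simp add: coeff_eq_0)

lemma degree_hermite: "degree (hermite n) \<le> n"
  by (rule degree_le) (simp add: coeff_hermite_gt)

lemma coeff_hermite_self: "coeff (hermite n) n = 1 / fact n"
proof (induction n)
  case (Suc n)
  then show ?case by (simp add: coeff_pderiv coeff_hermite_gt)
qed simp

section \<open>Orthogonality relations of the Hermite polynomials\<close>

lemma gauss_ex_hermite_Suc:
  "real (Suc j) * gauss_ex (hermite (Suc j) * p) = gauss_ex (hermite j * pderiv p)"
proof -
  have "real (Suc j) * gauss_ex (hermite (Suc j) * p)
      = gauss_ex (([:0, 1:] * hermite j - pderiv (hermite j)) * p)"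
    unfolding hermite_Suc_mult[symmetric] mult_smult_left gauss_ex_smult ..
  also have "\<dots> = gauss_ex ([:0, 1:] * (hermite j * p)) - gauss_ex (pderiv (hermite j) * p)"
    by (simp only: gauss_ex_diff[symmetric] algebra_simps)
  also have "\<dots> = gauss_ex (hermite j * pderiv p)"
    unfolding gauss_ex_stein[symmetric] pderiv_mult gauss_ex_add by (simp add: mult.commute)
  finally show ?thesis .
qed

text \<open>Each integration by parts moves a derivative onto \<open>p\<close>; after
  \<open>j\<close> of them only the leading coefficient is left, times j!, which the normalisation
  cancels. Smaller degrees give orthogonality.\<close>

lemma gauss_ex_hermite_lead: "degree p \<le> j \<Longrightarrow> gauss_ex (hermite j * p) = coeff p j"
proof (induction j arbitrary: p)
  case 0
  then obtain a where "p = [:a:]" by (metis degree_0_id le_zero_eq)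
  then show ?case using gauss_ex_smult[of a 1] gauss_ex_1 by simp
next
  case (Suc j)
  have "real (Suc j) * gauss_ex (hermite (Suc j) * p) = coeff (pderiv p) j"
    unfolding gauss_ex_hermite_Suc using Suc by (simp add: degree_pderiv)
  then show ?case unfolding coeff_pderiv by simp
qed

lemma gauss_ex_hermite_0: "degree p < j \<Longrightarrow> gauss_ex (hermite j * p) = 0"
  using gauss_ex_hermite_lead[of p j] by (simp add: coeff_eq_0)

lemma gauss_ex_hermite_square: "gauss_ex (hermite n * hermite n) = 1 / fact n"
  using gauss_ex_hermite_lead[OF degree_hermite] by (simp add: coeff_hermite_self)

lemma gauss_ex_y_hermite_hermite:
  "gauss_ex ([:0, 1:] * hermite (Suc n) * hermite n) = 1 / fact n"
proof -
  have "gauss_ex (hermite (Suc n) * ([:0, 1:] * hermite n)) = coeff ([:0, 1:] * hermite n) (Suc n)"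
    by (rule gauss_ex_hermite_lead) (intro degree_le, auto simp: coeff_pCons coeff_hermite_gt split: nat.splits)
  also have "\<dots> = 1 / fact n" by (simp add: coeff_hermite_self)
  finally show ?thesis by (simp only: mult_ac)
qed

text \<open>Two integrations by parts replace \<open>hermite 2\<close> by half the second derivative
  of the square; the part containing \<open>hermite (Suc n)\<close> then vanishes by degree.\<close>

lemma gauss_ex_hermite2_square:
  "gauss_ex (hermite 2 * (hermite (Suc n) * hermite (Suc n))) = 1 / fact n"
proof -
  let ?g = "hermite (Suc n) * hermite (Suc n)"
  have "2 * gauss_ex (hermite 2 * ?g) = gauss_ex (hermite 1 * pderiv ?g)"
    using gauss_ex_hermite_Suc[of 1 ?g] by (simp add: numeral_2_eq_2 del: hermite.simps)
  also have "\<dots> = gauss_ex (pderiv (pderiv ?g))"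
    using gauss_ex_hermite_Suc[of 0 "pderiv ?g"] by simp
  also have "pderiv (pderiv ?g)
      = smult 2 (hermite n * hermite n) + smult 2 (hermite (Suc n) * pderiv (hermite n))"
    unfolding pderiv_mult pderiv_hermite_Suc pderiv_add
    unfolding one_add_one[symmetric] smult_add_left
    by (simp add: algebra_simps del: hermite.simps one_add_one)
  also have "gauss_ex \<dots> = 2 / fact n"
  proof -
    have "degree (pderiv (hermite n)) < Suc n"
      using degree_hermite[of n] by (simp add: degree_pderiv)
    then show ?thesis
      unfolding gauss_ex_add gauss_ex_smult by (simp add: gauss_ex_hermite_square gauss_ex_hermite_0 del: hermite.simps)
  qed
  finally show ?thesis by simp
qed

subsection \<open>Formal expansion of the conditional mean\<close>

definition yderiv :: "real poly fps \<Rightarrow> real poly fps" where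
  "yderiv A = Abs_fps (\<lambda>n. pderiv (fps_nth A n))"

lemma yderiv_nth [simp]: "fps_nth (yderiv A) n = pderiv (fps_nth A n)"
  by (simp add: yderiv_def)

lemma yderiv_add: "yderiv (A + B) = yderiv A + yderiv B"
  by (rule fps_ext) (simp add: pderiv_add)

lemma yderiv_diff: "yderiv (A - B) = yderiv A - yderiv B"
  by (rule fps_ext) (simp add: pderiv_diff)

lemma yderiv_mult: "yderiv (A * B) = yderiv A * B + A * yderiv B"
  by (rule fps_ext) (simp add: fps_mult_nth pderiv_sum pderiv_mult sum.distrib mult.commute[of "pderiv _"])

abbreviation yvar :: "real poly fps" where
  "yvar \<equiv> fps_const [:0, 1:]"

lemma yvar_square_nth:
  "fps_nth ((yvar * A) * (yvar * A)) n = pCons 0 (pCons 0 (fps_nth (A * A) n))"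
proof -
  have "(yvar * A) * (yvar * A) = fps_const ([:0, 1:] * [:0, 1:]) * (A * A)"
    unfolding fps_const_mult[symmetric] by (simp add: mult_ac)
  then show ?thesis by (simp only: fps_mult_left_const_nth) simp
qed

lemma yderiv_yvar [simp]: "yderiv yvar = 1"
  by (rule fps_ext) (simp add: pderiv_pCons)

definition euler :: "'a::comm_ring_1 fps \<Rightarrow> 'a fps" where
  "euler A = fps_X * fps_deriv A"

lemma euler_nth [simp]: "fps_nth (euler A) n = of_nat n * fps_nth A n"
  by (cases n) (simp_all add: euler_def)

lemma euler_mult: "euler (A * B) = euler A * B + A * euler B"
  by (simp add: euler_def algebra_simps)

lemma euler_yderiv: "euler (yderiv A) = yderiv (euler A)"
  by (rule fps_ext) (simp add: pderiv_mult)

text \<open>With \<open>a\<^sub>n = E X\<^sup>n\<close> and the formal variable standing for \<open>\<epsilon> = \<surd>s\<close>, \<open>noisy_density a\<close> is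
  the density of \<open>\<epsilon> X + N\<close> relative to that of \<open>N\<close>, and \<open>cond_mean a\<close>, its logarithmic
  derivative, is \<open>\<epsilon> E (X | \<epsilon> X + N = y)\<close>.\<close>

definition noisy_density :: "(nat \<Rightarrow> real) \<Rightarrow> real poly fps" where
  "noisy_density a = Abs_fps (\<lambda>n. smult (a n) (hermite n))"

definition cond_mean :: "(nat \<Rightarrow> real) \<Rightarrow> real poly fps" where
  "cond_mean a = yderiv (noisy_density a) * fps_right_inverse (noisy_density a) 1"

text \<open>Order \<open>n\<close> of E (V^2 W). The factor W converts the Gaussian expectation into
  one under the law of the observation, so this is the expansion of the second moment of the
  conditional mean of \<epsilon> X.\<close>

definition cond_energy :: "(nat \<Rightarrow> real) \<Rightarrow> nat \<Rightarrow> real" where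
  "cond_energy a n = gauss_ex (fps_nth (cond_mean a * cond_mean a * noisy_density a) n)"

lemma noisy_density_nth: "fps_nth (noisy_density a) n = smult (a n) (hermite n)"
  by (simp add: noisy_density_def)

lemma noisy_density_cond_mean:
  assumes "a 0 = 1"
  shows "noisy_density a * cond_mean a = yderiv (noisy_density a)"
proof -
  have "noisy_density a * fps_right_inverse (noisy_density a) 1 = 1"
    by (rule fps_right_inverse) (simp add: noisy_density_nth assms)
  then show ?thesis by (simp add: cond_mean_def mult.left_commute)
qed

lemma euler_noisy_density:
  "euler (noisy_density a) = yvar * yderiv (noisy_density a) - yderiv (yderiv (noisy_density a))"
proof (rule fps_ext)
  fix n
  have "fps_nth (yvar * yderiv (noisy_density a) - yderiv (yderiv (noisy_density a))) n
      = smult (a n) ([:0, 1:] * pderiv (hermite n) - pderiv (pderiv (hermite n)))"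
    by (simp add: noisy_density_nth pderiv_smult smult_diff_right)
  also have "\<dots> = fps_nth (euler (noisy_density a)) n"
    unfolding hermite_eigen by (simp add: noisy_density_nth of_nat_poly mult.commute)
  finally show "fps_nth (euler (noisy_density a)) n
      = fps_nth (yvar * yderiv (noisy_density a) - yderiv (yderiv (noisy_density a))) n" ..
qed

text \<open>The noisy density solves the heat equation in self-similar variables; its logarithmic
  derivative therefore solves a Burgers equation.\<close>

lemma euler_cond_mean:
  assumes "a 0 = 1"
  defines "V \<equiv> cond_mean a"
  shows "euler V = V + yvar * yderiv V - yderiv (V * V) - yderiv (yderiv V)"
proof -
  define W where "W = noisy_density a"
  have WV: "yderiv W = W * V"
    using noisy_density_cond_mean[of a, OF assms(1)] by (simp add: W_def V_def)
  have W2: "yderiv (yderiv W) = W * V * V + W * yderiv V"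
    by (simp add: WV yderiv_mult)
  have W3: "yderiv (yderiv (yderiv W)) = W * V * V * V + 3 * (W * V * yderiv V) + W * yderiv (yderiv V)"
    unfolding W2 yderiv_add yderiv_mult WV by (simp add: algebra_simps)
  have eW: "euler W = yvar * yderiv W - yderiv (yderiv W)"
    by (simp add: W_def euler_noisy_density)
  have "euler W * V + W * euler V = euler (yderiv W)"
    unfolding WV euler_mult ..
  also have "\<dots> = yderiv (yvar * yderiv W - yderiv (yderiv W))"
    unfolding euler_yderiv eW ..
  also have "\<dots> = yderiv W + yvar * yderiv (yderiv W) - yderiv (yderiv (yderiv W))"
    by (simp add: yderiv_diff yderiv_mult)
  \<comment> \<open>With W' = W V every derivative of W is W times a polynomial in V and its
    derivatives; the terms y V^2 and V^3 cancel between the two sides.\<close>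
  finally have "W * euler V = W * (V + yvar * yderiv V - yderiv (V * V) - yderiv (yderiv V))"
    unfolding eW W3 unfolding W2 unfolding WV yderiv_mult by (simp add: algebra_simps)
  moreover have "W \<noteq> 0"
    using assms(1) fps_nonzero_nth[of W] by (auto simp: W_def noisy_density_nth intro: exI[of _ 0])
  ultimately show ?thesis by simp
qed

lemma gauss_ex_hermite_adjoint:
  "gauss_ex (hermite j * ([:0, 1:] * pderiv p - pderiv (pderiv p))) = real j * gauss_ex (hermite j * p)"
proof -
  have "gauss_ex (hermite j * ([:0, 1:] * pderiv p - pderiv (pderiv p)))
      = gauss_ex ([:0, 1:] * (hermite j * pderiv p)) - gauss_ex (hermite j * pderiv (pderiv p))"
    by (simp only: gauss_ex_diff[symmetric] algebra_simps)
  also have "\<dots> = gauss_ex (pderiv (hermite j) * pderiv p)"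
    unfolding gauss_ex_stein[symmetric] pderiv_mult gauss_ex_add by (simp add: mult.commute)
  also have "\<dots> = real j * gauss_ex (hermite j * p)"
  proof (cases j)
    case (Suc i)
    show ?thesis unfolding Suc pderiv_hermite_Suc gauss_ex_hermite_Suc ..
  qed simp
  finally show ?thesis .
qed

text \<open>The Burgers equation at order \<open>n\<close>, tested against \<open>hermite j\<close>.
  The linear part is symmetric with eigenvalue \<open>j\<close>, so only the quadratic term survives
  on the right. With \<open>n = k + 2\<close> and \<open>j = k - 1\<close> this computes a pairing
  of V that is not determined by its top-degree coefficient.\<close>

lemma gauss_ex_hermite_cond_mean:
  assumes "a 0 = 1"
  defines "V \<equiv> cond_mean a"
  shows "(real n - 1 - real j) * gauss_ex (hermite j * fps_nth V n)
       = - real (Suc j) * gauss_ex (hermite (Suc j) * fps_nth (V * V) n)"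
proof -
  let ?p = "fps_nth V n"
  have "smult (real n) ?p = fps_nth (euler V) n"
    by (simp add: of_nat_poly)
  also have "\<dots> = ?p + ([:0, 1:] * pderiv ?p - pderiv (pderiv ?p)) - pderiv (fps_nth (V * V) n)"
    unfolding V_def euler_cond_mean[of a, OF assms(1)] by simp
  finally have "gauss_ex (hermite j * smult (real n) ?p) =
      gauss_ex (hermite j * (?p + ([:0, 1:] * pderiv ?p - pderiv (pderiv ?p)) - pderiv (fps_nth (V * V) n)))"
    by (rule arg_cong)
  also have "\<dots> = gauss_ex (hermite j * ?p) + real j * gauss_ex (hermite j * ?p)
      - real (Suc j) * gauss_ex (hermite (Suc j) * fps_nth (V * V) n)"
    by (simp only: distrib_left right_diff_distrib' gauss_ex_add gauss_ex_diff gauss_ex_hermite_adjoint[unfolded right_diff_distrib' gauss_ex_diff] gauss_ex_hermite_Suc)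
  finally show ?thesis
    by (simp add: gauss_ex_smult algebra_simps del: hermite.simps)
qed

subsection \<open>Leading coefficients\<close>

text \<open>The order in the formal variable bounds the degree in y. Extracting the diagonal, where
  both exponents agree, is then multiplicative.\<close>

definition graded :: "real poly fps \<Rightarrow> bool" where
  "graded A \<longleftrightarrow> (\<forall>n. degree (fps_nth A n) \<le> n)"

definition top_coeffs :: "real poly fps \<Rightarrow> real fps" where
  "top_coeffs A = Abs_fps (\<lambda>n. coeff (fps_nth A n) n)"

lemma top_coeffs_nth [simp]: "fps_nth (top_coeffs A) n = coeff (fps_nth A n) n"
  by (simp add: top_coeffs_def)

lemma graded_mult:
  assumes "graded A" "graded B"
  shows "graded (A * B)"
  unfolding graded_def
proof
  fix n
  show "degree (fps_nth (A * B) n) \<le> n"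
    unfolding fps_mult_nth
  proof (rule degree_sum_le)
    fix i assume "i \<in> {0..n}"
    moreover have "degree (fps_nth A i) \<le> i" "degree (fps_nth B (n - i)) \<le> n - i"
      using assms by (auto simp: graded_def)
    ultimately show "degree (fps_nth A i * fps_nth B (n - i)) \<le> n"
      using degree_mult_le[of "fps_nth A i" "fps_nth B (n - i)"] by auto
  qed simp
qed

lemma coeff_mult_top:
  fixes p q :: "'a::comm_semiring_0 poly"
  assumes "degree p \<le> i" "degree q \<le> j"
  shows "coeff (p * q) (i + j) = coeff p i * coeff q j"
proof -
  have "coeff (p * q) (i + j) = (\<Sum>k\<le>i + j. if k = i then coeff p i * coeff q j else 0)"
    unfolding coeff_mult
  proof (rule sum.cong[OF refl])
    fix k assume "k \<in> {..i + j}"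
    consider "k = i" | "i < k" | "k < i" by linarith
    then show "coeff p k * coeff q (i + j - k) = (if k = i then coeff p i * coeff q j else 0)"
    proof cases
      case 2
      then have "degree p < k" using assms(1) by simp
      then show ?thesis using 2 by (simp add: coeff_eq_0)
    next
      case 3
      then have "degree q < i + j - k" using assms(2) by simp
      then show ?thesis using 3 by (simp add: coeff_eq_0)
    qed simp
  qed
  then show ?thesis by simp
qed

lemma top_coeffs_mult:
  assumes "graded A" "graded B"
  shows "top_coeffs (A * B) = top_coeffs A * top_coeffs B"
proof (rule fps_ext)
  fix n
  have "coeff (fps_nth A i * fps_nth B (n - i)) n = coeff (fps_nth A i) i * coeff (fps_nth B (n - i)) (n - i)"
    if "i \<in> {0..n}" for i
    using coeff_mult_top[of "fps_nth A i" i "fps_nth B (n - i)" "n - i"] assms that by (simp add: graded_def)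
  then show "fps_nth (top_coeffs (A * B)) n = fps_nth (top_coeffs A * top_coeffs B) n"
    by (simp add: fps_mult_nth coeff_sum)
qed

text \<open>Long division by a series with constant coefficient 1: each order of the quotient is
  determined by the lower ones, as the inductions below require.\<close>

lemma fps_nth_quotient:
  fixes W :: "'a::comm_ring_1 fps"
  assumes "fps_nth W 0 = 1" "W * U = B"
  shows "fps_nth U n = fps_nth B n - (\<Sum>i = 1..n. fps_nth W i * fps_nth U (n - i))"
proof -
  have "fps_nth B n = (\<Sum>i = 0..n. fps_nth W i * fps_nth U (n - i))"
    unfolding assms(2)[symmetric] fps_mult_nth ..
  also have "\<dots> = fps_nth U n + (\<Sum>i = 1..n. fps_nth W i * fps_nth U (n - i))"
    using assms(1) by (simp add: sum.atLeast_Suc_atMost)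
  finally show ?thesis by simp
qed

lemma graded_quotient:
  assumes "graded W" "graded B" "fps_nth W 0 = 1" "W * U = B"
  shows "graded U"
  unfolding graded_def
proof
  fix n
  show "degree (fps_nth U n) \<le> n"
  proof (induction n rule: less_induct)
    case (less n)
    have "degree (\<Sum>i = 1..n. fps_nth W i * fps_nth U (n - i)) \<le> n"
    proof (rule degree_sum_le)
      fix i assume i: "i \<in> {1..n}"
      moreover have "degree (fps_nth W i) \<le> i" "degree (fps_nth U (n - i)) \<le> n - i"
        using assms(1) less i by (auto simp: graded_def)
      ultimately show "degree (fps_nth W i * fps_nth U (n - i)) \<le> n"
        using degree_mult_le[of "fps_nth W i" "fps_nth U (n - i)"] by auto
    qed simp
    moreover have "degree (fps_nth B n) \<le> n"
      using assms(2) by (simp add: graded_def)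
    ultimately show ?case
      unfolding fps_nth_quotient[OF assms(3,4), of n] by (intro degree_diff_le)
  qed
qed

definition exp_gen :: "(nat \<Rightarrow> real) \<Rightarrow> real fps" where
  "exp_gen a = Abs_fps (\<lambda>n. a n / fact n)"

text \<open>\<open>lead_cumulant a n\<close> is \<open>K\<^sub>n / (n - 1)!\<close> for the moment sequence \<open>a\<close>.\<close>

definition lead_cumulant :: "(nat \<Rightarrow> real) \<Rightarrow> real fps" where
  "lead_cumulant a = top_coeffs (yvar * cond_mean a)"

lemma graded_noisy_density: "graded (noisy_density a)"
  unfolding graded_def noisy_density_nth
  by (meson degree_hermite degree_smult_le order_trans)

text \<open>The factor y restores the degree lost by differentiation. For this reason y V, rather
  than V, is treated as the graded object; no index shift is then needed on the diagonal.\<close>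

lemma graded_yvar_yderiv:
  assumes "graded A"
  shows "graded (yvar * yderiv A)"
  unfolding graded_def
proof
  fix n
  show "degree (fps_nth (yvar * yderiv A) n) \<le> n"
  proof (cases "degree (fps_nth A n) = 0")
    case True
    then have "pderiv (fps_nth A n) = 0" by (metis degree_0_id pderiv_pCons pderiv_0 pCons_0_0 add.right_neutral)
    then show ?thesis by simp
  next
    case False
    moreover have "degree (fps_nth A n) \<le> n" using assms by (simp add: graded_def)
    ultimately show ?thesis
      using degree_pCons_le[of "0::real" "pderiv (fps_nth A n)"] by (simp add: degree_pderiv)
  qed
qed

section \<open>Cumulants as top-degree coefficients of the conditional mean\<close>

context
  fixes a :: "nat \<Rightarrow> real"
  assumes a0: "a 0 = 1"
begin

lemma noisy_density_yvar_cond_mean: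
  "noisy_density a * (yvar * cond_mean a) = yvar * yderiv (noisy_density a)"
  using noisy_density_cond_mean[of a, OF a0] by (simp add: mult.left_commute)

lemma graded_cond_mean: "graded (yvar * cond_mean a)"
  by (rule graded_quotient[OF graded_noisy_density _ _ noisy_density_yvar_cond_mean])
     (simp_all add: graded_yvar_yderiv graded_noisy_density noisy_density_nth a0)

text \<open>The diagonal of W (y V) = y W'. With M for \<open>exp_gen a\<close> it reads M C = t M',
  so C = t (log M)' is the cumulant series with coefficients K_n / (n - 1)!.\<close>

lemma exp_gen_lead_cumulant: "exp_gen a * lead_cumulant a = euler (exp_gen a)"
proof -
  have "top_coeffs (noisy_density a) = exp_gen a"
    by (rule fps_ext) (simp add: exp_gen_def noisy_density_nth coeff_hermite_self)
  then have "exp_gen a * lead_cumulant a = top_coeffs (yvar * yderiv (noisy_density a))"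
    unfolding lead_cumulant_def noisy_density_yvar_cond_mean[symmetric]
    by (simp add: top_coeffs_mult graded_noisy_density graded_cond_mean)
  also have "\<dots> = euler (exp_gen a)"
  proof (rule fps_ext)
    fix n show "fps_nth (top_coeffs (yvar * yderiv (noisy_density a))) n = fps_nth (euler (exp_gen a)) n"
      by (cases n) (simp_all add: noisy_density_nth coeff_pderiv coeff_hermite_self exp_gen_def del: hermite.simps)
  qed
  finally show ?thesis .
qed

lemma cond_mean_nth_0 [simp]: "fps_nth (cond_mean a) 0 = 0"
  using fps_nth_quotient[OF _ noisy_density_cond_mean, of a 0] a0
  by (simp add: noisy_density_nth pderiv_smult)

text \<open>Degree counting: a nonzero coefficient of order \<open>n\<close> of V has degree at most
  n - 1, and one of V * V at most n - 2. These bounds leave only one or two indices in the sums for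
  orders 2k and 2k + 2.\<close>

lemma gauss_ex_hermite_cond_mean_0:
  "n \<le> j \<Longrightarrow> gauss_ex (hermite j * fps_nth (cond_mean a) n) = 0"
proof -
  assume "n \<le> j"
  have "degree (pCons 0 (fps_nth (cond_mean a) n)) \<le> n"
    using graded_cond_mean by (simp add: graded_def)
  with \<open>n \<le> j\<close> show ?thesis
    by (cases "fps_nth (cond_mean a) n = 0") (simp_all add: gauss_ex_hermite_0 degree_pCons_eq_if)
qed

lemma gauss_ex_hermite_cond_mean_lead:
  "gauss_ex (hermite j * fps_nth (cond_mean a) (Suc j)) = fps_nth (lead_cumulant a) (Suc j)"
proof -
  have "degree (pCons 0 (fps_nth (cond_mean a) (Suc j))) \<le> Suc j"
    using graded_cond_mean by (simp add: graded_def)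
  then have "degree (fps_nth (cond_mean a) (Suc j)) \<le> j"
    by (auto simp: degree_pCons_eq_if split: if_splits)
  then show ?thesis
    by (simp add: gauss_ex_hermite_lead lead_cumulant_def)
qed

lemma degree_cond_mean_square:
  "degree (pCons 0 (pCons 0 (fps_nth (cond_mean a * cond_mean a) n))) \<le> n"
  using graded_mult[OF graded_cond_mean graded_cond_mean]
  unfolding graded_def yvar_square_nth by blast

lemma gauss_ex_hermite_square_cond_mean_0:
  "n \<le> Suc j \<Longrightarrow> gauss_ex (hermite j * fps_nth (cond_mean a * cond_mean a) n) = 0"
  using degree_cond_mean_square[of n]
  by (cases "fps_nth (cond_mean a * cond_mean a) n = 0") (simp_all add: gauss_ex_hermite_0 degree_pCons_eq_if)

lemma gauss_ex_hermite_square_cond_mean_lead: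
  "gauss_ex (hermite j * fps_nth (cond_mean a * cond_mean a) (Suc (Suc j)))
     = fps_nth (lead_cumulant a * lead_cumulant a) (Suc (Suc j))"
proof -
  let ?p = "fps_nth (cond_mean a * cond_mean a) (Suc (Suc j))"
  have "degree ?p \<le> j"
    using degree_cond_mean_square[of "Suc (Suc j)"] by (auto simp: degree_pCons_eq_if split: if_splits)
  then have "gauss_ex (hermite j * ?p) = coeff (pCons 0 (pCons 0 ?p)) (Suc (Suc j))"
    by (simp add: gauss_ex_hermite_lead)
  also have "pCons 0 (pCons 0 ?p) = fps_nth ((yvar * cond_mean a) * (yvar * cond_mean a)) (Suc (Suc j))"
    by (rule yvar_square_nth[symmetric])
  also have "coeff \<dots> (Suc (Suc j)) = fps_nth (top_coeffs ((yvar * cond_mean a) * (yvar * cond_mean a))) (Suc (Suc j))"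
    by simp
  also have "\<dots> = fps_nth (lead_cumulant a * lead_cumulant a) (Suc (Suc j))"
    unfolding top_coeffs_mult[OF graded_cond_mean graded_cond_mean] lead_cumulant_def ..
  finally show ?thesis .
qed

end

lemma cond_mean_nth_1:
  assumes "a 0 = 1" "a 1 = 0"
  shows "fps_nth (cond_mean a) (Suc 0) = 0"
  using fps_nth_quotient[OF _ noisy_density_cond_mean, of a "Suc 0"] assms
  by (simp add: noisy_density_nth)

subsection \<open>Comparing two moment sequences\<close>

lemma fps_mult_nth_shift:
  fixes A B :: "'a::comm_ring_1 fps"
  assumes "\<And>i. i < k \<Longrightarrow> fps_nth A i = 0"
  shows "fps_nth (A * B) (k + m) = (\<Sum>i = 0..m. fps_nth A (k + i) * fps_nth B (m - i))"
proof -
  have "A = fps_X ^ k * fps_shift k A"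
    by (rule fps_ext) (simp add: fps_X_power_mult_nth assms)
  then have "A * B = fps_X ^ k * (fps_shift k A * B)"
    by (metis mult.assoc)
  then have "fps_nth (A * B) (k + m) = fps_nth (fps_shift k A * B) m"
    by (simp add: fps_X_power_mult_nth)
  then show ?thesis
    by (simp add: fps_mult_nth add.commute)
qed

lemma fps_mult_nth_shift2:
  fixes A B :: "'a::comm_ring_1 fps"
  assumes "\<And>i. i < k \<Longrightarrow> fps_nth A i = 0" "\<And>i. i < k \<Longrightarrow> fps_nth B i = 0"
  shows "fps_nth (A * B) (2 * k + m) = (\<Sum>i = 0..m. fps_nth A (k + i) * fps_nth B (k + (m - i)))"
proof -
  have "fps_nth (A * B) (2 * k + m) = fps_nth (A * B) (k + (k + m))"
    by (simp add: mult_2 add.assoc)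
  also have "\<dots> = (\<Sum>i = 0..k + m. fps_nth A (k + i) * fps_nth B (k + m - i))"
    by (rule fps_mult_nth_shift) (rule assms)
  also have "\<dots> = (\<Sum>i = 0..m. fps_nth A (k + i) * fps_nth B (k + m - i))"
    by (rule sum.mono_neutral_right) (auto simp: assms)
  also have "\<dots> = (\<Sum>i = 0..m. fps_nth A (k + i) * fps_nth B (k + (m - i)))"
    by (rule sum.cong) auto
  finally show ?thesis .
qed

context
  fixes a b :: "nat \<Rightarrow> real" and k :: nat
  assumes a0: "a 0 = 1" and a1: "a 1 = 0" and b0: "b 0 = 1" and b1: "b 1 = 0"
    and k2: "2 < k" and agree: "\<And>j. j < k \<Longrightarrow> b j = a j"
begin

private definition "eta = noisy_density b - noisy_density a"
text \<open>The defect of \<open>cond_mean a\<close> in the equation W V = W' for the density of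
  \<open>b\<close>. It equals that density times \<open>res\<close>, which allows \<open>res\<close>
  to be found by division.\<close>

private definition "rho = yderiv eta - cond_mean a * eta"
private definition "res = cond_mean b - cond_mean a"

private lemma eta_nth: "fps_nth eta j = smult (b j - a j) (hermite j)"
  by (simp add: eta_def noisy_density_nth smult_diff_left)

private lemma eta_low: "j < k \<Longrightarrow> fps_nth eta j = 0"
  by (simp add: eta_nth agree)

private lemma yderiv_eta_Suc: "fps_nth (yderiv eta) (Suc j) = smult (b (Suc j) - a (Suc j)) (hermite j)"
  by (simp add: eta_nth pderiv_smult pderiv_hermite_Suc del: hermite.simps)

private lemma density_res: "noisy_density b * res = rho"
proof -
  have "noisy_density b * res = yderiv (noisy_density b) - noisy_density b * cond_mean a"
    unfolding res_def right_diff_distrib noisy_density_cond_mean[of b, OF b0] ..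
  also have "\<dots> = yderiv eta + yderiv (noisy_density a) - (eta + noisy_density a) * cond_mean a"
    by (simp add: eta_def yderiv_diff)
  also have "\<dots> = rho"
    unfolding noisy_density_cond_mean[of a, OF a0, symmetric] rho_def by (simp add: algebra_simps)
  finally show ?thesis .
qed

text \<open>The first two terms are the effect of using the mismatched estimator \<open>cond_mean a\<close> for \<open>b\<close>; the last
  one, the excess error of that estimator, is quadratic in the perturbation.\<close>

private lemma cond_energy_diff:
  "cond_energy b n - cond_energy a n =
     2 * gauss_ex (fps_nth (yderiv eta * cond_mean a) n)
     - gauss_ex (fps_nth (eta * (cond_mean a * cond_mean a)) n) + gauss_ex (fps_nth (rho * res) n)"
proof -
  let ?v = "cond_mean a"
  have b: "cond_mean b = ?v + res" "noisy_density b = noisy_density a + eta"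
    by (simp_all add: res_def eta_def)
  have "cond_mean b * cond_mean b * noisy_density b
      = ?v * ?v * noisy_density b + (?v + ?v + res) * (noisy_density b * res)"
    unfolding b(1) by (simp add: algebra_simps)
  also have "\<dots> = ?v * ?v * noisy_density a + (yderiv eta * ?v + yderiv eta * ?v - eta * (?v * ?v) + rho * res)"
    unfolding density_res unfolding b(2) rho_def by (simp add: algebra_simps)
  finally show ?thesis
    unfolding cond_energy_def by (simp only: fps_add_nth fps_sub_nth gauss_ex_add gauss_ex_diff)
qed

private lemma cond_mean_2: "fps_nth (cond_mean a) 2 = smult (a 2) [:0, 1:]"
proof -
  have "fps_nth (cond_mean a) 2 = pderiv (smult (a 2) (hermite (Suc 1)))"
    using fps_nth_quotient[OF _ noisy_density_cond_mean, of a 2] a0 a1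
    by (simp add: noisy_density_nth numeral_2_eq_2 cond_mean_nth_1[of a, OF a0 a1] del: hermite.simps(2))
  then show ?thesis
    unfolding pderiv_smult pderiv_hermite_Suc by simp
qed

private lemma rho_low: "j < k \<Longrightarrow> fps_nth rho j = 0"
  by (simp add: rho_def eta_low fps_mult_nth)

private lemma rho_k: "fps_nth rho k = smult (b k - a k) (hermite (k - 1))"
proof -
  have "fps_nth (eta * cond_mean a) (k + 0) = 0"
    by (subst fps_mult_nth_shift) (simp_all add: eta_low cond_mean_nth_0[of a, OF a0])
  then show ?thesis
    using k2 yderiv_eta_Suc[of "k - 1"] by (simp add: rho_def mult.commute)
qed

private lemma rho_k2:
  "fps_nth rho (k + 2) = smult (b (k + 2) - a (k + 2)) (hermite (k + 1))
     - smult (a 2 * (b k - a k)) ([:0, 1:] * hermite k)"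
proof -
  have "fps_nth (eta * cond_mean a) (k + 2) = smult (b k - a k) (hermite k) * smult (a 2) [:0, 1:]"
    by (subst fps_mult_nth_shift[OF eta_low])
      (simp_all add: mult.commute[of "a _"] cond_mean_nth_0[of a, OF a0] cond_mean_nth_1[of a, OF a0 a1]
        cond_mean_2[unfolded numeral_2_eq_2] eta_nth numeral_2_eq_2 del: hermite.simps(2))
  then show ?thesis
    using yderiv_eta_Suc[of "Suc k"] by (simp add: rho_def mult.commute del: hermite.simps(2))
qed

private lemma res_low: "j < k \<Longrightarrow> fps_nth res j = 0"
proof (induction j rule: less_induct)
  case (less j)
  have "(\<Sum>i = 1..j. fps_nth (noisy_density b) i * fps_nth res (j - i)) = 0"
    using less by (intro sum.neutral) auto
  then show ?case
    using fps_nth_quotient[OF _ density_res, of j] less.prems b0 by (simp add: noisy_density_nth rho_low)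
qed

private lemma rho_eq:
  "fps_nth rho (k + m) = (\<Sum>i = 0..m. fps_nth res (k + i) * fps_nth (noisy_density b) (m - i))"
  unfolding density_res[symmetric] by (subst mult.commute, rule fps_mult_nth_shift) (rule res_low)

private lemma res_k: "fps_nth res k = fps_nth rho k"
  using rho_eq[of 0] b0 by (simp add: noisy_density_nth)

private lemma res_k1: "fps_nth res (k + 1) = fps_nth rho (k + 1)"
  using rho_eq[of 1] b0 b1 by (simp add: noisy_density_nth)

text \<open>Through this order the divisor acts as 1 plus \<open>a 2\<close> times
  \<open>hermite 2\<close> at order 2: centring removes order 1, and \<open>k > 2\<close> makes the
  second moments equal.\<close>

private lemma res_k2: "fps_nth res (k + 2) = fps_nth rho (k + 2) - smult (a 2) (hermite 2) * fps_nth rho k"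
proof -
  have "b 2 = a 2" using agree k2 by simp
  then show ?thesis
    using rho_eq[of 2] b0 b1 res_k
    by (simp add: noisy_density_nth numeral_2_eq_2 algebra_simps del: hermite.simps(2))
qed

section \<open>Energy differences at orders 2k and 2k + 2\<close>

private lemma linear_term:
  "gauss_ex (fps_nth (yderiv eta * cond_mean a) n)
     = (\<Sum>i = k..n. (b i - a i) * gauss_ex (hermite (i - 1) * fps_nth (cond_mean a) (n - i)))"
proof -
  have "gauss_ex (fps_nth (yderiv eta * cond_mean a) n)
      = (\<Sum>i = 0..n. gauss_ex (fps_nth (yderiv eta) i * fps_nth (cond_mean a) (n - i)))"
    by (simp add: fps_mult_nth gauss_ex_sum)
  also have "\<dots> = (\<Sum>i = k..n. gauss_ex (fps_nth (yderiv eta) i * fps_nth (cond_mean a) (n - i)))"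
    by (rule sum.mono_neutral_right) (auto simp: eta_low)
  also have "\<dots> = (\<Sum>i = k..n. (b i - a i) * gauss_ex (hermite (i - 1) * fps_nth (cond_mean a) (n - i)))"
  proof (rule sum.cong[OF refl])
    fix i assume "i \<in> {k..n}"
    then obtain j where "i = Suc j" using k2 by (cases i) auto
    then show "gauss_ex (fps_nth (yderiv eta) i * fps_nth (cond_mean a) (n - i))
        = (b i - a i) * gauss_ex (hermite (i - 1) * fps_nth (cond_mean a) (n - i))"
      unfolding \<open>i = Suc j\<close> yderiv_eta_Suc by (simp add: gauss_ex_smult)
  qed
  finally show ?thesis .
qed

private lemma square_term:
  "gauss_ex (fps_nth (eta * (cond_mean a * cond_mean a)) n)
     = (\<Sum>i = k..n. (b i - a i) * gauss_ex (hermite i * fps_nth (cond_mean a * cond_mean a) (n - i)))"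
proof -
  have "gauss_ex (fps_nth (eta * (cond_mean a * cond_mean a)) n)
      = (\<Sum>i = 0..n. gauss_ex (fps_nth eta i * fps_nth (cond_mean a * cond_mean a) (n - i)))"
    by (simp add: fps_mult_nth[of eta] gauss_ex_sum)
  also have "\<dots> = (\<Sum>i = k..n. gauss_ex (fps_nth eta i * fps_nth (cond_mean a * cond_mean a) (n - i)))"
    by (rule sum.mono_neutral_right) (auto simp: eta_low)
  finally show ?thesis by (simp add: eta_nth gauss_ex_smult)
qed

lemma cond_energy_diff_double:
  "cond_energy b (2 * k) - cond_energy a (2 * k)
     = (b k - a k) * (2 * fps_nth (lead_cumulant a) k + (b k - a k) / fact (k - 1))"
proof -
  obtain j where k: "k = Suc j" using k2 by (cases k) auto
  \<comment> \<open>For \<open>i > k\<close> the order \<open>2 * k - i\<close> is at most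
    \<open>i - 1\<close>, so the pairing with \<open>hermite (i - 1)\<close> vanishes by
    degree.\<close>
  have "gauss_ex (fps_nth (yderiv eta * cond_mean a) (2 * k))
      = (\<Sum>i\<in>{k}. (b i - a i) * gauss_ex (hermite (i - 1) * fps_nth (cond_mean a) (2 * k - i)))"
    unfolding linear_term
    by (rule sum.mono_neutral_right) (auto simp: gauss_ex_hermite_cond_mean_0[of a, OF a0])
  also have "\<dots> = (b k - a k) * fps_nth (lead_cumulant a) k"
    using gauss_ex_hermite_cond_mean_lead[of a j, OF a0] by (simp add: k)
  finally have 1: "gauss_ex (fps_nth (yderiv eta * cond_mean a) (2 * k))
      = (b k - a k) * fps_nth (lead_cumulant a) k" .
  \<comment> \<open>Here even \<open>i = k\<close> drops out, because V * V has one degree less than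
    V at the same order.\<close>
  have 2: "gauss_ex (fps_nth (eta * (cond_mean a * cond_mean a)) (2 * k)) = 0"
    unfolding square_term
    by (rule sum.neutral) (auto simp: gauss_ex_hermite_square_cond_mean_0[of a, OF a0])
  have "fps_nth (rho * res) (2 * k + 0) = fps_nth rho k * fps_nth rho k"
    by (subst fps_mult_nth_shift2[OF rho_low res_low]) (simp_all add: res_k)
  then have 3: "gauss_ex (fps_nth (rho * res) (2 * k)) = (b k - a k) * (b k - a k) / fact (k - 1)"
    by (simp add: rho_k gauss_ex_smult gauss_ex_hermite_square)
  show ?thesis
    unfolding cond_energy_diff 1 2 3 by (simp add: algebra_simps)
qed

text \<open>The number \<open>c\<close> is the Gaussian second moment of the order k + 1 coefficient
  of \<open>rho\<close>. The common factor - (k + 1) arises twice: as 2 (- k / 2) - 1 in the part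
  linear in the perturbation, and as - (2 + (k - 1)) in the quadratic part.\<close>

lemma cond_energy_diff_double2:
  "\<exists>c\<ge>0. cond_energy b (2 * k + 2) - cond_energy a (2 * k + 2)
     = 2 * (b (k + 1) - a (k + 1)) * fps_nth (lead_cumulant a) (k + 1) + c
       - real (k + 1) * (b k - a k) * (fps_nth (lead_cumulant a * lead_cumulant a) (k + 2)
          + a 2 * (b k - a k) / fact (k - 1))"
proof -
  obtain j where k: "k = Suc (Suc j)" using k2 by (cases k; cases "k - 1") auto
  let ?d = "b k - a k" and ?C = "lead_cumulant a"
  have "gauss_ex (fps_nth (yderiv eta * cond_mean a) (2 * k + 2))
      = (\<Sum>i\<in>{k, k + 1}. (b i - a i) * gauss_ex (hermite (i - 1) * fps_nth (cond_mean a) (2 * k + 2 - i)))"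
    unfolding linear_term
    by (rule sum.mono_neutral_right) (auto simp: gauss_ex_hermite_cond_mean_0[of a, OF a0])
  also have "\<dots> = ?d * gauss_ex (hermite (k - 1) * fps_nth (cond_mean a) (k + 2))
      + (b (k + 1) - a (k + 1)) * fps_nth ?C (k + 1)"
    using gauss_ex_hermite_cond_mean_lead[of a k, OF a0] by (simp del: hermite.simps(2))
  \<comment> \<open>The one pairing below the top degree; the left factor in
    \<open>gauss_ex_hermite_cond_mean\<close> is (k + 2) - 1 - (k - 1) = 2.\<close>
  also have "gauss_ex (hermite (k - 1) * fps_nth (cond_mean a) (k + 2)) = - real k / 2 * fps_nth (?C * ?C) (k + 2)"
    using gauss_ex_hermite_cond_mean[of a "k + 2" "k - 1", OF a0]
      gauss_ex_hermite_square_cond_mean_lead[of a k, OF a0] by (simp add: k del: hermite.simps(2))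
  finally have 1: "gauss_ex (fps_nth (yderiv eta * cond_mean a) (2 * k + 2))
      = ?d * (- real k / 2 * fps_nth (?C * ?C) (k + 2)) + (b (k + 1) - a (k + 1)) * fps_nth ?C (k + 1)" .
  have "gauss_ex (fps_nth (eta * (cond_mean a * cond_mean a)) (2 * k + 2))
      = (\<Sum>i\<in>{k}. (b i - a i) * gauss_ex (hermite i * fps_nth (cond_mean a * cond_mean a) (2 * k + 2 - i)))"
    unfolding square_term
    by (rule sum.mono_neutral_right) (auto simp: gauss_ex_hermite_square_cond_mean_0[of a, OF a0])
  then have 2: "gauss_ex (fps_nth (eta * (cond_mean a * cond_mean a)) (2 * k + 2))
      = ?d * fps_nth (?C * ?C) (k + 2)"
    using gauss_ex_hermite_square_cond_mean_lead[of a k, OF a0] by simp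
  define c where "c = gauss_ex (fps_nth rho (k + 1) * fps_nth rho (k + 1))"
  have c: "c \<ge> 0" unfolding c_def by (rule gauss_ex_square_nonneg)
  have "fps_nth (rho * res) (2 * k + 2) = fps_nth rho (k + 1) * fps_nth rho (k + 1)
      + (fps_nth rho k * fps_nth rho (k + 2) + fps_nth rho k * fps_nth rho (k + 2))
      - smult (a 2) (hermite 2 * (fps_nth rho k * fps_nth rho k))"
  proof -
    have "fps_nth (rho * res) (2 * k + 2) = (\<Sum>i = 0..2. fps_nth rho (k + i) * fps_nth res (k + (2 - i)))"
      by (rule fps_mult_nth_shift2[OF rho_low res_low])
    also have "\<dots> = fps_nth rho k * fps_nth res (k + 2) + fps_nth rho (k + 1) * fps_nth res (k + 1)
        + fps_nth rho (k + 2) * fps_nth res k"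
      by (simp add: numeral_2_eq_2)
    finally show ?thesis
      unfolding res_k res_k1 res_k2 by (simp add: algebra_simps)
  qed
  then have "gauss_ex (fps_nth (rho * res) (2 * k + 2)) = c
      + 2 * gauss_ex (fps_nth rho k * fps_nth rho (k + 2))
      - a 2 * gauss_ex (hermite 2 * (fps_nth rho k * fps_nth rho k))"
    by (simp only: c_def gauss_ex_add gauss_ex_diff gauss_ex_smult)
  also have "gauss_ex (fps_nth rho k * fps_nth rho (k + 2)) = - a 2 * ?d * ?d / fact (k - 1)"
  proof -
    have "fps_nth rho k * fps_nth rho (k + 2)
        = smult (?d * (b (k + 2) - a (k + 2))) (hermite (k + 1) * hermite (k - 1))
          - smult (a 2 * ?d * ?d) ([:0, 1:] * hermite k * hermite (k - 1))"
      unfolding rho_k rho_k2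
      by (simp only: right_diff_distrib mult_smult_left mult_smult_right smult_smult mult_ac)
    \<comment> \<open>Orthogonality removes the uncontrolled difference of the moments of order k +
      2.\<close>
    moreover have "gauss_ex (hermite (k + 1) * hermite (k - 1)) = 0"
      using degree_hermite[of "k - 1"] by (intro gauss_ex_hermite_0) simp
    moreover have "gauss_ex ([:0, 1:] * hermite k * hermite (k - 1)) = 1 / fact (k - 1)"
      using gauss_ex_y_hermite_hermite[of "k - 1"] k2 by (simp add: k del: hermite.simps(2) mult_pCons_left)
    ultimately show ?thesis by (simp only: gauss_ex_diff gauss_ex_smult) simp
  qed
  also have "gauss_ex (hermite 2 * (fps_nth rho k * fps_nth rho k)) = ?d * ?d * real (k - 1) / fact (k - 1)"
  proof -
    have j: "k - 1 = Suc j" by (simp add: k)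
    have "hermite 2 * (fps_nth rho k * fps_nth rho k)
        = smult (?d * ?d) (hermite 2 * (hermite (Suc j) * hermite (Suc j)))"
      unfolding rho_k j by (simp del: hermite.simps(2))
    also have "gauss_ex \<dots> = ?d * ?d / fact j"
      unfolding gauss_ex_smult gauss_ex_hermite2_square by simp
    also have "\<dots> = ?d * ?d * real (k - 1) / fact (k - 1)"
      by (simp add: k)
    finally show ?thesis .
  qed
  finally have "gauss_ex (fps_nth (rho * res) (2 * k + 2)) = c
      + 2 * (- a 2 * ?d * ?d / fact (k - 1)) - a 2 * (?d * ?d * real (k - 1) / fact (k - 1))" .
  also have "\<dots> = c - a 2 * ?d * ?d * (real k + 1) / fact (k - 1)"
    using k2 by (simp add: of_nat_diff divide_simps) (simp add: algebra_simps)
  finally have 3: "gauss_ex (fps_nth (rho * res) (2 * k + 2))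
      = c - a 2 * ?d * ?d * (real k + 1) / fact (k - 1)" .
  have "cond_energy b (2 * k + 2) - cond_energy a (2 * k + 2)
     = 2 * (b (k + 1) - a (k + 1)) * fps_nth ?C (k + 1) + c
       - real (k + 1) * ?d * (fps_nth (?C * ?C) (k + 2) + a 2 * ?d / fact (k - 1))"
    unfolding cond_energy_diff 1 2 3 by (simp add: field_simps)
  with c show ?thesis by blast
qed

end

subsection \<open>Cumulants from moments\<close>

text \<open>The derivatives \<open>G\<close> are required on an open set, since each differentiation
  needs the previous derivative in a neighbourhood and not only at \<open>t\<close>.\<close>

lemma nth_vderiv_eqI:
  assumes "open U" and der: "\<And>n t. t \<in> U \<Longrightarrow> (G n has_vector_derivative G (Suc n) t) (at t)"
    and "\<And>t. t \<in> U \<Longrightarrow> f t = G 0 t" and "t \<in> U"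
  shows "nth_vderiv n f t = G n t"
  using \<open>t \<in> U\<close>
proof (induction n arbitrary: t)
  case (Suc n)
  have "(nth_vderiv n f has_vector_derivative G (Suc n) t) (at t)"
    by (rule has_vector_derivative_transform_within_open[OF der[OF Suc.prems] \<open>open U\<close> Suc.prems])
       (simp add: Suc.IH)
  then show ?case by (simp add: nth_vderiv_def vector_derivative_at)
qed (simp add: nth_vderiv_def assms(3))

lemma Leibniz_sum_Suc:
  fixes g h :: "nat \<Rightarrow> 'a::comm_ring_1"
  shows "(\<Sum>k\<le>n. of_nat (n choose k) * (g (Suc k) * h (n - k) + g k * h (Suc n - k)))
       = (\<Sum>k\<le>Suc n. of_nat (Suc n choose k) * (g k * h (Suc n - k)))"
proof -
  have "(\<Sum>k\<le>Suc n. of_nat (Suc n choose k) * (g k * h (Suc n - k)))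
      = g 0 * h (Suc n) + (\<Sum>k\<le>n. of_nat (Suc n choose Suc k) * (g (Suc k) * h (n - k)))"
    by (subst sum.atMost_Suc_shift) simp
  also have "\<dots> = (\<Sum>k\<le>n. of_nat (n choose k) * (g (Suc k) * h (n - k)))
      + (g 0 * h (Suc n) + (\<Sum>k\<le>n. of_nat (n choose Suc k) * (g (Suc k) * h (n - k))))"
    by (simp add: algebra_simps sum.distrib)
  also have "g 0 * h (Suc n) + (\<Sum>k\<le>n. of_nat (n choose Suc k) * (g (Suc k) * h (n - k)))
      = (\<Sum>k\<le>Suc n. of_nat (n choose k) * (g k * h (Suc n - k)))"
    by (subst sum.atMost_Suc_shift) simp
  also have "\<dots> = (\<Sum>k\<le>n. of_nat (n choose k) * (g k * h (Suc n - k)))"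
    by (simp add: binomial_eq_0)
  finally show ?thesis by (simp add: algebra_simps sum.distrib)
qed

text \<open>If \<open>f n\<close> is the \<open>n\<close>-th derivative of \<open>f 0\<close>, then \<open>log_deriv f n\<close> is the \<open>n\<close>-th derivative of
  \<open>f 1 / f 0\<close>, solved for in the Leibniz rule.\<close>

fun log_deriv :: "(nat \<Rightarrow> real \<Rightarrow> complex) \<Rightarrow> nat \<Rightarrow> real \<Rightarrow> complex" where
  "log_deriv f n t = (f (Suc n) t - (\<Sum>k<n. of_nat (n choose k) * (log_deriv f k t * f (n - k) t))) / f 0 t"

declare log_deriv.simps [simp del]

lemma log_deriv_Leibniz:
  assumes "f 0 t \<noteq> 0"
  shows "(\<Sum>k\<le>n. of_nat (n choose k) * (log_deriv f k t * f (n - k) t)) = f (Suc n) t"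
proof -
  have "log_deriv f n t * f 0 t = f (Suc n) t - (\<Sum>k<n. of_nat (n choose k) * (log_deriv f k t * f (n - k) t))"
    using assms by (subst log_deriv.simps) simp
  then show ?thesis
    by (simp add: lessThan_Suc_atMost[symmetric])
qed

text \<open>Differentiating the defining quotient gives a numerator that involves \<open>S'\<close>,
  the derivative of the subtracted sum. The Leibniz rule at order n + 1, regrouped by Pascal's rule,
  identifies it.\<close>

lemma log_deriv_has_vector_derivative:
  assumes der: "\<And>n t. t \<in> U \<Longrightarrow> (f n has_vector_derivative f (Suc n) t) (at t)"
    and nz: "\<And>t. t \<in> U \<Longrightarrow> f 0 t \<noteq> 0" and "t \<in> U"
  shows "(log_deriv f n has_vector_derivative log_deriv f (Suc n) t) (at t)"
proof (induction n rule: less_induct)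
  case (less n)
  let ?w = "\<lambda>k. log_deriv f k t" and ?f = "\<lambda>k. f k t"
  define S' where "S' = (\<Sum>k<n. of_nat (n choose k) * (?w (Suc k) * ?f (n - k) + ?w k * ?f (Suc n - k)))"
  have num: "((\<lambda>t. f (Suc n) t - (\<Sum>k<n. of_nat (n choose k) * (log_deriv f k t * f (n - k) t)))
      has_vector_derivative ?f (Suc (Suc n)) - S') (at t)"
    unfolding S'_def using der[OF \<open>t \<in> U\<close>] less.IH
    by (auto intro!: derivative_eq_intros sum.cong simp: Suc_diff_le algebra_simps)
  have inv: "((\<lambda>t. inverse (f 0 t)) has_vector_derivative - (inverse (?f 0) * ?f 1 * inverse (?f 0))) (at t)"
    using field_vector_diff_chain_at[OF der[OF \<open>t \<in> U\<close>, of 0] DERIV_inverse[OF nz[OF \<open>t \<in> U\<close>]]]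
    by (simp add: o_def power2_eq_square mult_ac)
  have eq: "log_deriv f n = (\<lambda>t. (f (Suc n) t - (\<Sum>k<n. of_nat (n choose k) * (log_deriv f k t * f (n - k) t))) * inverse (f 0 t))"
    by (rule ext, subst log_deriv.simps) (simp add: divide_inverse)
  have "(log_deriv f n has_vector_derivative
      (?f (Suc n) - (\<Sum>k<n. of_nat (n choose k) * (?w k * ?f (n - k)))) * - (inverse (?f 0) * ?f 1 * inverse (?f 0))
      + (?f (Suc (Suc n)) - S') * inverse (?f 0)) (at t)"
    by (subst eq) (rule has_vector_derivative_mult[OF num inv])
  also have "(?f (Suc n) - (\<Sum>k<n. of_nat (n choose k) * (?w k * ?f (n - k)))) * - (inverse (?f 0) * ?f 1 * inverse (?f 0))
      = - ?w n * ?f 1 * inverse (?f 0)"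
    by (subst (2) log_deriv.simps) (simp add: divide_inverse mult_ac)
  also have "- ?w n * ?f 1 * inverse (?f 0) + (?f (Suc (Suc n)) - S') * inverse (?f 0)
      = (?f (Suc (Suc n)) - (?w n * ?f 1 + S')) / ?f 0"
    by (simp add: divide_inverse algebra_simps)
  also have "\<dots> = ?w (Suc n)"
  proof -
    have "?f (Suc (Suc n)) = (\<Sum>k\<le>n. of_nat (n choose k) * (?w (Suc k) * ?f (n - k) + ?w k * ?f (Suc n - k)))"
      using log_deriv_Leibniz[of f t "Suc n", OF nz[OF \<open>t \<in> U\<close>]] Leibniz_sum_Suc[of n ?w ?f] by simp
    also have "\<dots> = S' + (?w (Suc n) * ?f 0 + ?w n * ?f 1)"
      by (simp add: S'_def lessThan_Suc_atMost[symmetric])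
    finally show ?thesis using nz[OF \<open>t \<in> U\<close>] by simp
  qed
  finally show ?case .
qed

definition moment :: "real measure \<Rightarrow> nat \<Rightarrow> real" where
  "moment \<nu> n = (\<integral>x. x ^ n \<partial>\<nu>)"

section \<open>Derivatives of the characteristic function and of its logarithm\<close>

locale moment_law = prob_space \<nu> for \<nu> :: "real measure" +
  assumes sets_law [measurable_cong, simp]: "sets \<nu> = sets borel"
    and integrable_power [simp]: "\<And>n::nat. integrable \<nu> (\<lambda>x. x ^ n)"
begin

lemma space_law [simp]: "space \<nu> = UNIV"
  using sets_eq_imp_space_eq[OF sets_law] by simp

lemma integrable_abs_power [simp]: "integrable \<nu> (\<lambda>x. \<bar>x\<bar> ^ n)"
  using integrable_abs[OF integrable_power[of n]] by (simp add: power_abs)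

lemma moment_0: "moment \<nu> 0 = 1"
  using prob_space by (simp add: moment_def)

definition char_deriv :: "nat \<Rightarrow> real \<Rightarrow> complex" where
  "char_deriv n t = (CLINT x|\<nu>. (\<i> * complex_of_real x) ^ n * iexp (t * x))"

lemma integrable_char_deriv: "complex_integrable \<nu> (\<lambda>x. (\<i> * complex_of_real x) ^ n * iexp (t * x))"
  by (rule Bochner_Integration.integrable_bound[OF integrable_abs_power[of n]])
     (auto simp: norm_mult norm_power)

text \<open>Differentiation under the integral by an explicit error: the modulus of exp (i u) - 1 -
  i u is at most u^2 / 2, which costs h^2 / 2 times the absolute moment of order n + 2.\<close>

lemma char_deriv_has_vector_derivative:
  "(char_deriv n has_vector_derivative char_deriv (Suc n) t) (at t)"
proof -
  define C where "C = (\<integral>x. \<bar>x\<bar> ^ (n + 2) \<partial>\<nu>) / 2"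
  have bound: "norm (char_deriv n (t + h) - char_deriv n t - h *\<^sub>R char_deriv (Suc n) t) \<le> C * h\<^sup>2" for h
  proof -
    have "char_deriv n (t + h) - char_deriv n t - h *\<^sub>R char_deriv (Suc n) t
        = (CLINT x|\<nu>. (\<i> * complex_of_real x) ^ n * iexp ((t + h) * x)
            - (\<i> * complex_of_real x) ^ n * iexp (t * x)
            - complex_of_real h * ((\<i> * complex_of_real x) ^ Suc n * iexp (t * x)))"
      unfolding char_deriv_def scaleR_conv_of_real integral_mult_right_zero[symmetric]
      by (subst Bochner_Integration.integral_diff[symmetric]
          | intro Bochner_Integration.integrable_diff integrable_mult_right integrable_char_deriv)+ (rule refl)
    also have "norm \<dots> \<le> (\<integral>x. h\<^sup>2 / 2 * \<bar>x\<bar> ^ (n + 2) \<partial>\<nu>)"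
    proof (rule Bochner_Integration.integral_norm_bound_integral)
      show "integrable \<nu> (\<lambda>x. h\<^sup>2 / 2 * \<bar>x\<bar> ^ (n + 2))"
        by (intro integrable_mult_right integrable_abs_power)
      show "complex_integrable \<nu> (\<lambda>x. (\<i> * complex_of_real x) ^ n * iexp ((t + h) * x)
            - (\<i> * complex_of_real x) ^ n * iexp (t * x)
            - complex_of_real h * ((\<i> * complex_of_real x) ^ Suc n * iexp (t * x)))"
        by (intro Bochner_Integration.integrable_diff integrable_mult_right integrable_char_deriv)
      fix x :: real
      have "(\<i> * complex_of_real x) ^ n * iexp ((t + h) * x) - (\<i> * complex_of_real x) ^ n * iexp (t * x)
            - complex_of_real h * ((\<i> * complex_of_real x) ^ Suc n * iexp (t * x))
          = (\<i> * complex_of_real x) ^ n * iexp (t * x) * (iexp (h * x) - (\<Sum>k\<le>1. (\<i> * complex_of_real (h * x)) ^ k / fact k))"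
        by (simp add: algebra_simps exp_add)
      also have "norm \<dots> \<le> \<bar>x\<bar> ^ n * (\<bar>h * x\<bar> ^ 2 / 2)"
        unfolding norm_mult using iexp_approx1[of "h * x" 1]
        by (intro mult_mono) (auto simp: norm_power norm_mult numeral_2_eq_2)
      also have "\<dots> = h\<^sup>2 / 2 * \<bar>x\<bar> ^ (n + 2)"
        by (simp add: power_mult_distrib power_add) (simp add: power2_eq_square)
      finally show "norm ((\<i> * complex_of_real x) ^ n * iexp ((t + h) * x) - (\<i> * complex_of_real x) ^ n * iexp (t * x)
            - complex_of_real h * ((\<i> * complex_of_real x) ^ Suc n * iexp (t * x))) \<le> h\<^sup>2 / 2 * \<bar>x\<bar> ^ (n + 2)" .
    qed
    also have "\<dots> = C * h\<^sup>2" by (simp add: C_def)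
    finally show ?thesis .
  qed
  have "((\<lambda>h. norm (char_deriv n (t + h) - char_deriv n t - h *\<^sub>R char_deriv (Suc n) t) / norm h) \<longlongrightarrow> 0) (at 0)"
  proof (rule Lim_null_comparison)
    show "\<forall>\<^sub>F h in at 0. norm (norm (char_deriv n (t + h) - char_deriv n t - h *\<^sub>R char_deriv (Suc n) t) / norm h) \<le> C * \<bar>h\<bar>"
      using bound by (auto simp: eventually_at_filter divide_simps power2_eq_square mult.assoc)
    show "((\<lambda>h. C * \<bar>h\<bar>) \<longlongrightarrow> 0) (at 0)"
      by (auto intro!: tendsto_eq_intros)
  qed
  then show ?thesis
    unfolding has_vector_derivative_def has_derivative_at by (simp add: bounded_linear_scaleR_left)
qed

lemma char_deriv_at_0: "char_deriv n 0 = \<i> ^ n * complex_of_real (moment \<nu> n)"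
proof -
  have "char_deriv n 0 = (CLINT x|\<nu>. \<i> ^ n * complex_of_real (x ^ n))"
    by (simp add: char_deriv_def power_mult_distrib)
  also have "\<dots> = \<i> ^ n * complex_of_real (moment \<nu> n)"
    unfolding moment_def integral_mult_right_zero integral_complex_of_real ..
  finally show ?thesis .
qed

text \<open>The classical moment-cumulant recursion, brought to the binomial form of
  \<open>log_deriv\<close> so that the two agree term by term at 0.\<close>

lemma lead_cumulant_Suc:
  "fact n * fps_nth (lead_cumulant (moment \<nu>)) (Suc n)
     = moment \<nu> (Suc n) - (\<Sum>k<n. real (n choose k) * (fact k * fps_nth (lead_cumulant (moment \<nu>)) (Suc k)) * moment \<nu> (n - k))"
proof -
  let ?C = "lead_cumulant (moment \<nu>)"
  have "moment \<nu> (Suc n) / fact n = fps_nth (euler (exp_gen (moment \<nu>))) (Suc n)"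
    by (simp add: exp_gen_def)
  also have "\<dots> = fps_nth (?C * exp_gen (moment \<nu>)) (Suc n)"
    using exp_gen_lead_cumulant[of "moment \<nu>", OF moment_0] by (simp add: mult.commute)
  also have "\<dots> = (\<Sum>k\<le>Suc n. fps_nth ?C k * (moment \<nu> (Suc n - k) / fact (Suc n - k)))"
    by (simp add: fps_mult_nth atLeast0AtMost exp_gen_def)
  also have "\<dots> = (\<Sum>k\<le>n. fps_nth ?C (Suc k) * (moment \<nu> (n - k) / fact (n - k)))"
    by (subst sum.atMost_Suc_shift) (simp add: lead_cumulant_def)
  also have "\<dots> = fps_nth ?C (Suc n) + (\<Sum>k<n. fps_nth ?C (Suc k) * (moment \<nu> (n - k) / fact (n - k)))"
    by (simp add: lessThan_Suc_atMost[symmetric] moment_0)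
  finally have "fact n * fps_nth ?C (Suc n) = moment \<nu> (Suc n)
      - fact n * (\<Sum>k<n. fps_nth ?C (Suc k) * (moment \<nu> (n - k) / fact (n - k)))"
    by (simp add: field_simps)
  also have "fact n * (\<Sum>k<n. fps_nth ?C (Suc k) * (moment \<nu> (n - k) / fact (n - k)))
      = (\<Sum>k<n. real (n choose k) * (fact k * fps_nth ?C (Suc k)) * moment \<nu> (n - k))"
    unfolding sum_distrib_left by (rule sum.cong) (auto simp: binomial_fact)
  finally show ?thesis .
qed

lemma log_deriv_char_at_0:
  "log_deriv char_deriv n 0 = \<i> ^ Suc n * complex_of_real (fact n * fps_nth (lead_cumulant (moment \<nu>)) (Suc n))"
proof (induction n rule: less_induct)
  case (less n)
  let ?K = "\<lambda>k. fact k * fps_nth (lead_cumulant (moment \<nu>)) (Suc k)"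
  have "log_deriv char_deriv n 0 = \<i> ^ Suc n * complex_of_real (moment \<nu> (Suc n))
      - (\<Sum>k<n. of_nat (n choose k) * (log_deriv char_deriv k 0 * (\<i> ^ (n - k) * complex_of_real (moment \<nu> (n - k)))))"
    by (subst log_deriv.simps) (simp add: char_deriv_at_0 moment_0)
  also have "(\<Sum>k<n. of_nat (n choose k) * (log_deriv char_deriv k 0 * (\<i> ^ (n - k) * complex_of_real (moment \<nu> (n - k)))))
      = (\<Sum>k<n. \<i> ^ Suc n * complex_of_real (real (n choose k) * ?K k * moment \<nu> (n - k)))"
  proof (rule sum.cong[OF refl])
    fix k assume "k \<in> {..<n}"
    then have "\<i> ^ Suc k * \<i> ^ (n - k) = \<i> ^ Suc n" "k < n"
      by (simp_all flip: power_add)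
    then show "of_nat (n choose k) * (log_deriv char_deriv k 0 * (\<i> ^ (n - k) * complex_of_real (moment \<nu> (n - k))))
        = \<i> ^ Suc n * complex_of_real (real (n choose k) * ?K k * moment \<nu> (n - k))"
      by (simp add: less.IH mult_ac del: power_Suc)
  qed
  also have "\<i> ^ Suc n * complex_of_real (moment \<nu> (Suc n)) - \<dots> = \<i> ^ Suc n * complex_of_real (?K n)"
    unfolding lead_cumulant_Suc[of n] sum_distrib_left[symmetric] right_diff_distrib[symmetric] of_real_sum of_real_diff ..
  finally show ?case .
qed

lemma cumulant_Suc: "cumulant \<nu> (Suc n) = fact n * fps_nth (lead_cumulant (moment \<nu>)) (Suc n)"
proof -
  have c: "char \<nu> = char_deriv 0"
    by (rule ext) (simp add: char_def char_deriv_def)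
  have "continuous_on UNIV (char_deriv 0)"
    by (auto intro!: continuous_at_imp_continuous_on has_vector_derivative_continuous char_deriv_has_vector_derivative)
  then have "open {t. Re (char_deriv 0 t) > 0}"
    by (auto intro!: open_Collect_less continuous_intros)
  \<comment> \<open>On \<open>U\<close> the values avoid 0 and the branch cut of \<open>Ln\<close>;
    it contains 0, where the characteristic function is 1.\<close>
  moreover define U where "U = {t. Re (char_deriv 0 t) > 0}"
  ultimately have "open U" by simp
  have U: "char_deriv 0 t \<notin> \<real>\<^sub>\<le>\<^sub>0" "char_deriv 0 t \<noteq> 0" if "t \<in> U" for t
    using that by (auto simp: U_def complex_nonpos_Reals_iff)
  have 0: "0 \<in> U"
    by (simp add: U_def char_deriv_at_0 moment_0)
  define G where "G = (\<lambda>n. case n of 0 \<Rightarrow> (\<lambda>t. Ln (char_deriv 0 t)) | Suc m \<Rightarrow> log_deriv char_deriv m)"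
  have der: "(G n has_vector_derivative G (Suc n) t) (at t)" if "t \<in> U" for n t
  proof (cases n)
    case 0
    have "(Ln \<circ> char_deriv 0 has_vector_derivative char_deriv (Suc 0) t * inverse (char_deriv 0 t)) (at t)"
      by (rule field_vector_diff_chain_at[OF char_deriv_has_vector_derivative has_field_derivative_Ln[OF U(1)[OF that]]])
    moreover have "log_deriv char_deriv 0 t = char_deriv (Suc 0) t * inverse (char_deriv 0 t)"
      by (subst log_deriv.simps) (simp add: divide_inverse)
    ultimately show ?thesis by (simp add: 0 G_def o_def)
  next
    case (Suc m)
    then show ?thesis
      using log_deriv_has_vector_derivative[of U char_deriv t m, OF char_deriv_has_vector_derivative U(2) that]
      by (simp add: G_def)
  qed
  have "nth_vderiv (Suc n) (\<lambda>t. Ln (char \<nu> t)) 0 = G (Suc n) 0"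
    by (rule nth_vderiv_eqI[where G = G, OF \<open>open U\<close> der _ 0]) (simp_all add: G_def c)
  also have "\<dots> = \<i> ^ Suc n * complex_of_real (fact n * fps_nth (lead_cumulant (moment \<nu>)) (Suc n))"
    unfolding G_def using log_deriv_char_at_0[of n] by simp
  finally have "(- \<i>) ^ Suc n * nth_vderiv (Suc n) (\<lambda>t. Ln (char \<nu> t)) 0
      = ((- \<i>) ^ Suc n * \<i> ^ Suc n) * complex_of_real (fact n * fps_nth (lead_cumulant (moment \<nu>)) (Suc n))"
    by (simp only: mult.assoc)
  also have "(- \<i>) ^ Suc n * \<i> ^ Suc n = 1"
    by (subst power_mult_distrib[symmetric]) simp
  finally show ?thesis
    unfolding cumulant_def by (simp only: mult_1_left Re_complex_of_real)
qed

end

subsection \<open>Gaussian tilts\<close>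

abbreviation "gaussian \<equiv> std_normal_distribution"

text \<open>The density of N(t, 1) relative to N(0, 1); as a function of \<open>t\<close> it is also
  the generating function of the polynomials \<open>hermite j\<close>.\<close>

definition tilt :: "real \<Rightarrow> real \<Rightarrow> real" where
  "tilt t y = exp (t * y - t\<^sup>2 / 2)"

lemma tilt_pos [simp]: "tilt t y > 0" and tilt_nonneg [simp]: "tilt t y \<ge> 0"
  by (simp_all add: tilt_def)

lemma tilt_measurable [measurable (raw)]:
  assumes [measurable]: "f \<in> borel_measurable M" "g \<in> borel_measurable M"
  shows "(\<lambda>x. tilt (f x) (g x)) \<in> borel_measurable M"
  unfolding tilt_def by measurable

text \<open>Completing the square gives a bound uniform in \<open>t\<close>; hence tilted integrals
  over x are finite for every integrable function, without exponential moments.\<close>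

lemma tilt_le: "tilt t y \<le> exp (y\<^sup>2 / 2)"
proof -
  have "(y - t)\<^sup>2 \<ge> 0" by simp
  then show ?thesis by (simp add: tilt_def power2_eq_square algebra_simps)
qed

text \<open>One constant serves all large exponents, so that different polynomial bounds can later
  share a common exponent.\<close>

lemma abs_poly_le_power:
  fixes p :: "real poly"
  shows "\<exists>C\<ge>0. \<forall>d\<ge>degree p. \<forall>x. \<bar>poly p x\<bar> \<le> C * (1 + \<bar>x\<bar>) ^ d"
proof (intro exI conjI allI impI)
  let ?C = "\<Sum>i\<le>degree p. \<bar>coeff p i\<bar>"
  show "?C \<ge> 0" by (simp add: sum_nonneg)
  fix d x assume d: "degree p \<le> d"
  have "\<bar>poly p x\<bar> \<le> (\<Sum>i\<le>degree p. \<bar>coeff p i\<bar> * \<bar>x\<bar> ^ i)"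
    unfolding poly_altdef by (rule order_trans[OF sum_abs]) (simp add: abs_mult power_abs)
  also have "\<dots> \<le> (\<Sum>i\<le>degree p. \<bar>coeff p i\<bar> * (1 + \<bar>x\<bar>) ^ d)"
  proof (intro sum_mono mult_left_mono)
    fix i assume "i \<in> {..degree p}"
    then have "(1 + \<bar>x\<bar>) ^ i \<le> (1 + \<bar>x\<bar>) ^ d" using d by (intro power_increasing) auto
    moreover have "\<bar>x\<bar> ^ i \<le> (1 + \<bar>x\<bar>) ^ i" by (intro power_mono) auto
    ultimately show "\<bar>x\<bar> ^ i \<le> (1 + \<bar>x\<bar>) ^ d" by simp
  qed simp
  finally show "\<bar>poly p x\<bar> \<le> ?C * (1 + \<bar>x\<bar>) ^ d" by (simp add: sum_distrib_right)
qed

lemma one_plus_power_le_exp: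
  fixes u :: real
  assumes "u \<ge> 0"
  shows "(1 + u) ^ d \<le> real d ^ d * exp u"
proof (cases "d = 0")
  case False
  have "1 + u \<le> real d + u" using False by simp
  also have "\<dots> = real d * (1 + u / real d)" using False by (simp add: field_simps)
  also have "\<dots> \<le> real d * exp (u / real d)"
    by (intro mult_left_mono exp_ge_add_one_self) simp
  finally have "(1 + u) ^ d \<le> (real d * exp (u / real d)) ^ d"
    using assms by (intro power_mono) auto
  also have "\<dots> = real d ^ d * exp u"
    using False by (simp add: power_mult_distrib exp_of_nat_mult[symmetric])
  finally show ?thesis .
qed (use assms in simp)

lemma abs_poly_le_exp:
  fixes p :: "real poly"
  shows "\<exists>C\<ge>0. \<forall>x. \<bar>poly p x\<bar> \<le> C * exp \<bar>x\<bar>"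
proof -
  obtain C where C: "C \<ge> 0" "\<And>x. \<bar>poly p x\<bar> \<le> C * (1 + \<bar>x\<bar>) ^ degree p"
    using abs_poly_le_power[of p] by blast
  have "\<bar>poly p x\<bar> \<le> (C * real (degree p) ^ degree p) * exp \<bar>x\<bar>" for x
    using mult_left_mono[OF one_plus_power_le_exp[of "\<bar>x\<bar>" "degree p"] C(1)] C(2)[of x]
    by (simp add: mult.assoc)
  moreover have "C * real (degree p) ^ degree p \<ge> 0" using C(1) by simp
  ultimately show ?thesis by blast
qed

text \<open>Rodrigues' formula in the shift variable. The argument \<open>y - t\<close> comes from
  \<open>tilt (t + h) y = tilt t y * tilt h (y - t)\<close>.\<close>

lemma DERIV_hermite_tilt:
  "DERIV (\<lambda>t. fact m * poly (hermite m) (y - t) * tilt t y) t :>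
     fact (Suc m) * poly (hermite (Suc m)) (y - t) * tilt t y"
proof -
  have "DERIV (\<lambda>t. poly (hermite m) (y - t)) t :> poly (pderiv (hermite m)) (y - t) * (0 - 1)"
    by (rule DERIV_chain2[OF poly_DERIV]) (auto intro!: derivative_eq_intros)
  moreover have "DERIV (\<lambda>t. tilt t y) t :> (y - t) * tilt t y"
    unfolding tilt_def by (auto intro!: derivative_eq_intros simp: power2_eq_square)
  ultimately have "DERIV (\<lambda>t. poly (hermite m) (y - t) * tilt t y) t :>
      poly (pderiv (hermite m)) (y - t) * (0 - 1) * tilt t y + (y - t) * tilt t y * poly (hermite m) (y - t)"
    by (rule DERIV_mult)
  also have "poly (pderiv (hermite m)) (y - t) * (0 - 1) * tilt t y + (y - t) * tilt t y * poly (hermite m) (y - t)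
      = poly ([:0, 1:] * hermite m - pderiv (hermite m)) (y - t) * tilt t y"
    by (simp add: algebra_simps)
  also have "\<dots> = real (Suc m) * poly (hermite (Suc m)) (y - t) * tilt t y"
    unfolding hermite_Suc_mult[symmetric] by (simp del: hermite.simps)
  finally have "DERIV (\<lambda>t. fact m * (poly (hermite m) (y - t) * tilt t y)) t :>
      fact m * (real (Suc m) * poly (hermite (Suc m)) (y - t) * tilt t y)"
    by (rule DERIV_cmult)
  then show ?thesis by (simp add: mult_ac del: hermite.simps of_nat_Suc)
qed

text \<open>For \<open>\<bar>t\<bar> > 1\<close> the Taylor remainder is only controlled by the tilt itself, which is what makes the
  bound usable without exponential moments.\<close>

lemma tilt_Taylor:
  "\<exists>C\<ge>0. \<forall>t y. \<bar>tilt t y - (\<Sum>j<M. t ^ j * poly (hermite j) y)\<bar> \<le> \<bar>t\<bar> ^ M * (C * exp (2 * \<bar>y\<bar>) + tilt t y)"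
proof -
  have "\<forall>j. \<exists>B\<ge>0. \<forall>x. \<bar>poly (hermite j) x\<bar> \<le> B * exp \<bar>x\<bar>"
    using abs_poly_le_exp by blast
  then obtain B where B: "\<And>j. B j \<ge> 0" "\<And>j x. \<bar>poly (hermite j) x\<bar> \<le> B j * exp \<bar>x\<bar>"
    by metis
  define C where "C = B M * exp 1 + (\<Sum>j<M. B j)"
  have C: "C \<ge> 0" "B M * exp 1 \<le> C" "(\<Sum>j<M. B j) \<le> C"
    using B(1) by (auto simp: C_def sum_nonneg)
  have "\<bar>tilt t y - (\<Sum>j<M. t ^ j * poly (hermite j) y)\<bar> \<le> \<bar>t\<bar> ^ M * (C * exp (2 * \<bar>y\<bar>) + tilt t y)" for t y
  proof (cases "\<bar>t\<bar> \<le> 1")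
    case True
    obtain u where u: "\<bar>u\<bar> \<le> \<bar>t\<bar>" and eq: "tilt t y = (\<Sum>m<M. (fact m * poly (hermite m) (y - 0) * tilt 0 y) / fact m * t ^ m)
        + (fact M * poly (hermite M) (y - u) * tilt u y) / fact M * t ^ M"
      using Maclaurin_bi_le[of "\<lambda>m t. fact m * poly (hermite m) (y - t) * tilt t y" "\<lambda>t. tilt t y" M t]
        DERIV_hermite_tilt by (auto simp del: hermite.simps(2))
    have "tilt t y - (\<Sum>j<M. t ^ j * poly (hermite j) y) = poly (hermite M) (y - u) * tilt u y * t ^ M"
      unfolding eq by (simp add: tilt_def mult.commute)
    then have "\<bar>tilt t y - (\<Sum>j<M. t ^ j * poly (hermite j) y)\<bar> = \<bar>poly (hermite M) (y - u)\<bar> * tilt u y * \<bar>t\<bar> ^ M"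
      by (simp add: abs_mult power_abs)
    also have "\<dots> \<le> (B M * exp 1 * exp \<bar>y\<bar>) * exp \<bar>y\<bar> * \<bar>t\<bar> ^ M"
    proof (intro mult_right_mono mult_mono)
      have "\<bar>y - u\<bar> \<le> 1 + \<bar>y\<bar>" using u True by linarith
      then have "B M * exp \<bar>y - u\<bar> \<le> B M * exp (1 + \<bar>y\<bar>)" using B(1) by (intro mult_left_mono) auto
      with B(2)[of M "y - u"] show "\<bar>poly (hermite M) (y - u)\<bar> \<le> B M * exp 1 * exp \<bar>y\<bar>"
        by (simp add: exp_add mult.assoc)
      have "u * y \<le> \<bar>u\<bar> * \<bar>y\<bar>" by (metis abs_ge_self abs_mult)
      also have "\<dots> \<le> 1 * \<bar>y\<bar>" using u True by (intro mult_right_mono) auto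
      finally have "u * y - u\<^sup>2 / 2 \<le> \<bar>y\<bar>" using zero_le_power2[of u] by linarith
      then show "tilt u y \<le> exp \<bar>y\<bar>" by (simp add: tilt_def)
    qed (use B(1) in auto)
    also have "\<dots> = \<bar>t\<bar> ^ M * (B M * exp 1 * exp (2 * \<bar>y\<bar>))"
      by (simp add: exp_add[symmetric] mult_ac)
    also have "\<dots> \<le> \<bar>t\<bar> ^ M * (C * exp (2 * \<bar>y\<bar>) + tilt t y)"
      using C(2) by (intro mult_left_mono add_increasing2 mult_right_mono) auto
    finally show ?thesis .
  next
    case False
    have "\<bar>\<Sum>j<M. t ^ j * poly (hermite j) y\<bar> \<le> (\<Sum>j<M. \<bar>t ^ j * poly (hermite j) y\<bar>)"
      by (rule sum_abs)
    also have "\<dots> \<le> (\<Sum>j<M. \<bar>t\<bar> ^ M * (B j * exp (2 * \<bar>y\<bar>)))"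
    proof (rule sum_mono)
      fix j assume "j \<in> {..<M}"
      then have "\<bar>t\<bar> ^ j \<le> \<bar>t\<bar> ^ M" using False by (intro power_increasing) auto
      moreover have "\<bar>poly (hermite j) y\<bar> \<le> B j * exp (2 * \<bar>y\<bar>)"
        by (rule order_trans[OF B(2)]) (auto intro!: mult_left_mono B(1))
      ultimately show "\<bar>t ^ j * poly (hermite j) y\<bar> \<le> \<bar>t\<bar> ^ M * (B j * exp (2 * \<bar>y\<bar>))"
        unfolding abs_mult power_abs by (intro mult_mono) auto
    qed
    also have "\<dots> = \<bar>t\<bar> ^ M * ((\<Sum>j<M. B j) * exp (2 * \<bar>y\<bar>))"
      by (simp add: sum_distrib_left sum_distrib_right)
    also have "\<dots> \<le> \<bar>t\<bar> ^ M * (C * exp (2 * \<bar>y\<bar>))"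
      using C(3) by (intro mult_left_mono mult_right_mono) auto
    finally have 1: "\<bar>\<Sum>j<M. t ^ j * poly (hermite j) y\<bar> \<le> \<bar>t\<bar> ^ M * (C * exp (2 * \<bar>y\<bar>))" .
    have "1 \<le> \<bar>t\<bar> ^ M" using False by (intro one_le_power) auto
    then have "tilt t y \<le> \<bar>t\<bar> ^ M * tilt t y" using mult_right_mono[of 1 "\<bar>t\<bar> ^ M" "tilt t y"] by simp
    with 1 show ?thesis
      unfolding distrib_left using tilt_nonneg[of t y] by linarith
  qed
  with C(1) show ?thesis by blast
qed

text \<open>The Cameron-Martin formula: translating the Gaussian by \<open>t\<close> amounts to
  reweighting it with the tilt.\<close>

lemma nn_integral_gaussian_shift:
  fixes g :: "real \<Rightarrow> ennreal"
  assumes [measurable]: "g \<in> borel_measurable borel"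
  shows "(\<integral>\<^sup>+n. g (t + n) \<partial>gaussian) = (\<integral>\<^sup>+y. tilt t y * g y \<partial>gaussian)"
proof -
  have eq: "std_normal_density (y - t) = std_normal_density y * tilt t y" for y
    by (simp add: std_normal_density_def tilt_def exp_add[symmetric] power2_eq_square field_simps)
  have "(\<integral>\<^sup>+n. g (t + n) \<partial>gaussian) = (\<integral>\<^sup>+n. std_normal_density n * g (t + n) \<partial>lborel)"
    by (subst nn_integral_density) auto
  also have "\<dots> = (\<integral>\<^sup>+y. std_normal_density (y - t) * g y \<partial>lborel)"
    by (subst nn_integral_real_affine[of "\<lambda>y. std_normal_density (y - t) * g y" 1 t]) auto
  also have "\<dots> = (\<integral>\<^sup>+y. tilt t y * g y \<partial>gaussian)"
    unfolding eq by (subst nn_integral_density) (auto simp: ennreal_mult mult.assoc)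
  finally show ?thesis .
qed

lemma integrable_gaussian_exp_abs: "integrable gaussian (\<lambda>y. exp (c * \<bar>y\<bar>))"
proof -
  have 1: "integrable gaussian (tilt t)" for t
  proof (rule integrableI_nonneg)
    interpret prob_space gaussian by (rule prob_space_normal_density) simp
    have "(\<integral>\<^sup>+y. ennreal (tilt t y) \<partial>gaussian) = (\<integral>\<^sup>+n. 1 \<partial>gaussian)"
      using nn_integral_gaussian_shift[of "\<lambda>_. 1" t] by simp
    also have "\<dots> = 1" using emeasure_space_1 by simp
    finally show "(\<integral>\<^sup>+y. ennreal (tilt t y) \<partial>gaussian) < \<infinity>" by simp
  qed auto
  have 2: "integrable gaussian (\<lambda>y. exp (c\<^sup>2 / 2) * (tilt c y + tilt (- c) y))"
    by (intro integrable_mult_right Bochner_Integration.integrable_add 1)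
  have "exp (c * \<bar>y\<bar>) \<le> exp (c\<^sup>2 / 2) * (tilt c y + tilt (- c) y)" for y
    by (cases "y \<ge> 0") (simp_all add: tilt_def distrib_left exp_add[symmetric])
  then have "AE y in gaussian. norm (exp (c * \<bar>y\<bar>)) \<le> norm (exp (c\<^sup>2 / 2) * (tilt c y + tilt (- c) y))"
    by (auto intro!: AE_I2 order_trans[OF _ abs_ge_self])
  then show ?thesis
    by (intro Bochner_Integration.integrable_bound[OF 2]) simp_all
qed

lemma gauss_ex_hermite_eq_higher_pderiv: "gauss_ex (hermite j * p) = gauss_ex ((pderiv ^^ j) p) / fact j"
proof (induction j arbitrary: p)
  case (Suc j)
  have "gauss_ex (hermite (Suc j) * p) = gauss_ex (hermite j * pderiv p) / real (Suc j)"
    by (simp add: gauss_ex_hermite_Suc[symmetric] del: hermite.simps of_nat_Suc)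
  also have "\<dots> = gauss_ex ((pderiv ^^ j) (pderiv p)) / fact j / real (Suc j)"
    unfolding Suc ..
  also have "\<dots> = gauss_ex ((pderiv ^^ Suc j) p) / fact (Suc j)"
    unfolding funpow_Suc_right o_apply fact_Suc by (simp add: mult.commute del: of_nat_Suc)
  finally show ?case .
qed simp

text \<open>Taylor's formula is finite here because derivative D + 1 of \<open>p\<close> vanishes;
  repeated integration by parts turns the mean of each derivative into a Hermite pairing.\<close>

lemma integral_gaussian_poly_shift:
  fixes p :: "real poly"
  assumes "degree p \<le> D"
  shows "(\<integral>n. poly p (t + n) \<partial>gaussian) = (\<Sum>j\<le>D. t ^ j * gauss_ex (hermite j * p))"
proof -
  have 0: "(pderiv ^^ Suc D) p = 0"
    using assms by (simp add: pderiv_eq_0_iff degree_higher_pderiv)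
  have "poly p (t + n) = (\<Sum>j<Suc D. t ^ j / fact j * poly ((pderiv ^^ j) p) n)" for n
  proof -
    have der: "DERIV (\<lambda>s. poly ((pderiv ^^ m) p) (s + n)) s :> poly ((pderiv ^^ Suc m) p) (s + n)" for m s
      by (rule DERIV_cong[OF DERIV_chain2[OF poly_DERIV]]) (auto intro!: derivative_eq_intros)
    obtain u where "poly p (t + n) = (\<Sum>m<Suc D. poly ((pderiv ^^ m) p) (0 + n) / fact m * t ^ m)
        + poly ((pderiv ^^ Suc D) p) (u + n) / fact (Suc D) * t ^ Suc D"
      using Maclaurin_bi_le[of "\<lambda>m s. poly ((pderiv ^^ m) p) (s + n)" "\<lambda>s. poly p (s + n)" "Suc D" t] der
      by (auto simp del: funpow.simps(2) fact_Suc power_Suc)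
    then show ?thesis unfolding 0 by (simp add: mult_ac)
  qed
  then have "(\<integral>n. poly p (t + n) \<partial>gaussian) = (\<integral>n. (\<Sum>j<Suc D. t ^ j / fact j * poly ((pderiv ^^ j) p) n) \<partial>gaussian)"
    by simp
  also have "\<dots> = (\<Sum>j<Suc D. t ^ j / fact j * gauss_ex ((pderiv ^^ j) p))"
    unfolding gauss_ex_def by (subst Bochner_Integration.integral_sum) (auto intro!: integrable_mult_right integrable_std_normal_poly)
  also have "\<dots> = (\<Sum>j\<le>D. t ^ j * gauss_ex (hermite j * p))"
    by (simp only: gauss_ex_hermite_eq_higher_pderiv lessThan_Suc_atMost) (simp add: field_simps)
  finally show ?thesis .
qed

subsection \<open>The conditional mean and the minimum mean square error\<close>

lemma integrable_one_plus_abs_power: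
  assumes "prob_space M" and [measurable]: "X \<in> borel_measurable M" and "integrable M (\<lambda>x. \<bar>X x\<bar> ^ d)"
  shows "integrable M (\<lambda>x. (1 + \<bar>X x\<bar> :: real) ^ d)"
proof -
  interpret prob_space M by fact
  have int: "integrable M (\<lambda>x. 2 ^ d * (1 + \<bar>X x\<bar> ^ d))"
    using assms(3) by simp
  have "(1 + \<bar>u\<bar>) ^ d \<le> 2 ^ d * (1 + \<bar>u\<bar> ^ d)" for u :: real
  proof -
    have "(1 + \<bar>u\<bar>) ^ d \<le> (2 * max 1 \<bar>u\<bar>) ^ d" by (intro power_mono) auto
    also have "\<dots> = 2 ^ d * (max 1 \<bar>u\<bar>) ^ d" by (simp add: power_mult_distrib)
    also have "\<dots> \<le> 2 ^ d * (1 + \<bar>u\<bar> ^ d)" by (intro mult_left_mono) (auto simp: max_def)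
    finally show ?thesis .
  qed
  then have "AE x in M. norm ((1 + \<bar>X x\<bar>) ^ d) \<le> norm (2 ^ d * (1 + \<bar>X x\<bar> ^ d))"
    by (intro AE_I2) (auto simp: abs_of_nonneg)
  then show ?thesis
    by (intro Bochner_Integration.integrable_bound[OF int]) simp_all
qed

lemma integrable_mult_of_squares:
  fixes f g :: "'c \<Rightarrow> real"
  assumes [measurable]: "f \<in> borel_measurable M" "g \<in> borel_measurable M"
    and "integrable M (\<lambda>x. (f x)\<^sup>2)" "integrable M (\<lambda>x. (g x)\<^sup>2)"
  shows "integrable M (\<lambda>x. f x * g x)"
proof (rule Bochner_Integration.integrable_bound)
  show "integrable M (\<lambda>x. (f x)\<^sup>2 + (g x)\<^sup>2)" using assms by simp
  have "\<bar>u * v\<bar> \<le> u\<^sup>2 + v\<^sup>2" for u v :: real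
  proof -
    have "0 \<le> (\<bar>u\<bar> - \<bar>v\<bar>)\<^sup>2" by simp
    then have "2 * (\<bar>u\<bar> * \<bar>v\<bar>) \<le> u\<^sup>2 + v\<^sup>2" by (simp add: power2_diff)
    moreover have "0 \<le> \<bar>u\<bar> * \<bar>v\<bar>" by simp
    ultimately show ?thesis unfolding abs_mult by linarith
  qed
  then show "AE x in M. norm (f x * g x) \<le> norm ((f x)\<^sup>2 + (g x)\<^sup>2)"
    by (intro AE_I2) (auto simp: abs_of_nonneg)
qed simp

context moment_law
begin

sublocale P: pair_prob_space \<nu> gaussian
proof -
  interpret N: prob_space gaussian by (rule prob_space_normal_density) simp
  show "pair_prob_space \<nu> gaussian" ..
qed

abbreviation joint :: "(real \<times> real) measure" where
  "joint \<equiv> \<nu> \<Otimes>\<^sub>M gaussian"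

lemma sets_joint [measurable_cong, simp]: "sets joint = sets (borel \<Otimes>\<^sub>M borel)"
  by (intro sets_pair_measure_cong) auto

lemma space_joint [simp]: "space joint = UNIV"
  by (simp add: space_pair_measure)

lemma nn_integral_joint_shift:
  fixes F :: "real \<times> real \<Rightarrow> ennreal"
  assumes [measurable]: "F \<in> borel_measurable (borel \<Otimes>\<^sub>M borel)"
  shows "(\<integral>\<^sup>+z. F (fst z, e * fst z + snd z) \<partial>joint) = (\<integral>\<^sup>+z. tilt (e * fst z) (snd z) * F z \<partial>joint)"
proof -
  have "(\<integral>\<^sup>+z. F (fst z, e * fst z + snd z) \<partial>joint) = (\<integral>\<^sup>+x. (\<integral>\<^sup>+n. F (x, e * x + n) \<partial>gaussian) \<partial>\<nu>)"
    by (subst P.M2.nn_integral_fst[symmetric]) simp_all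
  also have "\<dots> = (\<integral>\<^sup>+x. (\<integral>\<^sup>+y. tilt (e * x) y * F (x, y) \<partial>gaussian) \<partial>\<nu>)"
    by (subst nn_integral_gaussian_shift) simp_all
  also have "\<dots> = (\<integral>\<^sup>+z. tilt (e * fst z) (snd z) * F z \<partial>joint)"
    by (subst P.M2.nn_integral_fst[symmetric]) simp_all
  finally show ?thesis .
qed

text \<open>The pair of signal and observation has a density relative to the product law. After this
  change of measure the observation is a plain coordinate, and Fubini separates it from the
  signal.\<close>

lemma distr_joint_shift:
  "distr joint (borel \<Otimes>\<^sub>M borel) (\<lambda>z. (fst z, e * fst z + snd z)) = density joint (\<lambda>z. tilt (e * fst z) (snd z))"
proof (rule measure_eqI)
  fix A assume "A \<in> sets (distr joint (borel \<Otimes>\<^sub>M borel) (\<lambda>z. (fst z, e * fst z + snd z)))"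
  then have A [measurable]: "A \<in> sets (borel \<Otimes>\<^sub>M borel)" by simp
  have "emeasure (distr joint (borel \<Otimes>\<^sub>M borel) (\<lambda>z. (fst z, e * fst z + snd z))) A
      = (\<integral>\<^sup>+z. indicator A z \<partial>distr joint (borel \<Otimes>\<^sub>M borel) (\<lambda>z. (fst z, e * fst z + snd z)))"
    by (subst nn_integral_indicator) simp_all
  also have "\<dots> = (\<integral>\<^sup>+z. indicator A (fst z, e * fst z + snd z) \<partial>joint)"
    by (subst nn_integral_distr) simp_all
  also have "\<dots> = (\<integral>\<^sup>+z. tilt (e * fst z) (snd z) * (indicator A z :: ennreal) \<partial>joint)"
    by (rule nn_integral_joint_shift) simp
  also have "\<dots> = emeasure (density joint (\<lambda>z. tilt (e * fst z) (snd z))) A"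
    by (subst emeasure_density) simp_all
  finally show "emeasure (distr joint (borel \<Otimes>\<^sub>M borel) (\<lambda>z. (fst z, e * fst z + snd z))) A
      = emeasure (density joint (\<lambda>z. tilt (e * fst z) (snd z))) A" .
qed simp

lemma integrable_joint_shift:
  fixes F :: "real \<times> real \<Rightarrow> real"
  assumes [measurable]: "F \<in> borel_measurable (borel \<Otimes>\<^sub>M borel)"
  shows "integrable joint (\<lambda>z. F (fst z, e * fst z + snd z))
     \<longleftrightarrow> integrable joint (\<lambda>z. tilt (e * fst z) (snd z) * F z)"
proof -
  have "integrable joint (\<lambda>z. F (fst z, e * fst z + snd z))
      \<longleftrightarrow> integrable (distr joint (borel \<Otimes>\<^sub>M borel) (\<lambda>z. (fst z, e * fst z + snd z))) F"
    by (subst integrable_distr_eq) simp_all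
  also have "\<dots> \<longleftrightarrow> integrable joint (\<lambda>z. tilt (e * fst z) (snd z) * F z)"
    unfolding distr_joint_shift by (subst integrable_density) simp_all
  finally show ?thesis .
qed

lemma integral_joint_shift:
  fixes F :: "real \<times> real \<Rightarrow> real"
  assumes [measurable]: "F \<in> borel_measurable (borel \<Otimes>\<^sub>M borel)"
  shows "(\<integral>z. F (fst z, e * fst z + snd z) \<partial>joint) = (\<integral>z. tilt (e * fst z) (snd z) * F z \<partial>joint)"
proof -
  have "(\<integral>z. F (fst z, e * fst z + snd z) \<partial>joint)
      = integral\<^sup>L (distr joint (borel \<Otimes>\<^sub>M borel) (\<lambda>z. (fst z, e * fst z + snd z))) F"
    by (subst integral_distr) simp_all
  also have "\<dots> = (\<integral>z. tilt (e * fst z) (snd z) * F z \<partial>joint)"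
    unfolding distr_joint_shift by (subst integral_density) simp_all
  finally show ?thesis .
qed

text \<open>The analytic counterpart of \<open>noisy_density\<close>: the density of the observation
  relative to the noise. Next to it, \<open>post_mean\<close> is Bayes' formula for the conditional
  mean.\<close>

definition marginal :: "real \<Rightarrow> real \<Rightarrow> real" where
  "marginal e y = (\<integral>x. tilt (e * x) y \<partial>\<nu>)"

definition post_mean :: "real \<Rightarrow> real \<Rightarrow> real" where
  "post_mean e y = (\<integral>x. x * tilt (e * x) y \<partial>\<nu>) / marginal e y"

lemma marginal_measurable [measurable]: "marginal e \<in> borel_measurable borel"
  unfolding marginal_def[abs_def] by measurable

lemma post_mean_measurable [measurable]: "post_mean e \<in> borel_measurable borel"
  unfolding post_mean_def[abs_def] by measurable

lemma integrable_tilt: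
  assumes "integrable \<nu> g"
  shows "integrable \<nu> (\<lambda>x. g x * tilt (e * x) y)"
proof (rule Bochner_Integration.integrable_bound)
  show "integrable \<nu> (\<lambda>x. exp (y\<^sup>2 / 2) * g x)" using assms by simp
  have [measurable]: "g \<in> borel_measurable borel" using borel_measurable_integrable[OF assms] by simp
  show "(\<lambda>x. g x * tilt (e * x) y) \<in> borel_measurable \<nu>" by measurable
  show "AE x in \<nu>. norm (g x * tilt (e * x) y) \<le> norm (exp (y\<^sup>2 / 2) * g x)"
  proof (rule AE_I2)
    fix x show "norm (g x * tilt (e * x) y) \<le> norm (exp (y\<^sup>2 / 2) * g x)"
      using mult_left_mono[OF tilt_le[of "e * x" y], of "\<bar>g x\<bar>"] by (simp add: abs_mult mult.commute)
  qed
qed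

lemma integrable_tilt_1: "integrable \<nu> (\<lambda>x. tilt (e * x) y)"
  using integrable_tilt[of "\<lambda>_. 1" e y] by simp

text \<open>Jensen's inequality, proved by the tangent of exp at \<open>c\<close>, the mean of the
  exponent; centring removes its part linear in y. Uniformity in y is what later permits division by
  the marginal.\<close>

lemma marginal_lower:
  assumes "moment \<nu> 1 = 0"
  shows "exp (- (e\<^sup>2 * moment \<nu> 2 / 2)) \<le> marginal e y"
proof -
  define c where "c = - (e\<^sup>2 * moment \<nu> 2 / 2)"
  define g where "g = (\<lambda>x. exp c * (1 + (e * y * x ^ 1 - e\<^sup>2 / 2 * x ^ 2) - c))"
  have int: "integrable \<nu> g"
    unfolding g_def by (intro integrable_mult_right Bochner_Integration.integrable_add
        Bochner_Integration.integrable_diff integrable_power integrable_const)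
  have "(\<integral>x. g x \<partial>\<nu>) = exp c * (1 + (e * y * moment \<nu> 1 - e\<^sup>2 / 2 * moment \<nu> 2) - c)"
    unfolding g_def moment_def using integrable_power[of 1] integrable_power[of 2] prob_space
    by (simp del: integrable_power)
  also have "\<dots> = exp c" using assms by (simp add: c_def)
  finally have "exp c = (\<integral>x. g x \<partial>\<nu>)" ..
  also have "\<dots> \<le> marginal e y"
    unfolding marginal_def
  proof (rule integral_mono[OF int integrable_tilt_1])
    fix x
    have "g x \<le> exp c * exp (e * y * x - e\<^sup>2 / 2 * x\<^sup>2 - c)"
    proof -
      have "1 + (e * y * x - e\<^sup>2 / 2 * x\<^sup>2) - c \<le> exp (e * y * x - e\<^sup>2 / 2 * x\<^sup>2 - c)"
        using exp_ge_add_one_self[of "e * y * x - e\<^sup>2 / 2 * x\<^sup>2 - c"] by linarith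
      from mult_left_mono[OF this, of "exp c"] show ?thesis by (simp add: g_def)
    qed
    also have "\<dots> = tilt (e * x) y"
      by (simp add: tilt_def exp_add[symmetric] power_mult_distrib mult_ac)
    finally show "g x \<le> tilt (e * x) y" .
  qed
  finally show ?thesis by (simp add: c_def)
qed

lemma marginal_pos: "moment \<nu> 1 = 0 \<Longrightarrow> marginal e y > 0"
  using marginal_lower[of e y] by (meson exp_gt_zero less_le_trans)

lemma integral_joint_tilt:
  assumes "integrable joint (\<lambda>z. tilt (e * fst z) (snd z) * (g (fst z) * b (snd z)))"
  shows "(\<integral>z. tilt (e * fst z) (snd z) * (g (fst z) * b (snd z)) \<partial>joint)
       = (\<integral>y. b y * (\<integral>x. g x * tilt (e * x) y \<partial>\<nu>) \<partial>gaussian)"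
proof -
  have "(\<integral>y. (\<integral>x. tilt (e * x) y * (g x * b y) \<partial>\<nu>) \<partial>gaussian)
      = (\<integral>z. tilt (e * fst z) (snd z) * (g (fst z) * b (snd z)) \<partial>joint)"
    by (rule P.integral_snd[of "\<lambda>x y. tilt (e * x) y * (g x * b y)", unfolded case_prod_beta, OF assms])
  moreover have "(\<integral>x. tilt (e * x) y * (g x * b y) \<partial>\<nu>) = b y * (\<integral>x. g x * tilt (e * x) y \<partial>\<nu>)" for y
    by (subst integral_mult_right_zero[symmetric]) (simp add: mult_ac)
  ultimately show ?thesis by simp
qed

text \<open>The marginal cancels the denominator of \<open>post_mean\<close>. Unbounded test
  functions are allowed, since besides indicators (to identify the conditional expectation) the
  estimation error itself is inserted.\<close>

lemma integral_post_mean_orthogonal: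
  assumes mean: "moment \<nu> 1 = 0" and [measurable]: "b \<in> borel_measurable borel"
    and int1: "integrable joint (\<lambda>z. fst z * b (e * fst z + snd z))"
    and int2: "integrable joint (\<lambda>z. post_mean e (e * fst z + snd z) * b (e * fst z + snd z))"
  shows "(\<integral>z. fst z * b (e * fst z + snd z) \<partial>joint)
       = (\<integral>z. post_mean e (e * fst z + snd z) * b (e * fst z + snd z) \<partial>joint)"
proof -
  let ?T = "\<lambda>z. tilt (e * fst z) (snd z)"
  have 1: "integrable joint (\<lambda>z. ?T z * (fst z * b (snd z)))"
    using int1 integrable_joint_shift[of "\<lambda>z. fst z * b (snd z)" e] by simp
  have 2: "integrable joint (\<lambda>z. ?T z * (1 * (post_mean e (snd z) * b (snd z))))"
    using int2 integrable_joint_shift[of "\<lambda>z. post_mean e (snd z) * b (snd z)" e] by simp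
  have "(\<integral>z. fst z * b (e * fst z + snd z) \<partial>joint) = (\<integral>z. ?T z * (fst z * b (snd z)) \<partial>joint)"
    using integral_joint_shift[of "\<lambda>z. fst z * b (snd z)" e] by simp
  also have "\<dots> = (\<integral>y. b y * (\<integral>x. x * tilt (e * x) y \<partial>\<nu>) \<partial>gaussian)"
    using integral_joint_tilt[of e "\<lambda>x. x" b] 1 by simp
  also have "\<dots> = (\<integral>y. (post_mean e y * b y) * (\<integral>x. 1 * tilt (e * x) y \<partial>\<nu>) \<partial>gaussian)"
  proof (intro Bochner_Integration.integral_cong refl)
    fix y
    have "marginal e y \<noteq> 0" using marginal_pos[OF mean, of e y] by simp
    then show "b y * (\<integral>x. x * tilt (e * x) y \<partial>\<nu>) = post_mean e y * b y * (\<integral>x. 1 * tilt (e * x) y \<partial>\<nu>)"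
      by (simp add: post_mean_def marginal_def)
  qed
  also have "\<dots> = (\<integral>z. ?T z * (1 * (post_mean e (snd z) * b (snd z))) \<partial>joint)"
    using integral_joint_tilt[of e "\<lambda>_. 1" "\<lambda>y. post_mean e y * b y"] 2 by simp
  also have "\<dots> = (\<integral>z. post_mean e (e * fst z + snd z) * b (e * fst z + snd z) \<partial>joint)"
    using integral_joint_shift[of "\<lambda>z. post_mean e (snd z) * b (snd z)" e] by simp
  finally show ?thesis .
qed

lemma integrable_product_joint:
  fixes f g :: "real \<Rightarrow> real"
  assumes "integrable \<nu> f" "integrable gaussian g"
  shows "integrable joint (\<lambda>z. f (fst z) * g (snd z))"
proof (rule P.Fubini_integrable)
  have [measurable]: "f \<in> borel_measurable borel" "g \<in> borel_measurable borel"
    using assms[THEN borel_measurable_integrable] by simp_all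
  show "(\<lambda>z. f (fst z) * g (snd z)) \<in> borel_measurable joint" by measurable
  show "integrable \<nu> (\<lambda>x. \<integral>y. norm (f (fst (x, y)) * g (snd (x, y))) \<partial>gaussian)"
    using assms(1) by (simp add: abs_mult)
  show "AE x in \<nu>. integrable gaussian (\<lambda>y. f (fst (x, y)) * g (snd (x, y)))"
    using assms(2) by simp
qed

lemma integrable_dominating:
  "integrable joint (\<lambda>z. (1 + \<bar>fst z\<bar>) ^ i * (1 + \<bar>snd z\<bar>) ^ j)"
proof (rule integrable_product_joint)
  show "integrable \<nu> (\<lambda>x. (1 + \<bar>x\<bar>) ^ i)"
    by (rule integrable_one_plus_abs_power) (simp_all add: prob_space_axioms)
  have "integrable gaussian (\<lambda>x. \<bar>x\<bar> ^ j)"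
    using integrable_abs[OF integrable_std_normal_distribution_moment[of j]] by (simp add: power_abs)
  then show "integrable gaussian (\<lambda>x. (1 + \<bar>x\<bar>) ^ j)"
    by (intro integrable_one_plus_abs_power) (simp_all add: P.M2.prob_space_axioms)
qed

lemma square_integrable_fst: "integrable joint (\<lambda>z. (fst z)\<^sup>2)" "integrable joint fst"
  using integrable_product_joint[of "\<lambda>x. x ^ 2" "\<lambda>_. 1"] integrable_product_joint[of "\<lambda>x. x ^ 1" "\<lambda>_. 1"]
    integrable_power[of 1] by simp_all

lemma cond_exp_eq_post_mean:
  assumes mean: "moment \<nu> 1 = 0"
    and int: "integrable joint (\<lambda>z. post_mean e (e * fst z + snd z))"
  shows "AE z in joint. real_cond_exp joint (vimage_algebra (space joint) (\<lambda>z. e * fst z + snd z) borel) fst z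
           = post_mean e (e * fst z + snd z)"
proof -
  let ?Y = "\<lambda>z. e * fst z + snd z :: real"
  define F where "F = vimage_algebra (space joint) ?Y borel"
  have setsF: "sets F = {?Y -` A \<inter> UNIV | A. A \<in> sets borel}"
    unfolding F_def by (subst sets_vimage_algebra2) auto
  have Y [measurable]: "?Y \<in> measurable F borel"
    unfolding F_def by (rule measurable_vimage_algebra1) simp
  have "subalgebra joint F"
  proof -
    have "?Y -` A \<in> sets joint" if "A \<in> sets borel" for A
      using measurable_sets[of ?Y joint borel A] that by simp
    then show ?thesis
      unfolding subalgebra_def setsF by (auto simp: F_def)
  qed
  then interpret finite_measure_subalgebra joint F
    by unfold_locales
  have "AE z in joint. real_cond_exp joint F fst z = post_mean e (?Y z)"
  proof (rule real_cond_exp_charact[OF _ square_integrable_fst(2) int])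
    fix A assume A: "A \<in> sets F"
    then obtain B where B: "A = ?Y -` B" and [measurable]: "B \<in> sets borel"
      unfolding setsF by auto
    have ind: "indicator A z = (indicator B (?Y z) :: real)" for z
      by (simp add: B indicator_def)
    have "A \<in> sets joint" using A \<open>subalgebra joint F\<close> by (auto simp: subalgebra_def)
    then have "integrable joint (\<lambda>z. indicator A z *\<^sub>R fst z)"
        "integrable joint (\<lambda>z. indicator A z *\<^sub>R post_mean e (?Y z))"
      by (intro integrable_mult_indicator square_integrable_fst(2) int; assumption)+
    then show "(\<integral>z\<in>A. fst z \<partial>joint) = (\<integral>z\<in>A. post_mean e (?Y z) \<partial>joint)"
      unfolding set_lebesgue_integral_def ind
      using integral_post_mean_orthogonal[OF mean, of "indicator B" e] by (simp add: mult.commute)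
  qed measurable
  then show ?thesis by (simp add: F_def)
qed

lemma mmse_pythagoras:
  assumes mean: "moment \<nu> 1 = 0" and "e > 0" and [measurable]: "f \<in> borel_measurable borel"
    and f: "integrable joint (\<lambda>z. (f (e * fst z + snd z))\<^sup>2)"
    and b: "integrable joint (\<lambda>z. (f (e * fst z + snd z) - e * post_mean e (e * fst z + snd z))\<^sup>2)"
  shows "(\<integral>z. (e * fst z - f (e * fst z + snd z))\<^sup>2 \<partial>joint)
     = e\<^sup>2 * mmse \<nu> (e\<^sup>2) + (\<integral>z. (f (e * fst z + snd z) - e * post_mean e (e * fst z + snd z))\<^sup>2 \<partial>joint)"
proof -
  let ?Y = "\<lambda>z. e * fst z + snd z :: real"
  let ?b = "\<lambda>y. f y - e * post_mean e y" and ?g = "\<lambda>z. post_mean e (?Y z)"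
  have fb: "integrable joint (\<lambda>z. f (?Y z) * ?b (?Y z))"
    by (rule integrable_mult_of_squares[OF _ _ f b]) measurable
  \<comment> \<open>Square integrability of the posterior mean is recovered from that of
    \<open>f\<close> and of the difference \<open>?b\<close>, since e times the posterior mean is
    their difference.\<close>
  have "integrable joint (\<lambda>z. ((f (?Y z))\<^sup>2 - 2 * (f (?Y z) * ?b (?Y z)) + (?b (?Y z))\<^sup>2) / e\<^sup>2)"
    using f b fb by simp
  also have "(\<lambda>z. ((f (?Y z))\<^sup>2 - 2 * (f (?Y z) * ?b (?Y z)) + (?b (?Y z))\<^sup>2) / e\<^sup>2) = (\<lambda>z. (?g z)\<^sup>2)"
    using \<open>e > 0\<close> by (auto simp: fun_eq_iff power2_eq_square field_simps)
  finally have g2: "integrable joint (\<lambda>z. (?g z)\<^sup>2)" .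
  have g1: "integrable joint ?g"
    using integrable_mult_of_squares[of ?g joint "\<lambda>_. 1"] g2 by simp
  have xb: "integrable joint (\<lambda>z. fst z * ?b (?Y z))"
    by (rule integrable_mult_of_squares[OF _ _ square_integrable_fst(1) b]) measurable
  have gb: "integrable joint (\<lambda>z. ?g z * ?b (?Y z))"
    by (rule integrable_mult_of_squares[OF _ _ g2 b]) measurable
  have xg: "integrable joint (\<lambda>z. fst z * ?g z)"
    by (rule integrable_mult_of_squares[OF _ _ square_integrable_fst(1) g2]) measurable
  have sq: "integrable joint (\<lambda>z. (fst z - ?g z)\<^sup>2)"
    unfolding power2_diff using g2 xg square_integrable_fst(1) by (simp add: mult.assoc)
  have ortho: "(\<integral>z. fst z * ?b (?Y z) \<partial>joint) = (\<integral>z. ?g z * ?b (?Y z) \<partial>joint)"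
    by (rule integral_post_mean_orthogonal[OF mean _ xb gb]) measurable
  have "mmse \<nu> (e\<^sup>2) = (\<integral>z. (fst z - real_cond_exp joint (vimage_algebra (space joint) ?Y borel) fst z)\<^sup>2 \<partial>joint)"
    using \<open>e > 0\<close> by (simp add: mmse_def Let_def del: space_joint)
  also have "\<dots> = (\<integral>z. (fst z - ?g z)\<^sup>2 \<partial>joint)"
  proof (rule integral_cong_AE)
    show "(\<lambda>z. (fst z - real_cond_exp joint (vimage_algebra (space joint) ?Y borel) fst z)\<^sup>2) \<in> borel_measurable joint"
      using borel_measurable_cond_exp2[of joint "vimage_algebra (space joint) ?Y borel" fst] by measurable
    show "AE z in joint. (fst z - real_cond_exp joint (vimage_algebra (space joint) ?Y borel) fst z)\<^sup>2 = (fst z - ?g z)\<^sup>2"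
      using cond_exp_eq_post_mean[OF mean g1] by eventually_elim (simp del: space_joint)
  qed measurable
  finally have mm: "mmse \<nu> (e\<^sup>2) = (\<integral>z. (fst z - ?g z)\<^sup>2 \<partial>joint)" .
  have "(e * fst z - f (?Y z))\<^sup>2
      = e\<^sup>2 * (fst z - ?g z)\<^sup>2 - 2 * e * (fst z * ?b (?Y z) - ?g z * ?b (?Y z)) + (?b (?Y z))\<^sup>2" for z
    by (simp add: power2_eq_square algebra_simps)
  then have "(\<integral>z. (e * fst z - f (?Y z))\<^sup>2 \<partial>joint)
      = e\<^sup>2 * (\<integral>z. (fst z - ?g z)\<^sup>2 \<partial>joint)
        - 2 * e * ((\<integral>z. fst z * ?b (?Y z) \<partial>joint) - (\<integral>z. ?g z * ?b (?Y z) \<partial>joint)) + (\<integral>z. (?b (?Y z))\<^sup>2 \<partial>joint)"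
    using sq xb gb b by simp
  then show ?thesis by (simp add: ortho mm)
qed

end

subsection \<open>Asymptotic expansion at zero signal\<close>

text \<open>A partial sum at the numerical value \<open>e\<close> of the formal variable; no
  convergence is involved.\<close>

definition eval_upto :: "real \<Rightarrow> nat \<Rightarrow> real poly fps \<Rightarrow> real poly" where
  "eval_upto e N A = (\<Sum>n\<le>N. smult (e ^ n) (fps_nth A n))"

lemma smult_conv_const_power: "smult (c ^ n) p = p * [:c:] ^ n"
  by (simp add: poly_const_pow)

text \<open>Multiplicative only for series with finitely many terms, hence the frequent use of
  \<open>fps_cutoff\<close> below.\<close>

lemma eval_upto_mult:
  assumes "\<And>i. i > m \<Longrightarrow> fps_nth A i = 0" "\<And>i. i > n \<Longrightarrow> fps_nth B i = 0"
  shows "eval_upto e m A * eval_upto e n B = eval_upto e (m + n) (A * B)"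
  unfolding eval_upto_def smult_conv_const_power
  using polynomial_product[of m "fps_nth A" n "fps_nth B" "[:e:]"] assms
  by (simp add: fps_mult_nth atLeast0AtMost)

lemma eval_upto_extend:
  assumes "\<And>i. i > m \<Longrightarrow> fps_nth A i = 0" "m \<le> N"
  shows "eval_upto e N A = eval_upto e m A"
  unfolding eval_upto_def by (rule sum.mono_neutral_right) (use assms in auto)

lemma eval_upto_cong:
  assumes "\<And>i. i \<le> N \<Longrightarrow> fps_nth A i = fps_nth B i"
  shows "eval_upto e N A = eval_upto e N B"
  unfolding eval_upto_def using assms by (intro sum.cong) auto

lemma eval_upto_diff: "eval_upto e N (A - B) = eval_upto e N A - eval_upto e N B"
  by (simp add: eval_upto_def smult_diff_right sum_subtractf)

lemma gauss_ex_eval_upto: "gauss_ex (eval_upto e N A) = (\<Sum>n\<le>N. e ^ n * gauss_ex (fps_nth A n))"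
  by (simp add: eval_upto_def gauss_ex_sum gauss_ex_smult)

lemma degree_eval_upto:
  assumes "\<And>n. n \<le> N \<Longrightarrow> degree (fps_nth A n) \<le> D"
  shows "degree (eval_upto e N A) \<le> D"
  unfolding eval_upto_def
  by (rule degree_sum_le) (use assms degree_smult_le in \<open>auto intro: order_trans\<close>)

lemma eval_upto_bound:
  assumes "\<And>n. n < k \<Longrightarrow> fps_nth A n = 0"
  shows "\<exists>C\<ge>0. \<exists>d0. \<forall>d\<ge>d0. \<forall>e y. 0 \<le> e \<and> e \<le> 1 \<longrightarrow> \<bar>poly (eval_upto e N A) y\<bar> \<le> C * e ^ k * (1 + \<bar>y\<bar>) ^ d"
proof -
  have "\<forall>n. \<exists>C\<ge>0. \<forall>d\<ge>degree (fps_nth A n). \<forall>x. \<bar>poly (fps_nth A n) x\<bar> \<le> C * (1 + \<bar>x\<bar>) ^ d"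
    using abs_poly_le_power by blast
  then obtain C where C: "\<And>n. C n \<ge> 0"
      "\<And>n d x. d \<ge> degree (fps_nth A n) \<Longrightarrow> \<bar>poly (fps_nth A n) x\<bar> \<le> C n * (1 + \<bar>x\<bar>) ^ d"
    by metis
  let ?d0 = "\<Sum>n\<le>N. degree (fps_nth A n)"
  have "\<bar>poly (eval_upto e N A) y\<bar> \<le> (\<Sum>n\<le>N. C n) * e ^ k * (1 + \<bar>y\<bar>) ^ d"
    if "d \<ge> ?d0" and e: "0 \<le> e" "e \<le> 1" for d e y
  proof -
    have "\<bar>poly (eval_upto e N A) y\<bar> \<le> (\<Sum>n\<le>N. \<bar>e ^ n * poly (fps_nth A n) y\<bar>)"
      unfolding eval_upto_def by (simp add: poly_sum sum_abs)
    also have "\<dots> \<le> (\<Sum>n\<le>N. C n * e ^ k * (1 + \<bar>y\<bar>) ^ d)"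
    proof (rule sum_mono)
      fix n assume n: "n \<in> {..N}"
      show "\<bar>e ^ n * poly (fps_nth A n) y\<bar> \<le> C n * e ^ k * (1 + \<bar>y\<bar>) ^ d"
      proof (cases "n < k")
        case True
        then show ?thesis using assms C(1) e by simp
      next
        case False
        have "degree (fps_nth A n) \<le> ?d0" using n by (intro member_le_sum) auto
        then have "\<bar>poly (fps_nth A n) y\<bar> \<le> C n * (1 + \<bar>y\<bar>) ^ d" using C(2)[of n d y] that(1) by simp
        moreover have "e ^ n \<le> e ^ k" using False e by (intro power_decreasing) auto
        ultimately have "e ^ n * \<bar>poly (fps_nth A n) y\<bar> \<le> e ^ k * (C n * (1 + \<bar>y\<bar>) ^ d)"
          using e by (intro mult_mono) auto
        then show ?thesis using e by (simp add: abs_mult mult_ac)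
      qed
    qed
    finally show ?thesis by (simp add: sum_distrib_right)
  qed
  moreover have "(\<Sum>n\<le>N. C n) \<ge> 0" using C(1) by (simp add: sum_nonneg)
  ultimately show ?thesis by blast
qed

lemma power_series_tail_bound:
  fixes q :: "nat \<Rightarrow> real"
  assumes "0 \<le> e" "e \<le> 1" and that: "k \<le> Suc N"
  shows "\<bar>(\<Sum>n\<le>N. e ^ n * q n) - (\<Sum>n<k. e ^ n * q n)\<bar> \<le> (\<Sum>n\<le>N + k. \<bar>q n\<bar>) * e ^ k"
proof -
  have "{..N} = {..<k} \<union> {k..N}" using that by auto
  then have "(\<Sum>n\<le>N. e ^ n * q n) = (\<Sum>n\<in>{..<k} \<union> {k..N}. e ^ n * q n)"
    by simp
  also have "\<dots> = (\<Sum>n<k. e ^ n * q n) + (\<Sum>n = k..N. e ^ n * q n)"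
    by (rule sum.union_disjoint) auto
  finally have "(\<Sum>n\<le>N. e ^ n * q n) = (\<Sum>n<k. e ^ n * q n) + (\<Sum>n = k..N. e ^ n * q n)" .
  then have "\<bar>(\<Sum>n\<le>N. e ^ n * q n) - (\<Sum>n<k. e ^ n * q n)\<bar> \<le> (\<Sum>n = k..N. \<bar>e ^ n * q n\<bar>)"
    by (simp add: sum_abs)
  also have "\<dots> \<le> (\<Sum>n = k..N. \<bar>q n\<bar> * e ^ k)"
  proof (rule sum_mono)
    fix n assume "n \<in> {k..N}"
    then have "e ^ n \<le> e ^ k" using assms by (intro power_decreasing) auto
    then have "\<bar>q n\<bar> * e ^ n \<le> \<bar>q n\<bar> * e ^ k" by (intro mult_left_mono) auto
    then show "\<bar>e ^ n * q n\<bar> \<le> \<bar>q n\<bar> * e ^ k"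
      using assms by (simp add: abs_mult mult.commute)
  qed
  also have "\<dots> = (\<Sum>n = k..N. \<bar>q n\<bar>) * e ^ k" by (simp add: sum_distrib_right)
  also have "\<dots> \<le> (\<Sum>n\<le>N + k. \<bar>q n\<bar>) * e ^ k"
    using assms by (intro mult_right_mono sum_mono2) auto
  finally show ?thesis .
qed

lemma fps_mult_nth_cong:
  assumes "\<And>i. i \<le> n \<Longrightarrow> fps_nth A i = fps_nth A' i" "\<And>i. i \<le> n \<Longrightarrow> fps_nth B i = fps_nth B' i"
  shows "fps_nth (A * B) n = fps_nth (A' * B') n"
  unfolding fps_mult_nth using assms by (intro sum.cong) auto

lemma one_plus_abs_shift_le:
  assumes "\<bar>e\<bar> \<le> 1"
  shows "1 + \<bar>e * x + n\<bar> \<le> (1 + \<bar>x\<bar>) * (1 + \<bar>n :: real\<bar>)"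
proof -
  have "\<bar>e * x\<bar> \<le> 1 * \<bar>x\<bar>" unfolding abs_mult using assms by (intro mult_right_mono) auto
  moreover have "0 \<le> \<bar>x\<bar> * \<bar>n\<bar>" by simp
  ultimately show ?thesis using abs_triangle_ineq[of "e * x" n]
    by (simp only: distrib_left distrib_right mult_1_left mult_1_right)
qed

section \<open>Mean square error of the truncated estimator\<close>

context moment_law
begin

lemma integrable_power_poly:
  assumes "\<bar>e\<bar> \<le> 1"
  shows "integrable joint (\<lambda>z. fst z ^ i * poly p (e * fst z + snd z))"
proof -
  obtain C where C: "C \<ge> 0" "\<And>x. \<bar>poly p x\<bar> \<le> C * (1 + \<bar>x\<bar>) ^ degree p"
    using abs_poly_le_power[of p] by blast
  let ?d = "degree p"
  show ?thesis
  proof (rule Bochner_Integration.integrable_bound)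
    show "integrable joint (\<lambda>z. C * ((1 + \<bar>fst z\<bar>) ^ (i + ?d) * (1 + \<bar>snd z\<bar>) ^ ?d))"
      by (intro integrable_mult_right integrable_dominating)
    have [measurable]: "poly p \<in> borel_measurable borel"
      by (intro borel_measurable_continuous_onI continuous_intros)
    show "(\<lambda>z. fst z ^ i * poly p (e * fst z + snd z)) \<in> borel_measurable joint" by measurable
    show "AE z in joint. norm (fst z ^ i * poly p (e * fst z + snd z))
        \<le> norm (C * ((1 + \<bar>fst z\<bar>) ^ (i + ?d) * (1 + \<bar>snd z\<bar>) ^ ?d))"
    proof (rule AE_I2)
      fix z :: "real \<times> real"
      have "(1 + \<bar>e * fst z + snd z\<bar>) ^ ?d \<le> ((1 + \<bar>fst z\<bar>) * (1 + \<bar>snd z\<bar>)) ^ ?d"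
        by (intro power_mono one_plus_abs_shift_le assms) auto
      then have "C * (1 + \<bar>e * fst z + snd z\<bar>) ^ ?d \<le> C * ((1 + \<bar>fst z\<bar>) ^ ?d * (1 + \<bar>snd z\<bar>) ^ ?d)"
        unfolding power_mult_distrib using C(1) by (rule mult_left_mono)
      with C(2) have "\<bar>poly p (e * fst z + snd z)\<bar> \<le> C * ((1 + \<bar>fst z\<bar>) ^ ?d * (1 + \<bar>snd z\<bar>) ^ ?d)"
        by (rule order_trans)
      moreover have "\<bar>fst z\<bar> ^ i \<le> (1 + \<bar>fst z\<bar>) ^ i" by (intro power_mono) auto
      ultimately have "\<bar>fst z\<bar> ^ i * \<bar>poly p (e * fst z + snd z)\<bar>
          \<le> (1 + \<bar>fst z\<bar>) ^ i * (C * ((1 + \<bar>fst z\<bar>) ^ ?d * (1 + \<bar>snd z\<bar>) ^ ?d))"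
        by (intro mult_mono) auto
      then show "norm (fst z ^ i * poly p (e * fst z + snd z))
          \<le> norm (C * ((1 + \<bar>fst z\<bar>) ^ (i + ?d) * (1 + \<bar>snd z\<bar>) ^ ?d))"
        using C(1) by (simp add: abs_mult power_abs power_add mult_ac)
    qed
  qed
qed

lemma integral_power_poly:
  assumes "\<bar>e\<bar> \<le> 1" "degree p \<le> D"
  shows "(\<integral>z. fst z ^ i * poly p (e * fst z + snd z) \<partial>joint)
       = (\<Sum>j\<le>D. e ^ j * moment \<nu> (i + j) * gauss_ex (hermite j * p))"
proof -
  have "(\<integral>z. fst z ^ i * poly p (e * fst z + snd z) \<partial>joint)
      = (\<integral>x. (\<integral>n. x ^ i * poly p (e * x + n) \<partial>gaussian) \<partial>\<nu>)"
    using P.integral_fst'[OF integrable_power_poly[OF assms(1), of i p]] by simp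
  also have "\<dots> = (\<integral>x. (\<Sum>j\<le>D. e ^ j * gauss_ex (hermite j * p) * x ^ (i + j)) \<partial>\<nu>)"
    by (simp add: integral_gaussian_poly_shift[OF assms(2)] sum_distrib_left power_mult_distrib power_add mult_ac)
  also have "\<dots> = (\<Sum>j\<le>D. e ^ j * moment \<nu> (i + j) * gauss_ex (hermite j * p))"
    unfolding moment_def by (subst Bochner_Integration.integral_sum) (simp_all add: mult_ac)
  finally show ?thesis .
qed

abbreviation "dens \<equiv> noisy_density (moment \<nu>)"
abbreviation "cmean \<equiv> cond_mean (moment \<nu>)"

text \<open>An exact identity although the density series is truncated: Hermite terms of index above
  \<open>D\<close> are orthogonal to \<open>p\<close>.\<close>

lemma integral_poly_eq_gauss_ex:
  assumes "\<bar>e\<bar> \<le> 1" "degree p \<le> D"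
  shows "(\<integral>z. poly p (e * fst z + snd z) \<partial>joint) = gauss_ex (eval_upto e D dens * p)"
proof -
  have "gauss_ex (eval_upto e D dens * p) = (\<Sum>j\<le>D. e ^ j * moment \<nu> j * gauss_ex (hermite j * p))"
    by (simp add: eval_upto_def sum_distrib_right gauss_ex_sum gauss_ex_smult noisy_density_nth mult.assoc)
  then show ?thesis using integral_power_poly[OF assms, of 0] by simp
qed

text \<open>The factor \<epsilon> x shifts moments by one and is matched by W'. Its order j + 1
  carries \<open>hermite j\<close>, so one more order is kept.\<close>

lemma integral_fst_poly_eq_gauss_ex:
  assumes "\<bar>e\<bar> \<le> 1" "degree p \<le> D"
  shows "(\<integral>z. e * fst z * poly p (e * fst z + snd z) \<partial>joint) = gauss_ex (eval_upto e (Suc D) (yderiv dens) * p)"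
proof -
  have "gauss_ex (eval_upto e (Suc D) (yderiv dens) * p)
      = (\<Sum>j\<le>D. e ^ Suc j * moment \<nu> (Suc j) * gauss_ex (hermite j * p))"
    unfolding eval_upto_def yderiv_nth noisy_density_nth pderiv_smult
    by (subst sum.atMost_Suc_shift)
      (simp add: pderiv_hermite_Suc sum_distrib_right gauss_ex_sum gauss_ex_smult mult.assoc del: hermite.simps(2))
  also have "\<dots> = e * (\<integral>z. fst z ^ 1 * poly p (e * fst z + snd z) \<partial>joint)"
    unfolding integral_power_poly[OF assms] by (simp add: sum_distrib_left mult_ac)
  also have "\<dots> = (\<integral>z. e * (fst z ^ 1 * poly p (e * fst z + snd z)) \<partial>joint)"
    by (rule integral_mult_right_zero[symmetric])
  finally show ?thesis by (simp add: mult.assoc)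
qed

lemma integral_fst_square: "(\<integral>z. (fst z)\<^sup>2 \<partial>joint) = moment \<nu> 2"
  using integral_power_poly[of 0 1 0 2] gauss_ex_1 by simp

definition estimator :: "nat \<Rightarrow> real \<Rightarrow> real poly" where
  "estimator m e = eval_upto e m cmean"

lemma estimator_eq: "estimator m e = eval_upto e m (fps_cutoff (Suc m) cmean)"
  unfolding estimator_def by (rule eval_upto_cong) simp

text \<open>Completing the square with W V = W': the difference of both sides is W (V - F)^2, and V
  - F starts at order m + 1.\<close>

lemma truncated_energy:
  assumes "n < 2 * m + 2"
  defines "F \<equiv> fps_cutoff (Suc m) cmean"
  shows "fps_nth (dens * (F * F)) n - fps_nth (yderiv dens * F) n - fps_nth (yderiv dens * F) n
       = - fps_nth (cmean * cmean * dens) n"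
proof -
  define R where "R = cmean - F"
  have R: "fps_nth R i = 0" if "i \<le> m" for i using that by (simp add: R_def F_def)
  have RR: "fps_nth (R * R) i = 0" if "i < 2 * m + 2" for i
    unfolding fps_mult_nth
  proof (rule sum.neutral, rule ballI)
    fix j assume "j \<in> {0..i}"
    then have "j \<le> m \<or> i - j \<le> m" using that by auto
    then show "fps_nth R j * fps_nth R (i - j) = 0" using R by auto
  qed
  have F: "F = cmean - R" by (simp add: R_def)
  have "dens * (F * F) - yderiv dens * F - yderiv dens * F = dens * (R * R) - cmean * cmean * dens"
    unfolding noisy_density_cond_mean[of "moment \<nu>", OF moment_0, symmetric] F by (simp add: algebra_simps)
  then have "fps_nth (dens * (F * F) - yderiv dens * F - yderiv dens * F) n
      = fps_nth (dens * (R * R)) n - fps_nth (cmean * cmean * dens) n"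
    by simp
  also have "fps_nth (dens * (R * R)) n = 0"
    unfolding fps_mult_nth[of dens] using RR assms(1) by (intro sum.neutral) auto
  finally show ?thesis by (simp only: fps_sub_nth diff_0)
qed

lemma estimator_error:
  "\<exists>C. \<forall>e. 0 \<le> e \<and> e \<le> 1 \<longrightarrow>
     \<bar>(\<integral>z. (e * fst z - poly (estimator m e) (e * fst z + snd z))\<^sup>2 \<partial>joint)
       - (e\<^sup>2 * moment \<nu> 2 - (\<Sum>n<2 * m + 2. e ^ n * cond_energy (moment \<nu>) n))\<bar> \<le> C * e ^ (2 * m + 2)"
proof -
  define F where "F = fps_cutoff (Suc m) cmean"
  define D0 where "D0 = (\<Sum>n\<le>m. degree (fps_nth F n))"
  \<comment> \<open>Large enough for two purposes: it bounds the degree of the squared estimator, so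
    the integrals are exact, and it exceeds 2m + 1, so the cutoffs leave all relevant orders
    unchanged.\<close>
  define D where "D = 2 * D0 + 2 * m + 2"
  define Wc where "Wc = fps_cutoff (Suc (Suc D)) dens"
  define Dc where "Dc = fps_cutoff (Suc (Suc D)) (yderiv dens)"
  define N where "N = Suc D + (m + m)"
  define q where "q = (\<lambda>n. gauss_ex (fps_nth (Wc * (F * F)) n - fps_nth (Dc * F) n - fps_nth (Dc * F) n))"
  have F0: "fps_nth F i = 0" if "i > m" for i using that by (simp add: F_def)
  have FF0: "fps_nth (F * F) i = 0" if "i > m + m" for i
    unfolding fps_mult_nth
  proof (rule sum.neutral, rule ballI)
    fix j assume "j \<in> {0..i}"
    then have "j > m \<or> i - j > m" using that by auto
    then show "fps_nth F j * fps_nth F (i - j) = 0" using F0 by auto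
  qed
  have Wc0: "fps_nth Wc i = 0" "fps_nth Dc i = 0" if "i > Suc D" for i
    using that by (simp_all add: Wc_def Dc_def)
  have est: "estimator m e = eval_upto e m F" for e
    by (simp add: estimator_eq F_def)
  have deg: "degree (estimator m e) \<le> D0" for e
    unfolding est
  proof (rule degree_eval_upto)
    fix n assume "n \<le> m"
    then show "degree (fps_nth F n) \<le> D0"
      unfolding D0_def by (intro member_le_sum) auto
  qed
  have eq: "(\<integral>z. (e * fst z - poly (estimator m e) (e * fst z + snd z))\<^sup>2 \<partial>joint)
      = e\<^sup>2 * moment \<nu> 2 + (\<Sum>n\<le>N. e ^ n * q n)" if e: "0 \<le> e" "e \<le> 1" for e
  proof -
    let ?f = "estimator m e" and ?Y = "\<lambda>z. e * fst z + snd z :: real"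
    have e1: "\<bar>e\<bar> \<le> 1" using e by simp
    have int: "integrable joint (\<lambda>z. e * fst z * poly ?f (?Y z))" "integrable joint (\<lambda>z. poly (?f * ?f) (?Y z))"
      "integrable joint (\<lambda>z. e\<^sup>2 * (fst z)\<^sup>2)"
      using integrable_mult_right[OF integrable_power_poly[OF e1, of 1 ?f], of e]
        integrable_power_poly[OF e1, of 0 "?f * ?f"] integrable_mult_right[OF square_integrable_fst(1), of "e\<^sup>2"]
      by (simp_all add: mult.assoc)
    have "(e * fst z - poly ?f (?Y z))\<^sup>2 = e\<^sup>2 * (fst z)\<^sup>2 - 2 * (e * fst z * poly ?f (?Y z)) + poly (?f * ?f) (?Y z)" for z
      by (simp add: power2_eq_square algebra_simps)
    then have 1: "(\<integral>z. (e * fst z - poly ?f (?Y z))\<^sup>2 \<partial>joint)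
        = e\<^sup>2 * (\<integral>z. (fst z)\<^sup>2 \<partial>joint) - 2 * (\<integral>z. e * fst z * poly ?f (?Y z) \<partial>joint) + (\<integral>z. poly (?f * ?f) (?Y z) \<partial>joint)"
      using int by (simp del: poly_mult)
    have "?f = eval_upto e (m + m) F"
      unfolding est by (rule eval_upto_extend[symmetric]) (use F0 in auto)
    moreover have "eval_upto e (Suc D) (yderiv dens) = eval_upto e (Suc D) Dc"
      by (rule eval_upto_cong) (simp add: Dc_def)
    moreover have "eval_upto e (Suc D) Dc * eval_upto e (m + m) F = eval_upto e N (Dc * F)"
      unfolding N_def by (rule eval_upto_mult) (use F0 Wc0 in auto)
    ultimately have "eval_upto e (Suc D) (yderiv dens) * ?f = eval_upto e N (Dc * F)"
      by simp
    moreover have "(\<integral>z. e * fst z * poly ?f (?Y z) \<partial>joint) = gauss_ex (eval_upto e (Suc D) (yderiv dens) * ?f)"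
      using deg[of e] by (intro integral_fst_poly_eq_gauss_ex e1) (simp add: D_def)
    ultimately have 2: "(\<integral>z. e * fst z * poly ?f (?Y z) \<partial>joint) = gauss_ex (eval_upto e N (Dc * F))"
      by simp
    have "eval_upto e (Suc D) dens = eval_upto e (Suc D) Wc"
      by (rule eval_upto_cong) (simp add: Wc_def)
    moreover have "?f * ?f = eval_upto e (m + m) (F * F)"
      unfolding est by (rule eval_upto_mult) (use F0 in auto)
    moreover have "eval_upto e (Suc D) Wc * eval_upto e (m + m) (F * F) = eval_upto e N (Wc * (F * F))"
      unfolding N_def by (rule eval_upto_mult) (use FF0 Wc0 in auto)
    ultimately have "eval_upto e (Suc D) dens * (?f * ?f) = eval_upto e N (Wc * (F * F))"
      by simp
    moreover have "(\<integral>z. poly (?f * ?f) (?Y z) \<partial>joint) = gauss_ex (eval_upto e (Suc D) dens * (?f * ?f))"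
      using deg[of e] degree_mult_le[of ?f ?f] by (intro integral_poly_eq_gauss_ex e1) (simp add: D_def)
    ultimately have 3: "(\<integral>z. poly (?f * ?f) (?Y z) \<partial>joint) = gauss_ex (eval_upto e N (Wc * (F * F)))"
      by (simp only:)
    show ?thesis
      unfolding 1 2 3 integral_fst_square gauss_ex_eval_upto q_def gauss_ex_diff
      by (simp add: sum_distrib_left sum_subtractf algebra_simps flip: sum.distrib)
  qed
  have q: "q n = - cond_energy (moment \<nu>) n" if "n < 2 * m + 2" for n
  proof -
    have "fps_nth (Wc * (F * F)) n = fps_nth (dens * (F * F)) n" "fps_nth (Dc * F) n = fps_nth (yderiv dens * F) n"
      using that by (auto intro!: fps_mult_nth_cong simp: Wc_def Dc_def D_def)
    then have "q n = gauss_ex (- fps_nth (cmean * cmean * dens) n)"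
      unfolding q_def using truncated_energy[OF that] by (simp add: F_def)
    also have "\<dots> = - cond_energy (moment \<nu>) n"
      unfolding cond_energy_def using gauss_ex_smult[of "-1"] by simp
    finally show ?thesis .
  qed
  have "\<bar>(\<integral>z. (e * fst z - poly (estimator m e) (e * fst z + snd z))\<^sup>2 \<partial>joint)
       - (e\<^sup>2 * moment \<nu> 2 - (\<Sum>n<2 * m + 2. e ^ n * cond_energy (moment \<nu>) n))\<bar>
     \<le> (\<Sum>n\<le>N + (2 * m + 2). \<bar>q n\<bar>) * e ^ (2 * m + 2)" if e: "0 \<le> e" "e \<le> 1" for e
  proof -
    have "(\<Sum>n<2 * m + 2. e ^ n * q n) = - (\<Sum>n<2 * m + 2. e ^ n * cond_energy (moment \<nu>) n)"
      unfolding sum_negf[symmetric] by (rule sum.cong) (auto simp: q)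
    moreover have "2 * m + 2 \<le> Suc N" by (simp add: N_def D_def)
    ultimately show ?thesis
      using power_series_tail_bound[OF e, of "2 * m + 2" N q] unfolding eq[OF e] by simp
  qed
  then show ?thesis by blast
qed

end

section \<open>Near-optimality of the truncated estimator\<close>

lemma integral_le_of_nn_integral:
  fixes f :: "'c \<Rightarrow> real"
  assumes [measurable]: "f \<in> borel_measurable M" and "\<And>x. f x \<ge> 0" "r \<ge> 0"
    and le: "(\<integral>\<^sup>+x. ennreal (f x) \<partial>M) \<le> ennreal r"
  shows "integrable M f" "(\<integral>x. f x \<partial>M) \<le> r"
proof -
  show int: "integrable M f"
    by (rule integrableI_nonneg) (use assms le_less_trans[OF le] in auto)
  have "ennreal (\<integral>x. f x \<partial>M) \<le> ennreal r"
    using nn_integral_eq_integral[OF int] assms by simp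
  then show "(\<integral>x. f x \<partial>M) \<le> r" using assms(3) by simp
qed

lemma mult_le_quarter_square_add:
  fixes u v :: real
  shows "u * v \<le> u\<^sup>2 / 4 + v\<^sup>2"
proof -
  have "0 \<le> (u / 2 - v)\<^sup>2" by simp
  then show ?thesis by (simp add: power2_eq_square algebra_simps)
qed

context moment_law
begin

lemma moment_2_nonneg: "moment \<nu> 2 \<ge> 0"
  by (simp add: moment_def)

text \<open>The sum is the mean of (f - e x) against the Taylor polynomial of the tilt, where f is
  the estimator. As a series in \<open>e\<close> it is F W - W' up to order m, which vanishes
  because F agrees with V there.\<close>

lemma estimator_equation_bound:
  "\<exists>C\<ge>0. \<exists>d0. \<forall>d\<ge>d0. \<forall>e y. 0 \<le> e \<and> e \<le> 1 \<longrightarrow>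
     \<bar>\<Sum>j<Suc m. (poly (estimator m e) y * moment \<nu> j - e * moment \<nu> (Suc j)) * e ^ j * poly (hermite j) y\<bar>
       \<le> C * e ^ Suc m * (1 + \<bar>y\<bar>) ^ d"
proof -
  define F where "F = fps_cutoff (Suc m) cmean"
  define Wc where "Wc = fps_cutoff (Suc m) dens"
  define Dc where "Dc = fps_cutoff (Suc (Suc m)) (yderiv dens)"
  have low: "fps_nth (F * Wc - Dc) n = 0" if "n < Suc m" for n
  proof -
    have "fps_nth (F * Wc) n = fps_nth (cmean * dens) n"
      using that by (intro fps_mult_nth_cong) (auto simp: F_def Wc_def)
    also have "\<dots> = fps_nth (yderiv dens) n"
      using noisy_density_cond_mean[of "moment \<nu>", OF moment_0] by (simp add: mult.commute)
    finally show ?thesis using that by (simp add: Dc_def)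
  qed
  have eq: "poly (eval_upto e (m + Suc m) (F * Wc - Dc)) y
      = (\<Sum>j<Suc m. (poly (estimator m e) y * moment \<nu> j - e * moment \<nu> (Suc j)) * e ^ j * poly (hermite j) y)" for e y
  proof -
    have "eval_upto e (m + Suc m) (F * Wc) = eval_upto e m F * eval_upto e (Suc m) Wc"
      by (rule eval_upto_mult[symmetric]) (auto simp: F_def Wc_def)
    also have "eval_upto e m F = estimator m e" by (simp add: estimator_eq F_def)
    also have "eval_upto e (Suc m) Wc = (\<Sum>j\<le>m. smult (e ^ j * moment \<nu> j) (hermite j))"
      by (simp add: eval_upto_def Wc_def noisy_density_nth)
    finally have 1: "eval_upto e (m + Suc m) (F * Wc)
        = estimator m e * (\<Sum>j\<le>m. smult (e ^ j * moment \<nu> j) (hermite j))" .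
    have "eval_upto e (m + Suc m) Dc = eval_upto e (Suc m) Dc"
      by (rule eval_upto_extend) (auto simp: Dc_def)
    also have "\<dots> = eval_upto e (Suc m) (yderiv dens)"
      by (rule eval_upto_cong) (simp add: Dc_def)
    also have "\<dots> = (\<Sum>j\<le>m. smult (e ^ Suc j * moment \<nu> (Suc j)) (hermite j))"
      unfolding eval_upto_def yderiv_nth noisy_density_nth pderiv_smult
      by (subst sum.atMost_Suc_shift) (simp add: pderiv_hermite_Suc del: hermite.simps(2))
    finally have 2: "eval_upto e (m + Suc m) Dc = (\<Sum>j\<le>m. smult (e ^ Suc j * moment \<nu> (Suc j)) (hermite j))" .
    show ?thesis
      unfolding eval_upto_diff 1 2 poly_diff poly_mult poly_sum poly_smult lessThan_Suc_atMost
        sum_distrib_left sum_subtractf[symmetric]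
      by (rule sum.cong) (simp_all add: algebra_simps)
  qed
  show ?thesis
    using eval_upto_bound[of "Suc m" "F * Wc - Dc" "m + Suc m", OF low] unfolding eq .
qed

lemma estimator_bound:
  "\<exists>C\<ge>0. \<exists>d0. \<forall>d\<ge>d0. \<forall>e y. 0 \<le> e \<and> e \<le> 1 \<longrightarrow> \<bar>poly (estimator m e) y\<bar> \<le> C * (1 + \<bar>y\<bar>) ^ d"
  unfolding estimator_def using eval_upto_bound[of 0 cmean m] by simp

context
  assumes mean: "moment \<nu> 1 = 0"
begin

text \<open>With Z the marginal and b the error, Z b is the tilted mean of f - e x. Replacing the
  tilt by its Taylor polynomial leaves O(e^M), M = m + 1, but the remainder contains the tilt
  itself. That part stays as an integral over x: integrating over y undoes the tilt and produces
  only polynomial moments.\<close>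

lemma post_mean_residual_bound:
  "\<exists>C d L. C \<ge> 0 \<and> L \<ge> 0 \<and> (\<forall>e y. 0 \<le> e \<and> e \<le> 1 \<longrightarrow>
     marginal e y * (poly (estimator m e) y - e * post_mean e y)\<^sup>2
       \<le> 2 * e ^ (2 * Suc m) * ((\<integral>x. (\<bar>x\<bar> ^ Suc m * (C * (1 + \<bar>y\<bar>) ^ d + \<bar>x\<bar>))\<^sup>2 * tilt (e * x) y \<partial>\<nu>)
            + L * exp (6 * \<bar>y\<bar>)))"
proof -
  let ?M = "Suc m"
  obtain C1 d1 where C1: "C1 \<ge> 0" "\<And>d e y. d \<ge> d1 \<Longrightarrow> 0 \<le> e \<Longrightarrow> e \<le> 1 \<Longrightarrow>
      \<bar>\<Sum>j<?M. (poly (estimator m e) y * moment \<nu> j - e * moment \<nu> (Suc j)) * e ^ j * poly (hermite j) y\<bar>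
       \<le> C1 * e ^ ?M * (1 + \<bar>y\<bar>) ^ d"
    using estimator_equation_bound[of m] by blast
  obtain C2 d2 where C2: "C2 \<ge> 0" "\<And>d e y. d \<ge> d2 \<Longrightarrow> 0 \<le> e \<Longrightarrow> e \<le> 1 \<Longrightarrow>
      \<bar>poly (estimator m e) y\<bar> \<le> C2 * (1 + \<bar>y\<bar>) ^ d"
    using estimator_bound[of m] by blast
  obtain K where K: "K \<ge> 0" "\<And>t y. \<bar>tilt t y - (\<Sum>j<?M. t ^ j * poly (hermite j) y)\<bar> \<le> \<bar>t\<bar> ^ ?M * (K * exp (2 * \<bar>y\<bar>) + tilt t y)"
    using tilt_Taylor[of ?M] by blast
  define C where "C = C1 + C2"
  define d where "d = d1 + d2"
  define g where "g = (\<lambda>y::real. C * (1 + \<bar>y\<bar>) ^ d)"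
  define c where "c = (\<lambda>x y::real. \<bar>x\<bar> ^ ?M * (g y + \<bar>x\<bar>))"
  define \<mu> where "\<mu> = (\<lambda>n::nat. \<integral>x. \<bar>x\<bar> ^ n \<partial>\<nu>)"
  define G where "G = C * real d ^ d"
  define C3 where "C3 = G + K * (G * \<mu> ?M + \<mu> (Suc ?M))"
  \<comment> \<open>The lower bound of the marginal at \<open>e = 1\<close>, which is the smallest
    one for 0 \<le> e \<le> 1.\<close>
  define l where "l = exp (- (moment \<nu> 2 / 2))"
  have C: "C \<ge> 0" "G \<ge> 0" using C1(1) C2(1) by (simp_all add: C_def G_def)
  have \<mu>: "\<mu> n \<ge> 0" for n by (simp add: \<mu>_def)
  have C3: "C3 \<ge> 0" using C K(1) \<mu> by (simp add: C3_def)
  have l: "l > 0" by (simp add: l_def)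
  have g: "0 \<le> g y" "g y \<le> G * exp \<bar>y\<bar>" for y
    using C(1) mult_left_mono[OF one_plus_power_le_exp[of "\<bar>y\<bar>" d] C(1)] by (simp_all add: g_def G_def mult.assoc)
  have f_le: "\<bar>poly (estimator m e) y\<bar> \<le> g y" if "0 \<le> e" "e \<le> 1" for e y
  proof -
    have "C2 * (1 + \<bar>y\<bar>) ^ d \<le> g y"
      unfolding g_def using C1(1) by (intro mult_right_mono) (auto simp: C_def)
    moreover have "\<bar>poly (estimator m e) y\<bar> \<le> C2 * (1 + \<bar>y\<bar>) ^ d"
      using that by (intro C2(2)) (simp_all add: d_def)
    ultimately show ?thesis by linarith
  qed
  have p_le: "\<bar>\<Sum>j<?M. (poly (estimator m e) y * moment \<nu> j - e * moment \<nu> (Suc j)) * e ^ j * poly (hermite j) y\<bar>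
       \<le> e ^ ?M * g y" if "0 \<le> e" "e \<le> 1" for e y
  proof -
    have "C1 * e ^ ?M * (1 + \<bar>y\<bar>) ^ d \<le> C * e ^ ?M * (1 + \<bar>y\<bar>) ^ d"
      using C2(1) that by (intro mult_right_mono) (auto simp: C_def)
    then show ?thesis using C1(2)[of d e y] that by (simp add: g_def d_def mult_ac)
  qed
  have c_meas [measurable]: "(\<lambda>x. c x y) \<in> borel_measurable borel" for y
    unfolding c_def by measurable
  have c_eq: "c x y = g y * \<bar>x\<bar> ^ ?M + \<bar>x\<bar> ^ Suc ?M" for x y
    by (simp add: c_def algebra_simps)
  have c_int: "integrable \<nu> (\<lambda>x. c x y)" for y
    unfolding c_eq by (intro Bochner_Integration.integrable_add integrable_mult_right integrable_abs_power)
  have c_val: "(\<integral>x. c x y \<partial>\<nu>) = g y * \<mu> ?M + \<mu> (Suc ?M)" for y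
    unfolding c_eq \<mu>_def
    by (subst Bochner_Integration.integral_add)
       (simp_all del: power_Suc add: integrable_mult_right)
  have c2_int: "integrable \<nu> (\<lambda>x. (c x y)\<^sup>2)" for y
  proof -
    have "(c x y)\<^sup>2 = (g y)\<^sup>2 * \<bar>x\<bar> ^ (?M + ?M) + 2 * g y * \<bar>x\<bar> ^ (?M + Suc ?M) + \<bar>x\<bar> ^ (Suc ?M + Suc ?M)" for x
      unfolding c_eq power_add by (simp add: power2_eq_square algebra_simps)
    then show ?thesis by (simp del: power_Suc add: Bochner_Integration.integrable_add)
  qed
  have main: "marginal e y * (poly (estimator m e) y - e * post_mean e y)\<^sup>2
       \<le> 2 * e ^ (2 * ?M) * ((\<integral>x. (c x y)\<^sup>2 * tilt (e * x) y \<partial>\<nu>) + C3\<^sup>2 / l * exp (6 * \<bar>y\<bar>))"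
    if e: "0 \<le> e" "e \<le> 1" for e y
  proof -
    let ?f = "poly (estimator m e) y"
    define Z where "Z = marginal e y"
    define b where "b = ?f - e * post_mean e y"
    define T where "T = (\<integral>x. (c x y)\<^sup>2 * tilt (e * x) y \<partial>\<nu>)"
    define S where "S = (\<integral>x. c x y * tilt (e * x) y \<partial>\<nu>)"
    define p where "p = (\<lambda>x. \<Sum>j<?M. (e * x) ^ j * poly (hermite j) y)"
    \<comment> \<open>Collects all contributions free of the tilt: exp (2 |y|) stems from the Taylor
      remainder, one further exp |y| from polynomial growth. Squaring yields the exponent 6.\<close>
    define v where "v = e ^ ?M * C3 * exp (3 * \<bar>y\<bar>)"
    have Z: "Z > 0" using marginal_pos[OF mean] by (simp add: Z_def)
    have lZ: "l \<le> Z"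
    proof -
      have "e\<^sup>2 \<le> 1" using e by (simp add: power_le_one)
      then have "e\<^sup>2 * moment \<nu> 2 \<le> moment \<nu> 2" using moment_2_nonneg mult_right_mono[of "e\<^sup>2" 1 "moment \<nu> 2"] by simp
      then have "l \<le> exp (- (e\<^sup>2 * moment \<nu> 2 / 2))" by (simp add: l_def)
      also have "\<dots> \<le> Z" unfolding Z_def by (rule marginal_lower[OF mean])
      finally show ?thesis .
    qed
    have v: "v \<ge> 0" using e C3 by (simp add: v_def)
    have int_x: "integrable \<nu> (\<lambda>x. (?f - e * x) * tilt (e * x) y)"
      using integrable_power[of 1] by (intro integrable_tilt) simp
    have xj: "(?f - e * x) * p x = (\<Sum>j<?M. ?f * (e ^ j * poly (hermite j) y) * x ^ j - e * (e ^ j * poly (hermite j) y) * x ^ Suc j)" for x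
      unfolding p_def sum_distrib_left by (rule sum.cong) (simp_all add: power_mult_distrib algebra_simps)
    have int_p: "integrable \<nu> (\<lambda>x. (?f - e * x) * p x)"
      unfolding xj by (intro Bochner_Integration.integrable_sum Bochner_Integration.integrable_diff
          integrable_mult_right integrable_power)
    have val_p: "(\<integral>x. (?f - e * x) * p x \<partial>\<nu>)
        = (\<Sum>j<?M. (?f * moment \<nu> j - e * moment \<nu> (Suc j)) * e ^ j * poly (hermite j) y)"
    proof -
      have "(\<integral>x. (?f - e * x) * p x \<partial>\<nu>) = (\<Sum>j<?M. (\<integral>x. ?f * (e ^ j * poly (hermite j) y) * x ^ j
          - e * (e ^ j * poly (hermite j) y) * x ^ Suc j \<partial>\<nu>))"
        unfolding xj by (rule Bochner_Integration.integral_sum)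
          (intro Bochner_Integration.integrable_diff integrable_mult_right integrable_power)
      also have "\<dots> = (\<Sum>j<?M. (?f * moment \<nu> j - e * moment \<nu> (Suc j)) * e ^ j * poly (hermite j) y)"
      proof (rule sum.cong[OF refl])
        fix j
        have "(\<integral>x. ?f * (e ^ j * poly (hermite j) y) * x ^ j - e * (e ^ j * poly (hermite j) y) * x ^ Suc j \<partial>\<nu>)
            = ?f * (e ^ j * poly (hermite j) y) * moment \<nu> j - e * (e ^ j * poly (hermite j) y) * moment \<nu> (Suc j)"
          unfolding moment_def
          by (subst Bochner_Integration.integral_diff)
            (intro integrable_mult_right integrable_power | simp only: integral_mult_right_zero)+
        then show "(\<integral>x. ?f * (e ^ j * poly (hermite j) y) * x ^ j - e * (e ^ j * poly (hermite j) y) * x ^ Suc j \<partial>\<nu>)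
            = (?f * moment \<nu> j - e * moment \<nu> (Suc j)) * e ^ j * poly (hermite j) y"
          by (simp add: algebra_simps)
      qed
      finally show ?thesis .
    qed
    have "Z * b = (\<integral>x. (?f - e * x) * tilt (e * x) y \<partial>\<nu>)"
    proof -
      have "(\<integral>x. (?f - e * x) * tilt (e * x) y \<partial>\<nu>) = (\<integral>x. ?f * tilt (e * x) y - e * (x * tilt (e * x) y) \<partial>\<nu>)"
        by (simp add: algebra_simps)
      also have "\<dots> = ?f * Z - e * (\<integral>x. x * tilt (e * x) y \<partial>\<nu>)"
        using integrable_tilt_1 integrable_tilt[OF integrable_power[of 1]]
        by (subst Bochner_Integration.integral_diff) (simp_all add: Z_def marginal_def)
      also have "\<dots> = Z * b"
        using Z by (simp add: b_def post_mean_def Z_def[symmetric] algebra_simps)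
      finally show ?thesis ..
    qed
    \<comment> \<open>The first integral is small by the choice of the estimator, the second by the
      Taylor remainder of the tilt.\<close>
    also have "\<dots> = (\<integral>x. (?f - e * x) * p x \<partial>\<nu>) + (\<integral>x. (?f - e * x) * tilt (e * x) y - (?f - e * x) * p x \<partial>\<nu>)"
      using int_x int_p by simp
    finally have "\<bar>Z * b\<bar> \<le> \<bar>\<integral>x. (?f - e * x) * p x \<partial>\<nu>\<bar>
        + \<bar>\<integral>x. (?f - e * x) * tilt (e * x) y - (?f - e * x) * p x \<partial>\<nu>\<bar>"
      by simp
    also have "\<dots> \<le> e ^ ?M * g y + (\<integral>x. e ^ ?M * (K * exp (2 * \<bar>y\<bar>) * c x y + c x y * tilt (e * x) y) \<partial>\<nu>)"
    proof (intro add_mono)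
      show "\<bar>\<integral>x. (?f - e * x) * p x \<partial>\<nu>\<bar> \<le> e ^ ?M * g y"
        unfolding val_p by (rule p_le[OF e])
      have "norm (\<integral>x. (?f - e * x) * tilt (e * x) y - (?f - e * x) * p x \<partial>\<nu>)
          \<le> (\<integral>x. e ^ ?M * (K * exp (2 * \<bar>y\<bar>) * c x y + c x y * tilt (e * x) y) \<partial>\<nu>)"
      proof (rule Bochner_Integration.integral_norm_bound_integral)
        show "integrable \<nu> (\<lambda>x. e ^ ?M * (K * exp (2 * \<bar>y\<bar>) * c x y + c x y * tilt (e * x) y))"
          by (intro integrable_mult_right Bochner_Integration.integrable_add c_int integrable_tilt)
        fix x
        have "\<bar>?f - e * x\<bar> \<le> g y + \<bar>x\<bar>"
          using f_le[OF e, of y] mult_right_mono[OF e(2), of "\<bar>x\<bar>"] abs_triangle_ineq4[of ?f "e * x"] e(1)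
          by (simp add: abs_mult)
        moreover have "\<bar>tilt (e * x) y - p x\<bar> \<le> (e ^ ?M * \<bar>x\<bar> ^ ?M) * (K * exp (2 * \<bar>y\<bar>) + tilt (e * x) y)"
          using K(2)[of "e * x" y] e(1) by (simp add: p_def abs_mult power_mult_distrib del: power_Suc)
        ultimately have "\<bar>?f - e * x\<bar> * \<bar>tilt (e * x) y - p x\<bar>
            \<le> (g y + \<bar>x\<bar>) * ((e ^ ?M * \<bar>x\<bar> ^ ?M) * (K * exp (2 * \<bar>y\<bar>) + tilt (e * x) y))"
          using g(1)[of y] by (intro mult_mono) auto
        also have "\<dots> = e ^ ?M * (K * exp (2 * \<bar>y\<bar>) * c x y + c x y * tilt (e * x) y)"
          by (simp add: c_def algebra_simps)
        finally show "norm ((?f - e * x) * tilt (e * x) y - (?f - e * x) * p x)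
            \<le> e ^ ?M * (K * exp (2 * \<bar>y\<bar>) * c x y + c x y * tilt (e * x) y)"
          by (simp add: abs_mult flip: right_diff_distrib)
      qed (use int_x int_p in simp)
      then show "\<bar>\<integral>x. (?f - e * x) * tilt (e * x) y - (?f - e * x) * p x \<partial>\<nu>\<bar>
          \<le> (\<integral>x. e ^ ?M * (K * exp (2 * \<bar>y\<bar>) * c x y + c x y * tilt (e * x) y) \<partial>\<nu>)"
        by simp
    qed
    also have "(\<integral>x. e ^ ?M * (K * exp (2 * \<bar>y\<bar>) * c x y + c x y * tilt (e * x) y) \<partial>\<nu>)
        = e ^ ?M * (K * exp (2 * \<bar>y\<bar>) * (g y * \<mu> ?M + \<mu> (Suc ?M)) + S)"
      unfolding S_def c_val[symmetric] using c_int integrable_tilt[OF c_int]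
      by (simp del: power_Suc add: integrable_mult_right)
    finally have Zb: "\<bar>Z * b\<bar> \<le> e ^ ?M * (g y + K * exp (2 * \<bar>y\<bar>) * (g y * \<mu> ?M + \<mu> (Suc ?M))) + e ^ ?M * S"
      by (simp add: algebra_simps)
    have "g y + K * exp (2 * \<bar>y\<bar>) * (g y * \<mu> ?M + \<mu> (Suc ?M)) \<le> C3 * exp (3 * \<bar>y\<bar>)"
    proof -
      have ex: "exp \<bar>y\<bar> \<le> exp (3 * \<bar>y\<bar>)" "exp (2 * \<bar>y\<bar>) \<le> exp (3 * \<bar>y\<bar>)" "exp (2 * \<bar>y\<bar>) * exp \<bar>y\<bar> = exp (3 * \<bar>y\<bar>)"
        by (simp_all flip: exp_add)
      have "g y \<le> G * exp (3 * \<bar>y\<bar>)"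
        using g(2)[of y] mult_left_mono[OF ex(1) C(2)] by linarith
      moreover have "exp (2 * \<bar>y\<bar>) * (g y * \<mu> ?M + \<mu> (Suc ?M)) \<le> exp (3 * \<bar>y\<bar>) * (G * \<mu> ?M + \<mu> (Suc ?M))"
      proof -
        have "exp (2 * \<bar>y\<bar>) * g y \<le> exp (2 * \<bar>y\<bar>) * (G * exp \<bar>y\<bar>)"
          using g(2)[of y] by (intro mult_left_mono) auto
        also have "\<dots> = G * exp (3 * \<bar>y\<bar>)" using ex(3) by (simp only: mult_ac)
        finally have "exp (2 * \<bar>y\<bar>) * g y * \<mu> ?M \<le> G * exp (3 * \<bar>y\<bar>) * \<mu> ?M"
          using \<mu> by (intro mult_right_mono) auto
        moreover have "exp (2 * \<bar>y\<bar>) * \<mu> (Suc ?M) \<le> exp (3 * \<bar>y\<bar>) * \<mu> (Suc ?M)"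
          using \<mu> ex(2) by (intro mult_right_mono) auto
        ultimately show ?thesis by (simp add: algebra_simps)
      qed
      then have "K * (exp (2 * \<bar>y\<bar>) * (g y * \<mu> ?M + \<mu> (Suc ?M))) \<le> K * (exp (3 * \<bar>y\<bar>) * (G * \<mu> ?M + \<mu> (Suc ?M)))"
        using K(1) by (rule mult_left_mono)
      ultimately show ?thesis unfolding C3_def by (simp add: algebra_simps)
    qed
    then have "e ^ ?M * (g y + K * exp (2 * \<bar>y\<bar>) * (g y * \<mu> ?M + \<mu> (Suc ?M))) \<le> v"
      unfolding v_def mult.assoc using e by (intro mult_left_mono) auto
    with Zb have "\<bar>Z * b\<bar> \<le> v + e ^ ?M * S" by linarith
    then have "\<bar>b\<bar> * \<bar>Z * b\<bar> \<le> \<bar>b\<bar> * (v + e ^ ?M * S)" by (rule mult_left_mono) simp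
    then have "Z * b\<^sup>2 \<le> \<bar>b\<bar> * v + \<bar>b\<bar> * (e ^ ?M * S)"
      using Z by (simp add: abs_mult power2_eq_square distrib_left mult_ac)
    \<comment> \<open>Young's inequality weighted by \<open>sqrt l\<close>. This and the next
      estimate each cost a quarter of Z b^2, so half of it can be absorbed on the left.\<close>
    moreover have "\<bar>b\<bar> * v \<le> Z * b\<^sup>2 / 4 + v\<^sup>2 / l"
    proof -
      have "\<bar>b\<bar> * v = (sqrt l * \<bar>b\<bar>) * (v / sqrt l)" using l by simp
      also have "\<dots> \<le> (sqrt l * \<bar>b\<bar>)\<^sup>2 / 4 + (v / sqrt l)\<^sup>2" by (rule mult_le_quarter_square_add)
      also have "\<dots> = l * b\<^sup>2 / 4 + v\<^sup>2 / l" using l by (simp add: power_mult_distrib power_divide)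
      also have "\<dots> \<le> Z * b\<^sup>2 / 4 + v\<^sup>2 / l" using lZ by (simp add: mult_right_mono)
      finally show ?thesis .
    qed
    \<comment> \<open>Young's inequality is applied pointwise in x before integrating against the
      tilt, whose total mass is Z.\<close>
    moreover have "\<bar>b\<bar> * (e ^ ?M * S) \<le> Z * b\<^sup>2 / 4 + e ^ (2 * ?M) * T"
    proof -
      have "\<bar>b\<bar> * (e ^ ?M * S) = (\<integral>x. \<bar>b\<bar> * e ^ ?M * (c x y * tilt (e * x) y) \<partial>\<nu>)"
        unfolding S_def by (simp del: power_Suc)
      also have "\<dots> \<le> (\<integral>x. b\<^sup>2 / 4 * tilt (e * x) y + e ^ (2 * ?M) * ((c x y)\<^sup>2 * tilt (e * x) y) \<partial>\<nu>)"
      proof (rule integral_mono)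
        show "integrable \<nu> (\<lambda>x. \<bar>b\<bar> * e ^ ?M * (c x y * tilt (e * x) y))"
          by (intro integrable_mult_right integrable_tilt c_int)
        show "integrable \<nu> (\<lambda>x. b\<^sup>2 / 4 * tilt (e * x) y + e ^ (2 * ?M) * ((c x y)\<^sup>2 * tilt (e * x) y))"
          by (intro Bochner_Integration.integrable_add integrable_mult_right integrable_tilt_1 integrable_tilt c2_int)
        fix x
        have "\<bar>b\<bar> * (e ^ ?M * c x y) \<le> \<bar>b\<bar>\<^sup>2 / 4 + (e ^ ?M * c x y)\<^sup>2"
          by (rule mult_le_quarter_square_add)
        then have "\<bar>b\<bar> * (e ^ ?M * c x y) * tilt (e * x) y \<le> (\<bar>b\<bar>\<^sup>2 / 4 + (e ^ ?M * c x y)\<^sup>2) * tilt (e * x) y"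
          by (rule mult_right_mono) simp
        moreover have "(e ^ ?M)\<^sup>2 = e ^ (2 * ?M)" by (rule power_even_eq[symmetric])
        ultimately show "\<bar>b\<bar> * e ^ ?M * (c x y * tilt (e * x) y)
            \<le> b\<^sup>2 / 4 * tilt (e * x) y + e ^ (2 * ?M) * ((c x y)\<^sup>2 * tilt (e * x) y)"
          by (simp add: power_mult_distrib distrib_right mult.assoc del: power_Suc)
      qed
      also have "\<dots> = b\<^sup>2 / 4 * Z + e ^ (2 * ?M) * T"
        unfolding T_def Z_def marginal_def using integrable_tilt_1[of e y] integrable_tilt[OF c2_int]
        by (subst Bochner_Integration.integral_add) (simp_all del: power_Suc mult_Suc_right)
      finally show ?thesis by (simp add: mult.commute)
    qed
    ultimately have "Z * b\<^sup>2 \<le> 2 * (e ^ (2 * ?M) * T) + 2 * (v\<^sup>2 / l)" by linarith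
    also have "v\<^sup>2 = e ^ (2 * ?M) * (C3\<^sup>2 * exp (6 * \<bar>y\<bar>))"
    proof -
      have "(exp (3 * \<bar>y\<bar>))\<^sup>2 = exp (6 * \<bar>y\<bar>)" by (simp add: power2_eq_square flip: exp_add)
      moreover have "(e ^ ?M)\<^sup>2 = e ^ (2 * ?M)" by (rule power_even_eq[symmetric])
      ultimately show ?thesis by (simp add: v_def power_mult_distrib del: power_Suc)
    qed
    finally have "Z * b\<^sup>2 \<le> 2 * e ^ (2 * ?M) * (T + C3\<^sup>2 / l * exp (6 * \<bar>y\<bar>))"
      by (simp add: algebra_simps del: power_Suc)
    then show ?thesis by (simp only: Z_def b_def T_def)
  qed
  show ?thesis
    using C(1) l main unfolding c_def g_def
    by (intro exI[of _ C] exI[of _ d] exI[of _ "C3\<^sup>2 / l"]) (auto simp del: power_Suc)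
qed

lemma post_mean_residual_integral:
  "\<exists>C. \<forall>e. 0 \<le> e \<and> e \<le> 1 \<longrightarrow>
     integrable joint (\<lambda>z. (poly (estimator m e) (e * fst z + snd z) - e * post_mean e (e * fst z + snd z))\<^sup>2) \<and>
     (\<integral>z. (poly (estimator m e) (e * fst z + snd z) - e * post_mean e (e * fst z + snd z))\<^sup>2 \<partial>joint)
       \<le> C * e ^ (2 * Suc m)"
proof -
  let ?M = "Suc m"
  obtain C d L where CL: "C \<ge> 0" "L \<ge> 0" and bound: "\<And>e y. 0 \<le> e \<Longrightarrow> e \<le> 1 \<Longrightarrow>
     marginal e y * (poly (estimator m e) y - e * post_mean e y)\<^sup>2
       \<le> 2 * e ^ (2 * ?M) * ((\<integral>x. (\<bar>x\<bar> ^ ?M * (C * (1 + \<bar>y\<bar>) ^ d + \<bar>x\<bar>))\<^sup>2 * tilt (e * x) y \<partial>\<nu>)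
            + L * exp (6 * \<bar>y\<bar>))"
    using post_mean_residual_bound[of m] by blast
  define c where "c = (\<lambda>x y::real. \<bar>x\<bar> ^ ?M * (C * (1 + \<bar>y\<bar>) ^ d + \<bar>x\<bar>))"
  \<comment> \<open>An integrable majorant independent of \<open>e\<close>, obtained from 1 + |e x +
    n| \<le> (1 + |x|) (1 + |n|) for |e| \<le> 1.\<close>
  define dom where "dom = (\<lambda>z::real \<times> real. (C + 1)\<^sup>2 * ((1 + \<bar>fst z\<bar>) ^ (2 * (?M + d + 1)) * (1 + \<bar>snd z\<bar>) ^ (2 * d)))"
  have dom: "integrable joint dom"
    unfolding dom_def by (intro integrable_mult_right integrable_dominating)
  have c_le: "(c (fst z) (e * fst z + snd z))\<^sup>2 \<le> dom z" if "0 \<le> e" "e \<le> 1" for e z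
  proof -
    let ?u = "1 + \<bar>fst z\<bar>" and ?w = "1 + \<bar>snd z\<bar>"
    have "(1 + \<bar>e * fst z + snd z\<bar>) ^ d \<le> (?u * ?w) ^ d"
      using that by (intro power_mono one_plus_abs_shift_le) auto
    then have "C * (1 + \<bar>e * fst z + snd z\<bar>) ^ d \<le> C * (?u ^ d * ?w ^ d)"
      unfolding power_mult_distrib using CL(1) by (rule mult_left_mono)
    also have "\<dots> \<le> C * (?u ^ (d + 1) * ?w ^ d)"
      using CL(1) by (intro mult_left_mono mult_right_mono power_increasing) auto
    finally have 1: "C * (1 + \<bar>e * fst z + snd z\<bar>) ^ d \<le> C * (?u ^ (d + 1) * ?w ^ d)" .
    have "\<bar>fst z\<bar> \<le> ?u ^ 1 * 1" by simp
    also have "\<dots> \<le> ?u ^ (d + 1) * ?w ^ d"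
      by (intro mult_mono power_increasing one_le_power) auto
    finally have "C * (1 + \<bar>e * fst z + snd z\<bar>) ^ d + \<bar>fst z\<bar> \<le> (C + 1) * (?u ^ (d + 1) * ?w ^ d)"
      using 1 by (simp add: distrib_right)
    moreover have "\<bar>fst z\<bar> ^ ?M \<le> ?u ^ ?M" by (intro power_mono) auto
    ultimately have "c (fst z) (e * fst z + snd z) \<le> ?u ^ ?M * ((C + 1) * (?u ^ (d + 1) * ?w ^ d))"
      unfolding c_def using CL(1) by (intro mult_mono) auto
    also have "\<dots> = (C + 1) * (?u ^ (?M + d + 1) * ?w ^ d)"
      unfolding power_add by (simp add: mult_ac)
    finally have "(c (fst z) (e * fst z + snd z))\<^sup>2 \<le> ((C + 1) * (?u ^ (?M + d + 1) * ?w ^ d))\<^sup>2"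
      using CL(1) by (intro power_mono) (auto simp: c_def)
    also have "\<dots> = dom z"
      unfolding dom_def power_mult_distrib power_mult[symmetric] by (simp only: mult.commute[of 2])
    finally show ?thesis .
  qed
  define B where "B = 2 * ((\<integral>z. dom z \<partial>joint) + L * (\<integral>y. exp (6 * \<bar>y\<bar>) \<partial>gaussian))"
  have "integrable joint (\<lambda>z. (poly (estimator m e) (e * fst z + snd z) - e * post_mean e (e * fst z + snd z))\<^sup>2)
      \<and> (\<integral>z. (poly (estimator m e) (e * fst z + snd z) - e * post_mean e (e * fst z + snd z))\<^sup>2 \<partial>joint)
        \<le> B * e ^ (2 * ?M)" if e: "0 \<le> e" "e \<le> 1" for e
  proof -
    let ?b = "\<lambda>y. poly (estimator m e) y - e * post_mean e y" and ?Y = "\<lambda>z. e * fst z + snd z :: real"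
    let ?T = "\<lambda>y. \<integral>x. (c x y)\<^sup>2 * tilt (e * x) y \<partial>\<nu>"
    have [measurable]: "poly p \<in> borel_measurable borel" for p :: "real poly"
      by (intro borel_measurable_continuous_onI continuous_intros)
    have [measurable]: "(\<lambda>z. c (fst z) (snd z)) \<in> borel_measurable (borel \<Otimes>\<^sub>M borel)"
      unfolding c_def by measurable
    have cY: "integrable joint (\<lambda>z. (c (fst z) (?Y z))\<^sup>2)"
    proof (rule Bochner_Integration.integrable_bound[OF dom])
      show "(\<lambda>z. (c (fst z) (?Y z))\<^sup>2) \<in> borel_measurable joint" unfolding c_def by measurable
      show "AE z in joint. norm ((c (fst z) (?Y z))\<^sup>2) \<le> norm (dom z)"
        using c_le[OF e] by (intro AE_I2) (auto intro: order_trans[OF _ abs_ge_self])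
    qed
    have ct: "integrable joint (\<lambda>z. tilt (e * fst z) (snd z) * (c (fst z) (snd z))\<^sup>2)"
      using cY integrable_joint_shift[of "\<lambda>z. (c (fst z) (snd z))\<^sup>2" e] by simp
    have T: "integrable gaussian ?T"
      using P.integrable_snd[of "\<lambda>x y. (c x y)\<^sup>2 * tilt (e * x) y", unfolded case_prod_beta] ct
      by (simp add: mult.commute)
    \<comment> \<open>The tilt is undone: the integral over y becomes an expectation at the actual
      observation, controlled by polynomial moments.\<close>
    have "(\<integral>y. ?T y \<partial>gaussian) = (\<integral>z. (c (fst z) (?Y z))\<^sup>2 \<partial>joint)"
      using P.integral_snd[of "\<lambda>x y. (c x y)\<^sup>2 * tilt (e * x) y", unfolded case_prod_beta] ct
        integral_joint_shift[of "\<lambda>z. (c (fst z) (snd z))\<^sup>2" e]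
      by (simp add: mult.commute)
    also have "\<dots> \<le> (\<integral>z. dom z \<partial>joint)"
      by (rule integral_mono[OF cY dom]) (rule c_le[OF e])
    finally have T_le: "(\<integral>y. ?T y \<partial>gaussian) \<le> (\<integral>z. dom z \<partial>joint)" .
    have int6: "integrable gaussian (\<lambda>y. 2 * e ^ (2 * ?M) * (?T y + L * exp (6 * \<bar>y\<bar>)))"
      by (intro integrable_mult_right Bochner_Integration.integrable_add T integrable_gaussian_exp_abs)
    have T0: "?T y \<ge> 0" for y by simp
    \<comment> \<open>Nonnegative integrals are used because the integrability of the squared error
      is itself part of the conclusion.\<close>
    have "(\<integral>\<^sup>+z. ennreal ((?b (?Y z))\<^sup>2) \<partial>joint)
        = (\<integral>\<^sup>+z. ennreal (tilt (e * fst z) (snd z)) * ennreal ((?b (snd z))\<^sup>2) \<partial>joint)"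
      using nn_integral_joint_shift[of "\<lambda>z. ennreal ((?b (snd z))\<^sup>2)" e] by simp
    also have "\<dots> = (\<integral>\<^sup>+y. (\<integral>\<^sup>+x. ennreal (tilt (e * x) y) * ennreal ((?b y)\<^sup>2) \<partial>\<nu>) \<partial>gaussian)"
      by (subst P.nn_integral_snd[symmetric]) simp_all
    also have "\<dots> = (\<integral>\<^sup>+y. ennreal (marginal e y * (?b y)\<^sup>2) \<partial>gaussian)"
    proof (intro nn_integral_cong)
      fix y
      have "(\<integral>\<^sup>+x. ennreal (tilt (e * x) y) * ennreal ((?b y)\<^sup>2) \<partial>\<nu>) = (\<integral>\<^sup>+x. ennreal (tilt (e * x) y * (?b y)\<^sup>2) \<partial>\<nu>)"
        by (simp add: ennreal_mult)
      also have "\<dots> = ennreal (\<integral>x. tilt (e * x) y * (?b y)\<^sup>2 \<partial>\<nu>)"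
        by (rule nn_integral_eq_integral) (simp_all add: integrable_tilt_1)
      also have "(\<integral>x. tilt (e * x) y * (?b y)\<^sup>2 \<partial>\<nu>) = marginal e y * (?b y)\<^sup>2"
        by (simp add: marginal_def)
      finally show "(\<integral>\<^sup>+x. ennreal (tilt (e * x) y) * ennreal ((?b y)\<^sup>2) \<partial>\<nu>) = ennreal (marginal e y * (?b y)\<^sup>2)" .
    qed
    also have "\<dots> \<le> (\<integral>\<^sup>+y. ennreal (2 * e ^ (2 * ?M) * (?T y + L * exp (6 * \<bar>y\<bar>))) \<partial>gaussian)"
      using bound[OF e] unfolding c_def by (intro nn_integral_mono ennreal_leI)
    also have "\<dots> = ennreal (\<integral>y. 2 * e ^ (2 * ?M) * (?T y + L * exp (6 * \<bar>y\<bar>)) \<partial>gaussian)"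
      by (rule nn_integral_eq_integral[OF int6]) (use e CL T0 in \<open>auto intro!: AE_I2 mult_nonneg_nonneg add_nonneg_nonneg\<close>)
    also have "(\<integral>y. 2 * e ^ (2 * ?M) * (?T y + L * exp (6 * \<bar>y\<bar>)) \<partial>gaussian)
        = 2 * e ^ (2 * ?M) * ((\<integral>y. ?T y \<partial>gaussian) + L * (\<integral>y. exp (6 * \<bar>y\<bar>) \<partial>gaussian))"
      using T integrable_gaussian_exp_abs[of 6] by (simp del: mult_Suc_right power_Suc)
    also have "ennreal \<dots> \<le> ennreal (B * e ^ (2 * ?M))"
    proof (rule ennreal_leI)
      have "2 * e ^ (2 * ?M) * ((\<integral>y. ?T y \<partial>gaussian) + L * (\<integral>y. exp (6 * \<bar>y\<bar>) \<partial>gaussian))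
          \<le> 2 * e ^ (2 * ?M) * ((\<integral>z. dom z \<partial>joint) + L * (\<integral>y. exp (6 * \<bar>y\<bar>) \<partial>gaussian))"
        using T_le e by (intro mult_left_mono add_right_mono) auto
      then show "2 * e ^ (2 * ?M) * ((\<integral>y. ?T y \<partial>gaussian) + L * (\<integral>y. exp (6 * \<bar>y\<bar>) \<partial>gaussian)) \<le> B * e ^ (2 * ?M)"
        by (simp only: B_def mult_ac)
    qed
    finally have le: "(\<integral>\<^sup>+z. ennreal ((?b (?Y z))\<^sup>2) \<partial>joint) \<le> ennreal (B * e ^ (2 * ?M))" .
    have "B \<ge> 0"
      unfolding B_def using CL by (intro mult_nonneg_nonneg add_nonneg_nonneg integral_nonneg) (auto simp: dom_def)
    then have "B * e ^ (2 * ?M) \<ge> 0" using e by simp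
    from integral_le_of_nn_integral[OF _ _ this le] show ?thesis by simp
  qed
  then show ?thesis by blast
qed

text \<open>By Pythagoras the estimator exceeds the minimal error by its squared distance to the
  posterior mean, which is of the order of the remainder in \<open>estimator_error\<close>.\<close>

lemma mmse_expansion:
  "\<exists>C. \<forall>e. 0 < e \<and> e \<le> 1 \<longrightarrow>
     \<bar>e\<^sup>2 * mmse \<nu> (e\<^sup>2) - (e\<^sup>2 * moment \<nu> 2 - (\<Sum>n<2 * m + 2. e ^ n * cond_energy (moment \<nu>) n))\<bar>
       \<le> C * e ^ (2 * m + 2)"
proof -
  obtain C1 where C1: "\<And>e. 0 \<le> e \<Longrightarrow> e \<le> 1 \<Longrightarrow>
      \<bar>(\<integral>z. (e * fst z - poly (estimator m e) (e * fst z + snd z))\<^sup>2 \<partial>joint)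
       - (e\<^sup>2 * moment \<nu> 2 - (\<Sum>n<2 * m + 2. e ^ n * cond_energy (moment \<nu>) n))\<bar> \<le> C1 * e ^ (2 * m + 2)"
    using estimator_error[of m] by blast
  obtain C2 where C2: "\<And>e. 0 \<le> e \<Longrightarrow> e \<le> 1 \<Longrightarrow>
     integrable joint (\<lambda>z. (poly (estimator m e) (e * fst z + snd z) - e * post_mean e (e * fst z + snd z))\<^sup>2) \<and>
     (\<integral>z. (poly (estimator m e) (e * fst z + snd z) - e * post_mean e (e * fst z + snd z))\<^sup>2 \<partial>joint)
       \<le> C2 * e ^ (2 * Suc m)"
    using post_mean_residual_integral[of m] by blast
  have "\<bar>e\<^sup>2 * mmse \<nu> (e\<^sup>2) - (e\<^sup>2 * moment \<nu> 2 - (\<Sum>n<2 * m + 2. e ^ n * cond_energy (moment \<nu>) n))\<bar>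
      \<le> (C1 + C2) * e ^ (2 * m + 2)" if e: "0 < e" "e \<le> 1" for e
  proof -
    let ?f = "poly (estimator m e)"
    define r where "r = (\<integral>z. (?f (e * fst z + snd z) - e * post_mean e (e * fst z + snd z))\<^sup>2 \<partial>joint)"
    have [measurable]: "?f \<in> borel_measurable borel"
      by (intro borel_measurable_continuous_onI continuous_intros)
    have f2: "integrable joint (\<lambda>z. (?f (e * fst z + snd z))\<^sup>2)"
      using integrable_power_poly[of e 0 "estimator m e * estimator m e"] e by (simp add: power2_eq_square)
    have "(\<integral>z. (e * fst z - ?f (e * fst z + snd z))\<^sup>2 \<partial>joint) = e\<^sup>2 * mmse \<nu> (e\<^sup>2) + r"
      unfolding r_def by (rule mmse_pythagoras[OF mean e(1) _ f2]) (use C2[of e] e in auto)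
    moreover have "0 \<le> r" "r \<le> C2 * e ^ (2 * m + 2)"
      using C2[of e] e by (simp_all add: r_def)
    ultimately show ?thesis
      using C1[of e] e unfolding distrib_right by (simp add: abs_le_iff)
  qed
  then show ?thesis by blast
qed

end

end

subsection \<open>Identification of the moments\<close>

lemma polynomial_small_imp_zero:
  fixes c :: "nat \<Rightarrow> real"
  assumes bound: "\<And>e. 0 < e \<Longrightarrow> e \<le> 1 \<Longrightarrow> \<bar>\<Sum>n<k. e ^ n * c n\<bar> \<le> C * e ^ k"
    and "n < k"
  shows "c n = 0"
  using \<open>n < k\<close>
proof (induction n rule: less_induct)
  case (less n)
  define B where "B = (\<Sum>i<k. \<bar>c i\<bar>) + \<bar>C\<bar>"
  have le: "\<bar>c n\<bar> \<le> e * B" if e: "0 < e" "e \<le> 1" for e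
  proof -
    have "{..<k} = insert n ({..<n} \<union> {n<..<k})" using less.prems by auto
    then have "(\<Sum>i<k. e ^ i * c i) = e ^ n * c n + (\<Sum>i\<in>{..<n} \<union> {n<..<k}. e ^ i * c i)"
      by simp
    also have "(\<Sum>i\<in>{..<n} \<union> {n<..<k}. e ^ i * c i) = (\<Sum>i\<in>{n<..<k}. e ^ i * c i)"
      using less by (intro sum.mono_neutral_right) auto
    finally have "\<bar>e ^ n * c n\<bar> \<le> \<bar>\<Sum>i<k. e ^ i * c i\<bar> + \<bar>\<Sum>i\<in>{n<..<k}. e ^ i * c i\<bar>"
      by linarith
    also have "\<bar>\<Sum>i\<in>{n<..<k}. e ^ i * c i\<bar> \<le> (\<Sum>i\<in>{n<..<k}. e ^ Suc n * \<bar>c i\<bar>)"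
    proof (rule order_trans[OF sum_abs sum_mono])
      fix i assume "i \<in> {n<..<k}"
      then have "e ^ i \<le> e ^ Suc n" using e by (intro power_decreasing) auto
      then show "\<bar>e ^ i * c i\<bar> \<le> e ^ Suc n * \<bar>c i\<bar>"
        using e by (simp add: abs_mult mult_right_mono del: power_Suc)
    qed
    also have "(\<Sum>i\<in>{n<..<k}. e ^ Suc n * \<bar>c i\<bar>) \<le> (\<Sum>i<k. e ^ Suc n * \<bar>c i\<bar>)"
      using e by (intro sum_mono2) auto
    also have "\<bar>\<Sum>i<k. e ^ i * c i\<bar> \<le> \<bar>C\<bar> * e ^ Suc n"
    proof -
      have "C * e ^ k \<le> \<bar>C\<bar> * e ^ k" using e by (intro mult_right_mono) auto
      also have "\<dots> \<le> \<bar>C\<bar> * e ^ Suc n" using e less.prems by (intro mult_left_mono power_decreasing) auto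
      finally show ?thesis using bound[OF e] by simp
    qed
    finally have "e ^ n * \<bar>c n\<bar> \<le> e ^ n * (e * B)"
      using e by (simp add: B_def abs_mult sum_distrib_left algebra_simps)
    then show ?thesis using e by simp
  qed
  show "c n = 0"
  proof (rule ccontr)
    assume "c n \<noteq> 0"
    then have "\<bar>c n\<bar> > 0" by simp
    moreover have B: "\<bar>c n\<bar> \<le> B" using le[of 1] by simp
    \<comment> \<open>This value of e turns the bound |c n| \<le> e B into |c n| \<le> |c n| /
      2.\<close>
    ultimately have "\<bar>c n\<bar> / (2 * B) * B = \<bar>c n\<bar> / 2" "0 < \<bar>c n\<bar> / (2 * B)" "\<bar>c n\<bar> / (2 * B) \<le> 1"
      by (simp_all add: divide_simps)
    with le[of "\<bar>c n\<bar> / (2 * B)"] \<open>\<bar>c n\<bar> > 0\<close> show False by simp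
  qed
qed

text \<open>For a centred sequence V starts at order 2, hence V^2 W at order 4. Order 2 of the mmse
  expansion therefore isolates the second moment.\<close>

lemma cond_energy_2:
  assumes "a 0 = 1" "a 1 = 0"
  shows "cond_energy a 2 = 0"
proof -
  have "fps_nth (cond_mean a * cond_mean a * noisy_density a) 2 = 0"
    using assms by (simp add: fps_mult_nth numeral_2_eq_2 cond_mean_nth_0 cond_mean_nth_1)
  then show ?thesis by (simp add: cond_energy_def)
qed

lemma mmse_eq_imp_cond_energy_eq:
  assumes "moment_law \<mu>" "moment_law \<nu>" "moment \<mu> 1 = 0" "moment \<nu> 1 = 0"
    and mmse: "\<And>s. s > 0 \<Longrightarrow> mmse \<mu> s = mmse \<nu> s"
  shows "moment \<mu> 2 = moment \<nu> 2" "cond_energy (moment \<mu>) n = cond_energy (moment \<nu>) n"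
proof -
  interpret X: moment_law \<mu> by fact
  interpret Y: moment_law \<nu> by fact
  define c where "c = (\<lambda>n. (if n = 2 then moment \<mu> 2 - moment \<nu> 2 else 0)
      - (cond_energy (moment \<mu>) n - cond_energy (moment \<nu>) n))"
  have c0: "c n = 0" for n
  proof -
    \<comment> \<open>The expansion must reach beyond both order \<open>n\<close> and order 2, where
      the second moments enter; the successor ensures m \<ge> 1.\<close>
    define m where "m = Suc n"
    obtain C1 where C1: "\<And>e. 0 < e \<Longrightarrow> e \<le> 1 \<Longrightarrow>
       \<bar>e\<^sup>2 * mmse \<mu> (e\<^sup>2) - (e\<^sup>2 * moment \<mu> 2 - (\<Sum>n<2 * m + 2. e ^ n * cond_energy (moment \<mu>) n))\<bar>
         \<le> C1 * e ^ (2 * m + 2)"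
      using X.mmse_expansion[OF assms(3), of m] by blast
    obtain C2 where C2: "\<And>e. 0 < e \<Longrightarrow> e \<le> 1 \<Longrightarrow>
       \<bar>e\<^sup>2 * mmse \<nu> (e\<^sup>2) - (e\<^sup>2 * moment \<nu> 2 - (\<Sum>n<2 * m + 2. e ^ n * cond_energy (moment \<nu>) n))\<bar>
         \<le> C2 * e ^ (2 * m + 2)"
      using Y.mmse_expansion[OF assms(4), of m] by blast
    show "c n = 0"
    proof (rule polynomial_small_imp_zero)
      show "n < 2 * m + 2" by (simp add: m_def)
      fix e :: real assume e: "0 < e" "e \<le> 1"
      have "(\<Sum>n<2 * m + 2. e ^ n * (if n = 2 then moment \<mu> 2 - moment \<nu> 2 else 0))
          = (\<Sum>n<2 * m + 2. if n = 2 then e\<^sup>2 * (moment \<mu> 2 - moment \<nu> 2) else 0)"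
        by (rule sum.cong) auto
      also have "\<dots> = e\<^sup>2 * (moment \<mu> 2 - moment \<nu> 2)"
        by (simp add: m_def)
      finally have sum: "(\<Sum>n<2 * m + 2. e ^ n * c n) = e\<^sup>2 * (moment \<mu> 2 - moment \<nu> 2)
          - ((\<Sum>n<2 * m + 2. e ^ n * cond_energy (moment \<mu>) n) - (\<Sum>n<2 * m + 2. e ^ n * cond_energy (moment \<nu>) n))"
        unfolding c_def right_diff_distrib sum_subtractf by simp
      have eq: "mmse \<mu> (e\<^sup>2) = mmse \<nu> (e\<^sup>2)" using e by (intro mmse) simp
      show "\<bar>\<Sum>n<2 * m + 2. e ^ n * c n\<bar> \<le> (C1 + C2) * e ^ (2 * m + 2)"
        using C1[OF e] C2[OF e] unfolding sum eq distrib_right right_diff_distrib by linarith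
    qed
  qed
  have "cond_energy (moment \<mu>) 2 = 0" "cond_energy (moment \<nu>) 2 = 0"
    using assms X.moment_0 Y.moment_0 by (simp_all add: cond_energy_2)
  with c0[of 2] show 2: "moment \<mu> 2 = moment \<nu> 2" by (simp add: c_def)
  show "cond_energy (moment \<mu>) n = cond_energy (moment \<nu>) n"
    using c0[of n] 2 by (simp add: c_def split: if_splits)
qed

lemma lead_cumulant_recursion:
  assumes "a 0 = 1"
  shows "fps_nth (lead_cumulant a) n = real n * a n / fact n
     - (\<Sum>i = 1..n. a i / fact i * fps_nth (lead_cumulant a) (n - i))"
  using fps_nth_quotient[OF _ exp_gen_lead_cumulant, of a n] assms by (simp add: exp_gen_def)

lemma lead_cumulant_0: "a 0 = 1 \<Longrightarrow> fps_nth (lead_cumulant a) 0 = 0"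
  by (simp add: lead_cumulant_recursion)

lemma lead_cumulant_2:
  assumes "a 0 = 1" "a 1 = 0"
  shows "fps_nth (lead_cumulant a) 2 = a 2"
  using lead_cumulant_recursion[of a 2] lead_cumulant_0[of a] assms
  by (simp add: numeral_2_eq_2)

text \<open>A cumulant is the moment of the same order plus a polynomial in lower moments, and those
  agree here.\<close>

lemma lead_cumulant_diff:
  assumes "a 0 = 1" "b 0 = 1" "\<And>j. j < k \<Longrightarrow> b j = a j" "k > 0"
  shows "fps_nth (lead_cumulant b) k = fps_nth (lead_cumulant a) k + (b k - a k) / fact (k - 1)"
proof -
  have less: "fps_nth (lead_cumulant b) j = fps_nth (lead_cumulant a) j" if "j < k" for j
    using that
  proof (induction j rule: less_induct)
    case (less j)
    have "(\<Sum>i = 1..j. b i / fact i * fps_nth (lead_cumulant b) (j - i))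
        = (\<Sum>i = 1..j. a i / fact i * fps_nth (lead_cumulant a) (j - i))"
      using less assms(3) by (intro sum.cong) auto
    then show ?case
      using lead_cumulant_recursion[of a j] lead_cumulant_recursion[of b j] assms less.prems by simp
  qed
  have "(\<Sum>i = 1..k. b i / fact i * fps_nth (lead_cumulant b) (k - i))
      = (\<Sum>i = 1..k. a i / fact i * fps_nth (lead_cumulant a) (k - i))"
  proof (rule sum.cong[OF refl])
    fix i assume i: "i \<in> {1..k}"
    show "b i / fact i * fps_nth (lead_cumulant b) (k - i) = a i / fact i * fps_nth (lead_cumulant a) (k - i)"
      using i assms less lead_cumulant_0[of a] lead_cumulant_0[of b] by (cases "i = k") auto
  qed
  then have "fps_nth (lead_cumulant b) k - fps_nth (lead_cumulant a) k = real k * b k / fact k - real k * a k / fact k"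
    using lead_cumulant_recursion[of a k] lead_cumulant_recursion[of b k] assms by simp
  also have "\<dots> = (b k - a k) / fact (k - 1)"
    using assms(4) by (simp add: fact_reduce[of k] diff_divide_distrib)
  finally show ?thesis by simp
qed

text \<open>Only \<open>a\<close> is required to have vanishing odd cumulants; \<open>b\<close> is
  merely centred, so odd moments take part in the induction too.\<close>

lemma moments_eqI:
  assumes a: "a 0 = 1" "a 1 = 0" and b: "b 0 = 1" "b 1 = 0" "b 2 = a 2"
    and energy: "\<And>n. cond_energy b n = cond_energy a n"
    and pos: "a 2 > 0"
    and odd: "\<And>n. odd n \<Longrightarrow> fps_nth (lead_cumulant a) n = 0"
    and alt: "\<And>n. n \<ge> 1 \<Longrightarrow> fps_nth (lead_cumulant a) (2 * n) * fps_nth (lead_cumulant a) (2 * n + 2) < 0"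
    and four: "fps_nth (lead_cumulant b) 4 * fps_nth (lead_cumulant a) 4 > 0"
  shows "b k = a k"
proof (induction k rule: less_induct)
  case (less k)
  define C where "C = (\<lambda>n. fps_nth (lead_cumulant a) n)"
  have C2: "C 2 = a 2" unfolding C_def by (rule lead_cumulant_2) fact+
  have C0: "C 0 = 0" unfolding C_def by (rule lead_cumulant_0) fact
  have sign: "(- 1) ^ Suc n * C (2 * n) > 0" if "n \<ge> 1" for n
    using that
  proof (induction n rule: nat_induct_at_least)
    case base
    then show ?case using pos C2 by simp
  next
    case (Suc n)
    have "((- 1) ^ Suc n * C (2 * n)) * ((- 1) ^ Suc n * C (2 * Suc n))
        = ((- 1) ^ Suc n * (- 1) ^ Suc n) * (C (2 * n) * C (2 * n + 2))"
      by (simp add: mult_ac)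
    also have "(- 1 :: real) ^ Suc n * (- 1) ^ Suc n = 1"
      by (simp flip: power_mult_distrib)
    also have "1 * (C (2 * n) * C (2 * n + 2)) < 0"
      using alt[OF Suc.hyps] by (simp add: C_def)
    finally have "((- 1) ^ Suc n * C (2 * n)) * ((- 1) ^ Suc n * C (2 * Suc n)) < 0" .
    with Suc.IH have "(- 1) ^ Suc n * C (2 * Suc n) < 0"
      by (meson less_imp_le linorder_not_less mult_nonneg_nonneg)
    then show ?case by simp
  qed
  consider "k < 3" | "k \<ge> 3" by linarith
  then show ?case
  proof cases
    case 1
    then have "k = 0 \<or> k = 1 \<or> k = 2" by auto
    with a b show ?thesis by auto
  next
    case 2
    then have k: "2 < k" by simp
    show ?thesis
    proof (rule ccontr)
      assume ne: "b k \<noteq> a k"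
      define d where "d = b k - a k"
      have "d * (2 * C k + d / fact (k - 1)) = 0"
        using cond_energy_diff_double[of a b k, OF a b(1,2) k less] energy by (simp add: d_def C_def)
      with ne have d: "d / fact (k - 1) = - 2 * C k" by (simp add: d_def)
      have dC: "d = - 2 * fact (k - 1) * C k"
        using d by (simp add: field_simps)
      from ne dC have Ck: "C k \<noteq> 0" by (auto simp: d_def)
      then have "even k" using odd by (auto simp: C_def)
      then obtain n where n: "k = 2 * n" by (auto elim: evenE)
      show False
      proof (cases "k = 4")
        case True
        have "fps_nth (lead_cumulant b) 4 = C 4 + d / fact (k - 1)"
          using lead_cumulant_diff[of a b k, OF a(1) b(1) less] True by (simp add: C_def d_def)
        \<comment> \<open>The fourth cumulant has been reflected, so its product with the original
          one is a negative square.\<close>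
        then have "fps_nth (lead_cumulant b) 4 * C 4 = - (C 4 * C 4)"
          using d True by simp
        then show False using four by (simp add: C_def not_less flip: power2_eq_square)
      next
        case False
        with n k have n3: "n \<ge> 3" by presburger
        obtain c where "c \<ge> 0" and c: "cond_energy b (2 * k + 2) - cond_energy a (2 * k + 2)
            = 2 * (b (k + 1) - a (k + 1)) * fps_nth (lead_cumulant a) (k + 1) + c
              - real (k + 1) * (b k - a k) * (fps_nth (lead_cumulant a * lead_cumulant a) (k + 2)
                + a 2 * (b k - a k) / fact (k - 1))"
          using cond_energy_diff_double2[of a b k, OF a b(1,2) k less] by blast
        define S where "S = fps_nth (lead_cumulant a * lead_cumulant a) (k + 2)"
        have "fps_nth (lead_cumulant a) (k + 1) = 0" using odd \<open>even k\<close> by simp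
        then have "c = real (k + 1) * d * (S + a 2 * (d / fact (k - 1)))"
          using c energy by (simp add: d_def S_def)
        then have "c = - 2 * fact (k - 1) * real (k + 1) * (C k * S - 2 * C 2 * (C k * C k))"
          unfolding d C2[symmetric] unfolding dC by (simp add: algebra_simps)
        \<comment> \<open>The subtracted term is exactly the contribution of the indices 2 and
          \<open>k\<close> to \<open>C k * S\<close>. What remains has both indices at least 4, and
          index 4 gives a strictly positive term because k \<ge> 6.\<close>
        moreover have "C k * S - 2 * C 2 * (C k * C k) > 0"
        proof -
          let ?t = "\<lambda>i. C k * (C i * C (k + 2 - i))"
          have t_pos: "?t (2 * u) > 0" if "1 \<le> u" "u \<le> n" for u
          proof -
            \<comment> \<open>The three alternating signs have total exponent 2 (n + 2), which is
              even.\<close>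
            have "0 < ((- 1) ^ Suc n * C (2 * n)) * (((- 1) ^ Suc u * C (2 * u))
                * ((- 1) ^ Suc (Suc n - u) * C (2 * (Suc n - u))))"
              using that n3 by (intro mult_pos_pos sign) auto
            also have "\<dots> = ((- 1) ^ (Suc n + Suc u + Suc (Suc n - u))) * (C (2 * n) * (C (2 * u) * C (2 * (Suc n - u))))"
              unfolding power_add by (simp add: mult_ac)
            also have "Suc n + Suc u + Suc (Suc n - u) = 2 * (n + 2)" using that by simp
            also have "2 * (Suc n - u) = k + 2 - 2 * u" by (simp add: n)
            finally show ?thesis by (simp add: n)
          qed
          have t_nonneg: "?t i \<ge> 0" if "i \<in> {0..k + 2}" for i
          proof (cases "even i")
            case True
            then obtain u where u: "i = 2 * u" by (auto elim: evenE)
            have "u \<le> Suc n" using that u n by simp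
            then consider "u = 0" | "u = Suc n" | "1 \<le> u" "u \<le> n" by linarith
            then show ?thesis
            proof cases
              case 3
              then show ?thesis using t_pos[of u] u by simp
            qed (use u n C0 in simp_all)
          next
            case False
            then have "C i = 0" using odd by (simp add: C_def)
            then show ?thesis by simp
          qed
          have "(\<Sum>i\<in>{2, 4, k}. ?t i) \<le> (\<Sum>i = 0..k + 2. ?t i)"
            by (rule sum_mono2) (use t_nonneg k n n3 in auto)
          also have "\<dots> = C k * S"
            unfolding S_def fps_mult_nth C_def sum_distrib_left ..
          finally have "?t 2 + ?t 4 + ?t k \<le> C k * S"
            using n n3 by simp
          moreover have "?t 2 = C 2 * (C k * C k)" "?t k = C 2 * (C k * C k)" by simp_all
          moreover have "?t 4 > 0" using t_pos[of 2] n3 by simp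
          ultimately show ?thesis by linarith
        qed
        ultimately have "c < 0" by (simp add: mult_neg_pos)
        with \<open>c \<ge> 0\<close> show False by simp
      qed
    qed
  qed
qed

section \<open>Symmetric laws and the conclusion\<close>

context moment_law
begin

lemma symmetric_odd_moment:
  assumes "distr \<nu> borel uminus = \<nu>" "odd n"
  shows "moment \<nu> n = 0"
proof -
  have "moment \<nu> n = (\<integral>x. x ^ n \<partial>distr \<nu> borel uminus)"
    by (simp add: moment_def assms(1))
  also have "\<dots> = (\<integral>x. (- x) ^ n \<partial>\<nu>)"
    by (rule integral_distr) simp_all
  also have "\<dots> = - moment \<nu> n"
    using assms(2) by (simp add: moment_def)
  finally show ?thesis by simp
qed

text \<open>In the recursion the indices i and n - i add up to an odd number, so each product has an
  odd moment or a smaller odd cumulant as a factor.\<close>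

lemma symmetric_odd_lead_cumulant:
  assumes "distr \<nu> borel uminus = \<nu>" "odd n"
  shows "fps_nth (lead_cumulant (moment \<nu>)) n = 0"
  using \<open>odd n\<close>
proof (induction n rule: less_induct)
  case (less n)
  have "(\<Sum>i = 1..n. moment \<nu> i / fact i * fps_nth (lead_cumulant (moment \<nu>)) (n - i)) = 0"
  proof (rule sum.neutral, rule ballI)
    fix i assume "i \<in> {1..n}"
    then show "moment \<nu> i / fact i * fps_nth (lead_cumulant (moment \<nu>)) (n - i) = 0"
      using less symmetric_odd_moment[OF assms(1), of i] by (cases "odd i") auto
  qed
  then show ?case
    using lead_cumulant_recursion[of "moment \<nu>" n] moment_0 symmetric_odd_moment[OF assms(1) less.prems] by simp
qed

end

theorem theorem2p9:
  fixes M :: "'a measure" and X :: "'a \<Rightarrow> real"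
    and M' :: "'b measure" and Y :: "'b \<Rightarrow> real"
  assumes "prob_space M" and "X \<in> borel_measurable M"
    and "prob_space M'" and "Y \<in> borel_measurable M'"
    and "SMD (distr M borel X)"
    and "\<And>n::nat. n \<ge> 1 \<Longrightarrow>
           cumulant (distr M borel X) (2*n) * cumulant (distr M borel X) (2*n+2) < 0"
    and "\<And>n::nat. integrable M' (\<lambda>\<omega>. Y \<omega> ^ n)"
    and "(\<integral>\<omega>. Y \<omega> \<partial>M') = 0"
    and "cumulant (distr M' borel Y) 4 * cumulant (distr M borel X) 4 > 0"
    and "\<And>s::real. s > 0 \<Longrightarrow> mmse (distr M borel X) s = mmse (distr M' borel Y) s"
  shows "distr M borel X = distr M' borel Y"
proof -
  define \<mu> where "\<mu> = distr M borel X"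
  define \<nu> where "\<nu> = distr M' borel Y"
  have smd: "real_law \<mu>" "distr \<mu> borel uminus = \<mu>" "all_moments \<mu>"
    "\<And>\<nu>. real_law \<nu> \<Longrightarrow> (\<And>p. p \<ge> 1 \<Longrightarrow> integrable \<nu> (\<lambda>x. x ^ p) \<and> (\<integral>x. x ^ p \<partial>\<nu>) = (\<integral>x. x ^ p \<partial>\<mu>)) \<Longrightarrow> \<nu> = \<mu>"
    using assms(5) unfolding SMD_def \<mu>_def by blast+
  interpret X: moment_law \<mu>
    using smd by (simp add: moment_law_def moment_law_axioms_def real_law_def all_moments_def)
  have \<nu>: "real_law \<nu>"
    using prob_space.prob_space_distr[OF assms(3,4)] by (simp add: real_law_def \<nu>_def)
  interpret Y: moment_law \<nu>
    using \<nu> assms(4,7) by (simp add: moment_law_def moment_law_axioms_def real_law_def \<nu>_def integrable_distr_eq)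
  let ?a = "moment \<mu>" and ?b = "moment \<nu>"
  have a1: "?a 1 = 0" by (rule X.symmetric_odd_moment[OF smd(2)]) simp
  have b1: "?b 1 = 0" using assms(4,8) by (simp add: moment_def \<nu>_def integral_distr)
  have mmse: "mmse \<mu> s = mmse \<nu> s" if "s > 0" for s
    using assms(10)[OF that] by (simp add: \<mu>_def \<nu>_def)
  note eq = mmse_eq_imp_cond_energy_eq[OF X.moment_law_axioms Y.moment_law_axioms a1 b1 mmse]
  have cum: "cumulant \<mu> (2 * n) = fact (2 * n - 1) * fps_nth (lead_cumulant ?a) (2 * n)" if "n \<ge> 1" for n
    using X.cumulant_Suc[of "2 * n - 1"] that by simp
  \<comment> \<open>Passing from cumulants to \<open>lead_cumulant\<close> divides by positive
    factorials and keeps the signs.\<close>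
  have alt: "fps_nth (lead_cumulant ?a) (2 * n) * fps_nth (lead_cumulant ?a) (2 * n + 2) < 0" if "n \<ge> 1" for n
    using assms(6)[OF that] cum[OF that] cum[of "Suc n"]
    by (simp add: \<mu>_def[symmetric] mult_less_0_iff zero_less_mult_iff)
  \<comment> \<open>The variance is nonnegative, and it is nonzero because the product of the second
    and fourth cumulants is negative.\<close>
  have pos: "?a 2 > 0"
    using alt[of 1] lead_cumulant_2[of ?a] a1 X.moment_0 X.moment_2_nonneg by (cases "?a 2 = 0") auto
  have four: "fps_nth (lead_cumulant ?b) 4 * fps_nth (lead_cumulant ?a) 4 > 0"
    using assms(9) X.cumulant_Suc[of 3] Y.cumulant_Suc[of 3]
    by (simp add: \<mu>_def[symmetric] \<nu>_def[symmetric] zero_less_mult_iff mult_less_0_iff)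
  have "?b k = ?a k" for k
    by (rule moments_eqI[OF X.moment_0 a1 Y.moment_0 b1 _ _ pos X.symmetric_odd_lead_cumulant[OF smd(2)] alt four])
       (use eq in simp_all)
  \<comment> \<open>Determinacy by moments, the last ingredient of \<open>SMD\<close>, turns equal
    moments into equal laws.\<close>
  then have "\<nu> = \<mu>"
    by (intro smd(4)[OF \<nu>]) (simp add: moment_def)
  then show ?thesis by (simp add: \<mu>_def \<nu>_def)
qed

end
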